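(* Let $T$ be an ergodic automorphism (invertible, bimeasurable, measure preserving) of a probability space $(\Omega,\mathcal A,\mu)$, and let $(\mathcal F_i)_{i\in\mathbb Z}$ be a filtration of sub-$\sigma$-algebras of $\mathcal A$ ($\mathcal F_i\subset\mathcal F_{i+1}$) with $\mathcal F_{i+1}=T^{-1}\mathcal F_i$ for all $i$. Assume that regular conditional probabilities $m_\omega$, $\omega\in\Omega$, with respect to $\mathcal F_0$ exist. Let $e\in L^2(\mathcal F_0)\ominus L^2(\mathcal F_{-1})$ with $\|e\|_2=1$, let $(a_i)_{i\ge 0}$ be real numbers with $\sum_{i=0}^\infty a_i^2<\infty$, and set $$f=\sum_{i=0}^\infty a_i\, e\circ T^{-i},\qquad S_n=\sum_{i=0}^{n-1} f\circ T^i,\quad n\ge 1 .$$ Put $b_0=0$, $b_j=\sum_{i=0}^{j-1}a_i$ for $j\ge 1$, and $$\bar\sigma_n^2=E\big[(S_n-E(S_n\mid\mathcal F_0))^2\big]=\sum_{k=1}^{n-1} b_{n-k}^2 .$$ Suppose $\bar\sigma_n^2\to\infty$ as $n\to\infty$. If at least one of the following holds: (i) the random variables $e\circ T^i$, $i\in\mathbb Z$, are independent and identically distributed and $(\mathcal F_i)_i$ is their natural filtration, i.e. $\mathcal F_i=\sigma\{e\circ T^j: j\le i\}$; (ii) $$\sup_{n\ge 1,\ \bar\sigma_n>0}\ \max_{k\le n}\ \frac{n\,b_k^2}{\bar\sigma_n^2}<\infty ;$$ then $\frac{1}{\bar\sigma_n}\,[S_n-E(S_n\mid\mathcal F_0)]$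 satisfies a quenched central limit theorem: for $\mu$-almost every $\omega$, the distributions of $\frac{1}{\bar\sigma_n}[S_n-E(S_n\mid\mathcal F_0)]$ under the probability measure $m_\omega$ converge weakly to the standard normal law $\mathcal N(0,1)$ as $n\to\infty$.
   Context: $L^2(\mathcal F_0)\ominus L^2(\mathcal F_{-1})$ denotes the orthogonal complement of $L^2(\mathcal F_{-1})$ in $L^2(\mathcal F_0)$ (spaces of square integrable functions measurable with respect to the indicated $\sigma$-algebra), so that $(e\circ T^i)_i$ is a stationary martingale difference sequence adapted to $(\mathcal F_i)_i$. $m_\omega$ is the regular conditional probability given $\mathcal F_0$: $m_\omega$ is a probability measure on $\mathcal A$ and $\omega\mapsto m_\omega(A)$ is a version of $\mu(A\mid\mathcal F_0)$ for each $A\in\mathcal A$. In the maximum, $k$ ranges over integers $1\le k\le n$. *)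

theory Defs
  imports "HOL-Probability.Probability"
begin

definition automorphism :: "'a measure \<Rightarrow> ('a \<Rightarrow> 'a) \<Rightarrow> bool" where
  "automorphism M T \<longleftrightarrow>
     bij_betw T (space M) (space M) \<and>
     T \<in> measurable M M \<and>
     inv_into (space M) T \<in> measurable M M \<and>
     (\<forall>A\<in>sets M. emeasure M (T -` A \<inter> space M) = emeasure M A)"

definition ergodic :: "'a measure \<Rightarrow> ('a \<Rightarrow> 'a) \<Rightarrow> bool" where
  "ergodic M T \<longleftrightarrow>
     (\<forall>A\<in>sets M. T -` A \<inter> space M = A \<longrightarrow> measure M A = 0 \<or> measure M A = 1)"

text \<open>The iterates of \<open>T\<close> over all integers, where \<open>T\<close> is only assumed invertible on \<open>space M\<close>.\<close>

definition iter :: "'a measure \<Rightarrow> ('a \<Rightarrow> 'a) \<Rightarrow> int \<Rightarrow> 'a \<Rightarrow> 'a" where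
  "iter M T i = (if 0 \<le> i then T ^^ nat i else (inv_into (space M) T) ^^ nat (- i))"

text \<open>Below, sub-\<open>\<sigma>\<close>-algebras are given as measures \<open>G\<close> with \<^term>\<open>subalgebra M G\<close>. Only
  \<^term>\<open>sets G\<close> matters; integrals are always taken with respect to \<open>M\<close>. Elements of \<open>L\<^sup>2\<close> are
  represented by functions, not by classes modulo null sets.\<close>

definition L2 :: "'a measure \<Rightarrow> 'a measure \<Rightarrow> ('a \<Rightarrow> real) set" where
  "L2 M G = {g \<in> borel_measurable G. integrable M (\<lambda>x. (g x)\<^sup>2)}"

definition L2_norm :: "'a measure \<Rightarrow> ('a \<Rightarrow> real) \<Rightarrow> real" where
  "L2_norm M g = sqrt (\<integral>x. (g x)\<^sup>2 \<partial>M)"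

definition L2_ominus :: "'a measure \<Rightarrow> 'a measure \<Rightarrow> 'a measure \<Rightarrow> ('a \<Rightarrow> real) set" where
  "L2_ominus M G H = {g \<in> L2 M G. \<forall>h\<in>L2 M H. (\<integral>x. g x * h x \<partial>M) = 0}"

definition L2_sums :: "'a measure \<Rightarrow> (nat \<Rightarrow> 'a \<Rightarrow> real) \<Rightarrow> ('a \<Rightarrow> real) \<Rightarrow> bool" where
  "L2_sums M u f \<longleftrightarrow>
     (\<forall>i. u i \<in> L2 M M) \<and> f \<in> L2 M M \<and>
     (\<lambda>N. L2_norm M (\<lambda>x. f x - (\<Sum>i<N. u i x))) \<longlonglongrightarrow> 0"

definition regular_cond_prob :: "'a measure \<Rightarrow> 'a measure \<Rightarrow> ('a \<Rightarrow> 'a measure) \<Rightarrow> bool" where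
  "regular_cond_prob M G m \<longleftrightarrow>
     (\<forall>\<omega>\<in>space M. prob_space (m \<omega>) \<and> sets (m \<omega>) = sets M) \<and>
     (\<forall>A\<in>sets M. (\<lambda>\<omega>. measure (m \<omega>) A) \<in> borel_measurable G \<and>
        (AE \<omega> in M. measure (m \<omega>) A = real_cond_exp M G (indicator A) \<omega>))"

definition birkhoff_sum :: "('a \<Rightarrow> 'a) \<Rightarrow> ('a \<Rightarrow> real) \<Rightarrow> nat \<Rightarrow> 'a \<Rightarrow> real" where
  "birkhoff_sum T f n x = (\<Sum>i<n. f ((T ^^ i) x))"

definition cond_centered :: "'a measure \<Rightarrow> 'a measure \<Rightarrow> ('a \<Rightarrow> real) \<Rightarrow> 'a \<Rightarrow> real" where
  "cond_centered M G X x = X x - real_cond_exp M G X x"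

definition sigma_bar :: "'a measure \<Rightarrow> 'a measure \<Rightarrow> ('a \<Rightarrow> 'a) \<Rightarrow> ('a \<Rightarrow> real) \<Rightarrow> nat \<Rightarrow> real" where
  "sigma_bar M G T f n = sqrt (\<integral>x. (cond_centered M G (birkhoff_sum T f n) x)\<^sup>2 \<partial>M)"

end

theory Submission
  imports Defs
begin

text \<open>Write \<open>e\<^sub>j = e \<circ> T\<^sup>j\<close>. Subtracting \<open>E(S\<^sub>n | F\<^sub>0)\<close> removes exactly the terms with nonpositive index, so
  the centered sum is \<open>b\<^sub>n\<^sub>-\<^sub>1 e\<^sub>1 + \<dots> + b\<^sub>1 e\<^sub>n\<^sub>-\<^sub>1\<close> almost surely, and orthogonality gives the variance.
  For almost every \<open>\<omega>\<close> this is a martingale array under \<open>m\<^sub>\<omega>\<close>, with respect to a countably generated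
  filtration inside \<open>F\<close>; countable generation is what allows one null set for all the martingale
  identities. Let \<open>h\<^sub>K\<close> be the conditional expectation of \<open>e\<^sup>2 1{e\<^sup>2 \<ge> K}\<close> given \<open>F\<^sub>-\<^sub>1\<close>. The martingale central
  limit theorem, proved by stopping as soon as the conditional variance exceeds 2, needs that the weights
  \<open>b\<^sub>k\<^sup>2 / \<sigma>\<^sub>n\<^sup>2\<close> are uniformly small, which follows from \<open>\<Sum> a\<^sub>i\<^sup>2 < \<infinity>\<close>, and that for all \<open>K\<close> the weighted sums
  of the \<open>h\<^sub>K \<circ> T\<^sup>k\<close> converge almost surely to the mean of \<open>h\<^sub>K\<close>; \<open>K = 0\<close> is the convergence of the conditional
  variances, and \<open>K\<close> tending to infinity gives the Lindeberg condition. In case (i) the \<open>h\<^sub>K\<close> are constant.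
  In case (ii) the weights are \<open>O(1/n)\<close> and vary slowly since \<open>a\<^sub>i\<close> tends to 0, and Birkhoff's theorem applies.\<close>

section \<open>Birkhoff's ergodic theorem\<close>

text \<open>The link between the two measures is that an \<open>M\<close>-null set is
  \<open>m \<omega>\<close>-null for almost every \<omega>. Almost sure convergence therefore passes
  from \<open>M\<close> to \<open>m \<omega>\<close> along the whole sequence, which convergence in
  probability or in mean would not do; this is why the weighted conditional variances have to
  converge pointwise. Ergodic theorems cannot be applied under \<open>m \<omega>\<close>, which need
  not be \<open>T\<close>-invariant, so all ergodic input is obtained under \<open>M\<close> and
  then transferred. The ergodic theorem does not apply to the weighted sums as they stand: the
  weights form a triangular array that runs backwards in time, and no limit of the weights is
  assumed to exist. The way out is that slowly varying weights cannot distinguish a sequence from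
  its average over windows of fixed length. The window averages are already close to the mean in L1,
  so an upper bound on the weights is all that is used of their size.\<close>

locale measure_preserving = prob_space M for M :: "'a measure" +
  fixes T :: "'a \<Rightarrow> 'a"
  assumes T_measurable [measurable]: "T \<in> M \<rightarrow>\<^sub>M M"
    and distr_T: "distr M M T = M"
begin

lemma funpow_measurable [measurable]: "(T ^^ n) \<in> M \<rightarrow>\<^sub>M M"
  by (induction n) auto

lemma distr_funpow: "distr M M (T ^^ n) = M"
proof (induction n)
  case (Suc n)
  have "distr M M (T ^^ Suc n) = distr (distr M M (T ^^ n)) M T"
    by (subst distr_distr) auto
  then show ?case using Suc distr_T by argo
qed (simp add: distr_id2)

lemma integrable_funpow:
  fixes u :: "'a \<Rightarrow> real"
  assumes "integrable M u"
  shows "integrable M (\<lambda>x. u ((T ^^ n) x))"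
  using assms integrable_distr_eq[OF funpow_measurable, of u n] by (simp add: distr_funpow)

lemma integral_funpow:
  fixes u :: "'a \<Rightarrow> real"
  assumes [measurable]: "u \<in> borel_measurable M"
  shows "(\<integral>x. u ((T ^^ n) x) \<partial>M) = (\<integral>x. u x \<partial>M)"
  using integral_distr[OF funpow_measurable assms, of n] by (simp add: distr_funpow)

lemma AE_funpow:
  assumes "AE x in M. P x"
  shows "AE x in M. P ((T ^^ n) x)"
proof -
  obtain N where N: "{x \<in> space M. \<not> P x} \<subseteq> N" "emeasure M N = 0" "N \<in> sets M"
    using assms by (rule AE_E)
  have "AE x in distr M M (T ^^ n). x \<notin> N"
    using N by (simp add: distr_funpow AE_not_in null_setsI)
  moreover have "Measurable.pred M (\<lambda>x. x \<notin> N)" using N by measurable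
  ultimately have "AE x in M. (T ^^ n) x \<notin> N"
    by (subst (asm) AE_distr_iff) (auto simp: pred_def)
  then show ?thesis
    using AE_space by eventually_elim (use N measurable_space[OF funpow_measurable] in blast)
qed

end

section \<open>The maximal ergodic inequality\<close>

lemma birkhoff_sum_0 [simp]: "birkhoff_sum T u 0 x = 0"
  by (simp add: birkhoff_sum_def)

lemma birkhoff_sum_Suc: "birkhoff_sum T u (Suc n) x = u x + birkhoff_sum T u n (T x)"
  by (simp add: birkhoff_sum_def sum.lessThan_Suc_shift funpow_swap1 del: sum.lessThan_Suc)

text \<open>This is the maximum of \<open>birkhoff_sum T u k x\<close> over
  \<open>0 \<le> k \<le> n\<close>, given by the recursion that Garsia's proof of the maximal
  inequality exploits.\<close>

primrec max_birkhoff_sum :: "('a \<Rightarrow> 'a) \<Rightarrow> ('a \<Rightarrow> real) \<Rightarrow> nat \<Rightarrow> 'a \<Rightarrow> real" where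
  "max_birkhoff_sum T u 0 x = 0"
| "max_birkhoff_sum T u (Suc n) x = max 0 (u x + max_birkhoff_sum T u n (T x))"

lemma max_birkhoff_sum_nonneg: "0 \<le> max_birkhoff_sum T u n x"
  by (cases n) auto

lemma max_birkhoff_sum_le_Suc: "max_birkhoff_sum T u n x \<le> max_birkhoff_sum T u (Suc n) x"
proof (induction n arbitrary: x)
  case (Suc n)
  show ?case using Suc[of "T x"] by (simp add: max_def)
qed simp

lemma max_birkhoff_sum_mono: "m \<le> n \<Longrightarrow> max_birkhoff_sum T u m x \<le> max_birkhoff_sum T u n x"
  by (rule lift_Suc_mono_le[of "\<lambda>n. max_birkhoff_sum T u n x"]) (rule max_birkhoff_sum_le_Suc)

lemma birkhoff_sum_le_max: "birkhoff_sum T u n x \<le> max_birkhoff_sum T u n x"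
proof (induction n arbitrary: x)
  case (Suc n)
  then show ?case by (simp add: birkhoff_sum_Suc le_max_iff_disj)
qed simp

context measure_preserving
begin

lemma birkhoff_sum_measurable [measurable]:
  assumes [measurable]: "u \<in> borel_measurable M"
  shows "birkhoff_sum T u n \<in> borel_measurable M"
  unfolding birkhoff_sum_def[abs_def] by measurable

lemma integrable_max_birkhoff_sum:
  assumes "integrable M u"
  shows "integrable M (max_birkhoff_sum T u n)"
proof (induction n)
  case (Suc n)
  have "integrable M (\<lambda>x. max 0 (u x + max_birkhoff_sum T u n ((T ^^ 1) x)))"
    using integrable_funpow[OF Suc, of 1] assms by (intro integrable_max Bochner_Integration.integrable_add) auto
  then show ?case by (simp add: comp_def)
next
  case 0
  have "max_birkhoff_sum T u 0 = (\<lambda>x. 0)" by auto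
  then show ?case by simp
qed

text \<open>Garsia's argument: where the maximum is positive it equals \<open>u x\<close> plus the
  previous maximum at \<open>T x\<close>, hence is at most \<open>u x + ?m (T x)\<close>; elsewhere
  it is 0 and \<open>?m (T x)\<close> is nonnegative. Integrating \<open>?m x - ?m (T x)\<close>
  gives 0 by invariance.\<close>

theorem maximal_ergodic:
  assumes u: "integrable M u"
  shows "0 \<le> (\<integral>x. indicator {x. 0 < max_birkhoff_sum T u n x} x * u x \<partial>M)"
proof -
  let ?m = "max_birkhoff_sum T u n"
  have int: "integrable M ?m" by (rule integrable_max_birkhoff_sum[OF u])
  note [measurable] = borel_measurable_integrable[OF int] borel_measurable_integrable[OF u]
  have T: "integrable M (\<lambda>x. ?m (T x))" "(\<integral>x. ?m (T x) \<partial>M) = (\<integral>x. ?m x \<partial>M)"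
    using integrable_funpow[OF int, of 1] integral_funpow[of ?m 1] by simp_all
  have le: "?m x - ?m (T x) \<le> indicator {x. 0 < ?m x} x * u x" for x
  proof (cases n)
    case (Suc k)
    show ?thesis
      using max_birkhoff_sum_le_Suc[of T u k "T x"] max_birkhoff_sum_nonneg[of T u n "T x"]
      unfolding Suc by (simp add: indicator_def max_def del: max_birkhoff_sum.simps(2) add: max_birkhoff_sum.simps(2)[of T u k x])
  qed simp
  have "0 = (\<integral>x. ?m x - ?m (T x) \<partial>M)" using int T by simp
  also have "\<dots> \<le> (\<integral>x. indicator {x. 0 < ?m x} x * u x \<partial>M)"
  proof (rule integral_mono)
    show "integrable M (\<lambda>x. ?m x - ?m (T x))" using int T by simp
    show "integrable M (\<lambda>x. indicator {x. 0 < ?m x} x * u x)"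
      using integrable_real_mult_indicator[OF _ u, of "{x \<in> space M. 0 < ?m x}"]
      by (rule Bochner_Integration.integrable_cong[THEN iffD1, OF refl, rotated])
        (auto simp: indicator_def)
  qed (use le in simp)
  finally show ?thesis .
qed

end

section \<open>Pointwise and mean ergodic theorems\<close>

locale ergodic_system = measure_preserving +
  assumes erg: "ergodic M T"
begin

text \<open>The set where the Birkhoff sums are unbounded above is invariant; if it had full measure,
  the maximal ergodic inequality would pass to the limit and give a nonnegative mean.\<close>

lemma AE_bounded_birkhoff_sum:
  assumes u: "integrable M u" and neg: "(\<integral>x. u x \<partial>M) < 0"
  shows "AE x in M. \<exists>N::nat. \<forall>n. birkhoff_sum T u n x \<le> real N"
proof -
  note [measurable] = borel_measurable_integrable[OF u]
  define A where "A = {x \<in> space M. \<forall>N::nat. \<exists>n. real N < birkhoff_sum T u n x}"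
  have [measurable]: "A \<in> sets M" unfolding A_def by measurable
  have *: "(\<forall>N::nat. \<exists>n. real N < birkhoff_sum T u n (T x)) \<longleftrightarrow> (\<forall>N::nat. \<exists>n. real N < birkhoff_sum T u n x)" for x
  proof safe
    fix N :: nat assume H: "\<forall>N::nat. \<exists>n. real N < birkhoff_sum T u n (T x)"
    \<comment> \<open>The sums at \<open>x\<close> and at \<open>T x\<close> differ by
      \<open>u x\<close>, which the added ceiling absorbs.\<close>
    obtain n where "real (N + nat \<lceil>\<bar>u x\<bar>\<rceil>) < birkhoff_sum T u n (T x)" using H by blast
    then have "real N < birkhoff_sum T u (Suc n) x" unfolding birkhoff_sum_Suc by linarith
    then show "\<exists>n. real N < birkhoff_sum T u n x" by blast
  next
    fix N :: nat assume H: "\<forall>N::nat. \<exists>n. real N < birkhoff_sum T u n x"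
    obtain n where n: "real (N + nat \<lceil>\<bar>u x\<bar>\<rceil>) < birkhoff_sum T u n x" using H by blast
    moreover obtain k where "n = Suc k"
    proof (cases n)
      case 0
      then show ?thesis using n of_nat_0_le_iff[of "N + nat \<lceil>\<bar>u x\<bar>\<rceil>", where ?'a = real] unfolding 0 birkhoff_sum_0 by linarith
    qed
    ultimately have "real N < birkhoff_sum T u k (T x)" by (simp add: birkhoff_sum_Suc) linarith
    then show "\<exists>n. real N < birkhoff_sum T u n (T x)" by blast
  qed
  have "T -` A \<inter> space M = A"
    unfolding A_def using * measurable_space[OF T_measurable] by auto
  then have "prob A = 0 \<or> prob A = 1"
    using erg unfolding ergodic_def by auto
  moreover have "prob A \<noteq> 1"
  proof
    assume "prob A = 1"
    then have A: "AE x in M. x \<in> A" by (simp add: prob_eq_1)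
    let ?I = "\<lambda>n. \<integral>x. indicator {x. 0 < max_birkhoff_sum T u n x} x * u x \<partial>M"
    note [measurable] = borel_measurable_integrable[OF integrable_max_birkhoff_sum[OF u]]
    \<comment> \<open>On \<open>A\<close> some Birkhoff sum is positive, so from that
      \<open>n\<close> on the indicator is 1.\<close>
    have "?I \<longlonglongrightarrow> (\<integral>x. u x \<partial>M)"
    proof (rule integral_dominated_convergence[where w = "\<lambda>x. \<bar>u x\<bar>"])
      show "AE x in M. (\<lambda>n. indicator {x. 0 < max_birkhoff_sum T u n x} x * u x) \<longlonglongrightarrow> u x"
        using A
      proof eventually_elim
        case (elim x)
        then obtain n where "real 0 < birkhoff_sum T u n x" unfolding A_def by blast
        then have "0 < max_birkhoff_sum T u k x" if "n \<le> k" for k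
          using birkhoff_sum_le_max[of T u n x] max_birkhoff_sum_mono[OF that, of T u x] by linarith
        then show ?case
          by (intro tendsto_eventually eventually_sequentiallyI[of n]) simp
      qed
    next
      show "(\<lambda>x. indicator {x. 0 < max_birkhoff_sum T u n x} x * u x) \<in> borel_measurable M" for n
        by (rule measurable_cong[THEN iffD1, of _ "\<lambda>x. indicator {x \<in> space M. 0 < max_birkhoff_sum T u n x} x * u x"])
          (auto simp: indicator_def)
      show "AE x in M. norm (indicator {x. 0 < max_birkhoff_sum T u n x} x * u x) \<le> \<bar>u x\<bar>" for n
        by (auto simp: indicator_def)
      show "integrable M (\<lambda>x. \<bar>u x\<bar>)" using u by simp
    qed measurable
    then have "0 \<le> (\<integral>x. u x \<partial>M)"
      by (rule LIMSEQ_le_const) (use maximal_ergodic[OF u] in blast)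
    with neg show False by simp
  qed
  ultimately have "AE x in M. x \<notin> A" by (simp add: prob_eq_0)
  with AE_space show ?thesis
    by eventually_elim (auto simp: A_def not_less)
qed

lemma birkhoff_sum_uminus: "birkhoff_sum T (\<lambda>x. - u x) n x = - birkhoff_sum T u n x" for u :: "'a \<Rightarrow> real"
  by (simp add: birkhoff_sum_def sum_negf)

text \<open>Lowering \<open>u\<close> by slightly more than its mean makes the mean negative, so the
  lowered sums stay bounded and vanish after division by \<open>n\<close>. Excesses of the form
  \<open>1 / Suc k\<close> keep the exceptional sets countable in number.\<close>

lemma birkhoff_upper:
  assumes u: "integrable M u"
  shows "AE x in M. \<forall>\<epsilon>>0. eventually (\<lambda>n. birkhoff_sum T u n x / real n < (\<integral>x. u x \<partial>M) + \<epsilon>) sequentially"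
proof -
  let ?E = "\<integral>x. u x \<partial>M"
  have "AE x in M. \<exists>N::nat. \<forall>n. birkhoff_sum T (\<lambda>x. u x - (?E + 1 / Suc k)) n x \<le> real N" for k :: nat
    by (rule AE_bounded_birkhoff_sum) (use u in \<open>auto simp: prob_space\<close>)
  then have "AE x in M. \<forall>k::nat. \<exists>N::nat. \<forall>n. birkhoff_sum T (\<lambda>x. u x - (?E + 1 / Suc k)) n x \<le> real N"
    by (simp add: AE_all_countable)
  then show ?thesis
  proof eventually_elim
    case (elim x)
    show ?case
    proof (intro allI impI)
      fix \<epsilon> :: real assume "0 < \<epsilon>"
      then obtain k :: nat where k: "1 / Suc k < \<epsilon> / 2"
        using nat_approx_posE[of "\<epsilon> / 2"] by auto
      obtain N :: nat where N: "\<And>n. birkhoff_sum T (\<lambda>x. u x - (?E + 1 / Suc k)) n x \<le> real N"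
        using elim by metis
      have "(\<lambda>n. real N / real n) \<longlonglongrightarrow> 0" by (rule lim_const_over_n)
      then have "eventually (\<lambda>n. real N / real n < \<epsilon> / 2) sequentially"
        by (rule order_tendstoD) (use \<open>0 < \<epsilon>\<close> in simp)
      then show "eventually (\<lambda>n. birkhoff_sum T u n x / real n < ?E + \<epsilon>) sequentially"
        using eventually_gt_at_top[of 0]
      proof eventually_elim
        case (elim n)
        have "birkhoff_sum T u n x \<le> real n * (?E + 1 / Suc k) + real N"
          using N[of n] by (simp add: birkhoff_sum_def sum_subtractf)
        then have "birkhoff_sum T u n x / real n \<le> (real n * (?E + 1 / Suc k) + real N) / real n"
          by (intro divide_right_mono) auto
        also have "\<dots> = ?E + 1 / Suc k + real N / real n"
          using elim by (simp add: field_simps)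
        finally show ?case using k elim by linarith
      qed
    qed
  qed
qed

theorem birkhoff:
  assumes u: "integrable M u"
  shows "AE x in M. (\<lambda>n. birkhoff_sum T u n x / real n) \<longlonglongrightarrow> (\<integral>x. u x \<partial>M)"
  using birkhoff_upper[OF u] birkhoff_upper[OF integrable_minus[OF u]]
proof eventually_elim
  case (elim x)
  show ?case
  proof (rule LIMSEQ_I)
    fix r :: real assume "0 < r"
    then have "eventually (\<lambda>n. birkhoff_sum T u n x / real n < (\<integral>x. u x \<partial>M) + r) sequentially"
      "eventually (\<lambda>n. birkhoff_sum T (\<lambda>x. - u x) n x / real n < (\<integral>x. - u x \<partial>M) + r) sequentially"
      using elim by auto
    then have "eventually (\<lambda>n. norm (birkhoff_sum T u n x / real n - (\<integral>x. u x \<partial>M)) < r) sequentially"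
      by eventually_elim (simp add: birkhoff_sum_uminus abs_less_iff)
    then show "\<exists>no. \<forall>n\<ge>no. norm (birkhoff_sum T u n x / real n - (\<integral>x. u x \<partial>M)) < r"
      by (simp add: eventually_sequentially)
  qed
qed

text \<open>Scheffe's lemma: for nonnegative functions, pointwise convergence together with control
  of the integrals gives convergence in L1. It makes the averages over long windows close to the
  mean.\<close>

theorem mean_ergodic_L1:
  assumes u: "integrable M u" and nonneg: "\<And>x. 0 \<le> u x"
  shows "(\<lambda>n. \<integral>x. \<bar>birkhoff_sum T u n x / real n - (\<integral>x. u x \<partial>M)\<bar> \<partial>M) \<longlonglongrightarrow> 0"
proof -
  let ?E = "\<integral>x. u x \<partial>M"
  note [measurable] = borel_measurable_integrable[OF u]
  have int: "integrable M (\<lambda>x. birkhoff_sum T u n x / real n)" for n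
    unfolding birkhoff_sum_def
    using integrable_funpow[OF u] by (intro integrable_divide Bochner_Integration.integrable_sum) auto
  \<comment> \<open>At \<open>n = 0\<close> division by zero yields 0, which is harmless: only an
    upper bound on the integrals enters.\<close>
  have E: "(\<integral>x. birkhoff_sum T u n x / real n \<partial>M) = (if n = 0 then 0 else ?E)" for n
    unfolding birkhoff_sum_def
    by (simp add: integral_funpow integrable_funpow u Bochner_Integration.integral_sum)
  have pos: "0 \<le> birkhoff_sum T u n x / real n" for n x
    unfolding birkhoff_sum_def by (intro divide_nonneg_nonneg sum_nonneg nonneg) auto
  have "(\<lambda>n. \<integral>\<^sup>+ x. norm (birkhoff_sum T u n x / real n - ?E) \<partial>M) \<longlonglongrightarrow> 0"
  proof (rule Scheffe_lemma2)
    show "AE x in M. (\<lambda>n. birkhoff_sum T u n x / real n) \<longlonglongrightarrow> ?E" by (rule birkhoff[OF u])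
    have E0: "0 \<le> ?E" using nonneg by simp
    show "(\<integral>\<^sup>+ x. norm (birkhoff_sum T u n x / real n) \<partial>M) \<le> (\<integral>\<^sup>+ x. norm ?E \<partial>M)" for n
    proof -
      have "(\<integral>\<^sup>+ x. norm (birkhoff_sum T u n x / real n) \<partial>M) = (\<integral>\<^sup>+ x. ennreal (birkhoff_sum T u n x / real n) \<partial>M)"
        using pos[of n] by (intro nn_integral_cong arg_cong[where f = ennreal]) (metis abs_of_nonneg real_norm_def)
      also have "\<dots> = ennreal (\<integral>x. birkhoff_sum T u n x / real n \<partial>M)"
        using pos[of n] by (intro nn_integral_eq_integral int) auto
      also have "\<dots> \<le> ennreal ?E" unfolding E using E0 by simp
      finally show ?thesis using E0 by (simp add: emeasure_space_1)
    qed
  qed (use int in auto)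
  moreover have "(\<integral>\<^sup>+ x. norm (birkhoff_sum T u n x / real n - ?E) \<partial>M) = ennreal (\<integral>x. \<bar>birkhoff_sum T u n x / real n - ?E\<bar> \<partial>M)" for n
    using int[of n] by (subst nn_integral_eq_integral) auto
  ultimately show ?thesis
    by (simp add: tendsto_ennreal_iff[where x = 0, simplified])
qed

end

section \<open>Disintegration by a regular conditional probability\<close>

locale disintegration = prob_space M for M :: "'a measure" +
  fixes G :: "'a measure" and m :: "'a \<Rightarrow> 'a measure"
  assumes sub: "subalgebra M G" and rcp: "regular_cond_prob M G m"
begin

sublocale finite_measure_subalgebra M G
  by unfold_locales (rule sub)

lemma kernel_prob_space: "\<omega> \<in> space M \<Longrightarrow> prob_space (m \<omega>)"
  and sets_kernel: "\<omega> \<in> space M \<Longrightarrow> sets (m \<omega>) = sets M"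
  using rcp unfolding regular_cond_prob_def by blast+

lemma space_kernel: "\<omega> \<in> space M \<Longrightarrow> space (m \<omega>) = space M"
  by (rule sets_eq_imp_space_eq) (rule sets_kernel)

lemma kernel_measurable_sub [measurable]: "m \<in> G \<rightarrow>\<^sub>M subprob_algebra M"
proof (rule measurable_subprob_algebra)
  have sp: "space G = space M" using sub by (simp add: subalgebra_def)
  fix \<omega> assume "\<omega> \<in> space G"
  then have \<omega>: "\<omega> \<in> space M" by (simp add: sp)
  show "subprob_space (m \<omega>)" using kernel_prob_space[OF \<omega>] by (rule prob_space_imp_subprob_space)
  show "sets (m \<omega>) = sets M" using sets_kernel[OF \<omega>] .
next
  fix A assume "A \<in> sets M"
  then have [measurable]: "(\<lambda>\<omega>. measure (m \<omega>) A) \<in> borel_measurable G"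
    using rcp unfolding regular_cond_prob_def by auto
  have "emeasure (m \<omega>) A = ennreal (measure (m \<omega>) A)" if "\<omega> \<in> space G" for \<omega>
  proof -
    interpret P: prob_space "m \<omega>" using that sub kernel_prob_space by (simp add: subalgebra_def)
    show ?thesis by (rule P.emeasure_eq_measure)
  qed
  then show "(\<lambda>\<omega>. emeasure (m \<omega>) A) \<in> borel_measurable G"
    by (subst measurable_cong[where g = "\<lambda>\<omega>. ennreal (measure (m \<omega>) A)"]) auto
qed

lemma kernel_measurable [measurable]: "m \<in> M \<rightarrow>\<^sub>M subprob_algebra M"
  by (rule measurable_from_subalg[OF sub kernel_measurable_sub])

text \<open>The defining property of the kernel, read as an equality of measures: mixing the
  \<open>m \<omega>\<close> over a set of \<open>G\<close> restores \<open>M\<close> on that set. In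
  this form it extends from sets to all nonnegative functions through the integral of a
  \<open>bind\<close>.\<close>

lemma bind_density_indicator:
  assumes A: "A \<in> sets G"
  shows "density M (indicator A) \<bind> m = density M (indicator A)"
proof (rule measure_eqI)
  have [measurable]: "A \<in> sets M" using A sub by (auto simp: subalgebra_def)
  have ne: "space M \<noteq> {}" by (rule not_empty)
  have m: "m \<in> density M (indicator A) \<rightarrow>\<^sub>M subprob_algebra M" by simp
  show sets: "sets (density M (indicator A) \<bind> m) = sets (density M (indicator A))"
    using sets_bind[of "density M (indicator A)" m M] sets_kernel ne by simp
  fix B assume "B \<in> sets (density M (indicator A) \<bind> m)"
  then have B [measurable]: "B \<in> sets M" unfolding sets by simp
  have iB: "integrable M (indicator B :: 'a \<Rightarrow> real)" by (rule integrable_real_indicator) (auto simp: less_top[symmetric])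
  have "emeasure (density M (indicator A) \<bind> m) B = (\<integral>\<^sup>+\<omega>. indicator A \<omega> * emeasure (m \<omega>) B \<partial>M)"
    using ne by (subst emeasure_bind[OF _ m B]) (simp_all add: nn_integral_density)
  also have "\<dots> = (\<integral>\<^sup>+\<omega>. ennreal (indicator A \<omega> * real_cond_exp M G (indicator B) \<omega>) \<partial>M)"
  proof (rule nn_integral_cong_AE)
    have "AE \<omega> in M. measure (m \<omega>) B = real_cond_exp M G (indicator B) \<omega>"
      using rcp B unfolding regular_cond_prob_def by auto
    with AE_space show "AE \<omega> in M. indicator A \<omega> * emeasure (m \<omega>) B = ennreal (indicator A \<omega> * real_cond_exp M G (indicator B) \<omega>)"
    proof eventually_elim
      case (elim \<omega>)
      interpret P: prob_space "m \<omega>" by (rule kernel_prob_space[OF elim(1)])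
      show ?case using elim(2) by (auto simp: P.emeasure_eq_measure indicator_def)
    qed
  qed
  also have "\<dots> = ennreal (\<integral>\<omega>. indicator A \<omega> * real_cond_exp M G (indicator B) \<omega> \<partial>M)"
  proof (rule nn_integral_eq_integral)
    show "integrable M (\<lambda>\<omega>. indicator A \<omega> * real_cond_exp M G (indicator B) \<omega>)"
      using integrable_mult_indicator[of A M "real_cond_exp M G (indicator B)"] real_cond_exp_int(1)[OF iB]
      by simp
    show "AE \<omega> in M. 0 \<le> indicator A \<omega> * real_cond_exp M G (indicator B) \<omega>"
      using real_cond_exp_pos[of "indicator B"] by auto
  qed
  also have "(\<integral>\<omega>. indicator A \<omega> * real_cond_exp M G (indicator B) \<omega> \<partial>M) = (\<integral>\<omega>. indicator A \<omega> * indicator B \<omega> \<partial>M)"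
  proof (rule real_cond_exp_intg(2))
    show "integrable M (\<lambda>\<omega>. indicator A \<omega> * indicator B \<omega> :: real)"
      using integrable_mult_indicator[OF _ iB, of A] by simp
  qed (use A in auto)
  also have "\<dots> = (\<integral>\<omega>. indicator (A \<inter> B) \<omega> \<partial>M)"
    by (rule Bochner_Integration.integral_cong) (auto simp: indicator_def)
  also have "\<dots> = measure M (A \<inter> B)" by simp
  also have "ennreal \<dots> = (\<integral>\<^sup>+\<omega>. indicator (A \<inter> B) \<omega> \<partial>M)"
    by (simp add: emeasure_eq_measure)
  also have "\<dots> = (\<integral>\<^sup>+\<omega>. indicator A \<omega> * indicator B \<omega> \<partial>M)"
    by (rule nn_integral_cong) (auto simp: indicator_def)
  also have "\<dots> = emeasure (density M (indicator A)) B"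
    by (simp add: emeasure_density)
  finally show "emeasure (density M (indicator A) \<bind> m) B = emeasure (density M (indicator A)) B" .
qed

lemma nn_integral_kernel:
  assumes A: "A \<in> sets G" and f [measurable]: "f \<in> borel_measurable M"
  shows "(\<integral>\<^sup>+\<omega>. indicator A \<omega> * (\<integral>\<^sup>+x. f x \<partial>m \<omega>) \<partial>M) = (\<integral>\<^sup>+x. indicator A x * f x \<partial>M)"
proof -
  have [measurable]: "A \<in> sets M" using A sub by (auto simp: subalgebra_def)
  have m: "m \<in> density M (indicator A) \<rightarrow>\<^sub>M subprob_algebra M" by simp
  have "(\<integral>\<^sup>+x. f x \<partial>density M (indicator A)) = (\<integral>\<^sup>+\<omega>. \<integral>\<^sup>+x. f x \<partial>m \<omega> \<partial>density M (indicator A))"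
    using nn_integral_bind[OF f m] by (simp add: bind_density_indicator[OF A])
  then show ?thesis by (simp add: nn_integral_density)
qed

lemma nn_integral_kernel_UNIV:
  assumes "f \<in> borel_measurable M"
  shows "(\<integral>\<^sup>+\<omega>. \<integral>\<^sup>+x. f x \<partial>m \<omega> \<partial>M) = (\<integral>\<^sup>+x. f x \<partial>M)"
proof -
  have sp: "space M \<in> sets G" using sub by (metis sets.top subalgebra_def)
  have "(\<integral>\<^sup>+\<omega>. \<integral>\<^sup>+x. f x \<partial>m \<omega> \<partial>M) = (\<integral>\<^sup>+\<omega>. indicator (space M) \<omega> * (\<integral>\<^sup>+x. f x \<partial>m \<omega>) \<partial>M)"
    by (rule nn_integral_cong) simp
  also have "\<dots> = (\<integral>\<^sup>+x. indicator (space M) x * f x \<partial>M)"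
    by (rule nn_integral_kernel[OF sp assms])
  also have "\<dots> = (\<integral>\<^sup>+x. f x \<partial>M)"
    by (rule nn_integral_cong) simp
  finally show ?thesis .
qed

text \<open>The \<open>m \<omega>\<close>-measures of an \<open>M\<close>-null set average to 0 and
  are nonnegative. Every almost sure statement reaches the quenched measures by this route.\<close>

lemma AE_kernel:
  assumes "AE x in M. P x"
  shows "AE \<omega> in M. AE x in m \<omega>. P x"
proof -
  obtain N where N: "{x \<in> space M. \<not> P x} \<subseteq> N" "emeasure M N = 0" "N \<in> sets M"
    using assms by (rule AE_E)
  note [measurable] = N(3)
  have "(\<integral>\<^sup>+\<omega>. \<integral>\<^sup>+x. indicator N x \<partial>m \<omega> \<partial>M) = 0"
    using N by (subst nn_integral_kernel_UNIV) auto
  then have "AE \<omega> in M. (\<integral>\<^sup>+x. indicator N x \<partial>m \<omega>) = 0"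
    by (subst (asm) nn_integral_0_iff_AE) auto
  with AE_space show ?thesis
  proof eventually_elim
    case (elim \<omega>)
    then have "N \<in> null_sets (m \<omega>)" using sets_kernel[OF elim(1)] N by (auto simp: null_sets_def)
    moreover have "{x \<in> space (m \<omega>). \<not> P x} \<subseteq> N" using space_kernel[OF elim(1)] N by auto
    ultimately show ?case by (rule AE_I')
  qed
qed

lemma AE_kernel_integrable:
  fixes X :: "'a \<Rightarrow> real"
  assumes X: "integrable M X"
  shows "AE \<omega> in M. integrable (m \<omega>) X"
proof -
  note [measurable] = borel_measurable_integrable[OF X]
  have "(\<integral>\<^sup>+\<omega>. \<integral>\<^sup>+x. norm (X x) \<partial>m \<omega> \<partial>M) < \<infinity>"
    using X by (subst nn_integral_kernel_UNIV) (auto simp: integrable_iff_bounded)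
  then have "AE \<omega> in M. (\<integral>\<^sup>+x. norm (X x) \<partial>m \<omega>) \<noteq> \<infinity>"
    by (intro nn_integral_PInf_AE) auto
  with AE_space show ?thesis
  proof eventually_elim
    case (elim \<omega>)
    have "X \<in> borel_measurable (m \<omega>)"
      by (subst measurable_cong_sets[OF sets_kernel[OF elim(1)] refl]) measurable
    with elim show ?case by (auto simp: integrable_iff_bounded top.not_eq_extremum)
  qed
qed

text \<open>Nonnegative functions come first because the mixing identity concerns
  \<open>nn_integral\<close>; the kernel integral is then recognised as a conditional expectation by
  its integrals over the sets of \<open>G\<close>.\<close>

lemma AE_kernel_integral_nonneg:
  fixes X :: "'a \<Rightarrow> real"
  assumes X: "integrable M X" and nonneg: "\<And>x. 0 \<le> X x"
  shows "AE \<omega> in M. (\<integral>x. X x \<partial>m \<omega>) = real_cond_exp M G X \<omega>"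
proof -
  note [measurable] = borel_measurable_integrable[OF X]
  let ?Y = "\<lambda>\<omega>. \<integral>x. X x \<partial>m \<omega>"
  have Y [measurable]: "?Y \<in> borel_measurable G"
    using measurable_comp[OF kernel_measurable_sub integral_measurable_subprob_algebra[of X M]] by (simp add: comp_def)
  have [measurable]: "?Y \<in> borel_measurable M" by (rule measurable_from_subalg[OF sub Y])
  have Y0: "0 \<le> ?Y \<omega>" for \<omega> using nonneg by simp
  \<comment> \<open>Where \<open>X\<close> is not \<open>m \<omega>\<close>-integrable the left side
    is 0 by convention and the equality fails, hence the null set.\<close>
  have eq: "AE \<omega> in M. ennreal (?Y \<omega>) = (\<integral>\<^sup>+x. X x \<partial>m \<omega>)"
    using AE_kernel_integrable[OF X] by eventually_elim (rule nn_integral_eq_integral[symmetric], auto simp: nonneg)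
  have nn: "(\<integral>\<^sup>+\<omega>. ennreal (indicator A \<omega> * ?Y \<omega>) \<partial>M) = (\<integral>\<^sup>+x. ennreal (indicator A x * X x) \<partial>M)" if A: "A \<in> sets G" for A
  proof -
    have "(\<integral>\<^sup>+\<omega>. ennreal (indicator A \<omega> * ?Y \<omega>) \<partial>M) = (\<integral>\<^sup>+\<omega>. indicator A \<omega> * (\<integral>\<^sup>+x. X x \<partial>m \<omega>) \<partial>M)"
    proof (rule nn_integral_cong_AE)
      show "AE \<omega> in M. ennreal (indicator A \<omega> * ?Y \<omega>) = indicator A \<omega> * (\<integral>\<^sup>+x. X x \<partial>m \<omega>)"
        using eq by eventually_elim (simp add: indicator_def)
    qed
    also have "\<dots> = (\<integral>\<^sup>+x. indicator A x * ennreal (X x) \<partial>M)"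
      by (rule nn_integral_kernel[OF A]) simp
    finally show ?thesis by (simp add: ennreal_mult' ennreal_indicator)
  qed
  have sp: "space M \<in> sets G" using sub by (metis sets.top subalgebra_def)
  have "(\<integral>\<^sup>+\<omega>. ennreal (?Y \<omega>) \<partial>M) = (\<integral>\<^sup>+\<omega>. ennreal (indicator (space M) \<omega> * ?Y \<omega>) \<partial>M)"
    by (rule nn_integral_cong) simp
  also have "\<dots> = (\<integral>\<^sup>+x. ennreal (indicator (space M) x * X x) \<partial>M)" by (rule nn[OF sp])
  also have "\<dots> = (\<integral>\<^sup>+x. ennreal (X x) \<partial>M)" by (rule nn_integral_cong) simp
  finally have int: "integrable M ?Y"
    using X Y0 nonneg by (simp add: integrable_iff_bounded)
  have *: "(\<integral>x\<in>A. X x \<partial>M) = (\<integral>x\<in>A. ?Y x \<partial>M)" if A: "A \<in> sets G" for A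
  proof -
    have [measurable]: "A \<in> sets M" using A sub by (auto simp: subalgebra_def)
    show ?thesis
      unfolding set_lebesgue_integral_def
      using nn[OF A] Y0 nonneg by (simp add: integral_eq_nn_integral)
  qed
  have "AE x in M. real_cond_exp M G X x = ?Y x"
    by (rule real_cond_exp_charact[OF _ X int Y]) (rule *)
  then show ?thesis by eventually_elim simp
qed

lemma AE_kernel_integral:
  fixes X :: "'a \<Rightarrow> real"
  assumes X: "integrable M X"
  shows "AE \<omega> in M. (\<integral>x. X x \<partial>m \<omega>) = real_cond_exp M G X \<omega>"
proof -
  let ?p = "\<lambda>x. max (X x) 0" and ?n = "\<lambda>x. max (- X x) 0"
  have p: "integrable M ?p" and n: "integrable M ?n" using X by auto
  have X': "?p x - ?n x = X x" for x by (auto simp: max_def)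
  have "AE \<omega> in M. (\<integral>x. ?p x \<partial>m \<omega>) = real_cond_exp M G ?p \<omega>"
    "AE \<omega> in M. (\<integral>x. ?n x \<partial>m \<omega>) = real_cond_exp M G ?n \<omega>"
    by (intro AE_kernel_integral_nonneg p n; simp)+
  then show ?thesis
    using AE_kernel_integrable[OF p] AE_kernel_integrable[OF n] real_cond_exp_diff[OF p n]
  proof eventually_elim
    case (elim \<omega>)
    then have "(\<integral>x. ?p x - ?n x \<partial>m \<omega>) = real_cond_exp M G (\<lambda>x. ?p x - ?n x) \<omega>" by simp
    then show ?case unfolding X' .
  qed
qed

text \<open>Countable generation makes the exceptional null set independent of the test set: the test sets
  with vanishing integral form a Dynkin system.\<close>

lemma AE_kernel_integral_sets_0:
  fixes X :: "'a \<Rightarrow> real"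
  assumes X: "integrable M X"
    and H: "sets H = sigma_sets (space M) E" "countable E" "Int_stable E" "sets H \<subseteq> sets M"
    and 0: "\<And>A. A \<in> sets H \<Longrightarrow> AE \<omega> in M. real_cond_exp M G (\<lambda>x. indicator A x * X x) \<omega> = 0"
  shows "AE \<omega> in M. \<forall>A\<in>sets H. (\<integral>x. indicator A x * X x \<partial>m \<omega>) = 0"
proof -
  have E: "E \<subseteq> sets M" using H by (auto simp: sigma_sets.Basic)
  \<comment> \<open>The whole space is added because \<open>E\<close> need not contain it, while the
    complement step below needs the total integral to vanish.\<close>
  have "AE \<omega> in M. (\<integral>x. indicator A x * X x \<partial>m \<omega>) = 0" if A: "A \<in> insert (space M) E" for A
  proof -
    have "A \<in> sets H" using A unfolding H(1) by (auto intro: sigma_sets_top sigma_sets.Basic)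
    then have "AE \<omega> in M. real_cond_exp M G (\<lambda>x. indicator A x * X x) \<omega> = 0" by (rule 0)
    moreover have "integrable M (\<lambda>x. indicator A x * X x)"
      using \<open>A \<in> sets H\<close> H(4) integrable_mult_indicator[OF _ X, of A] by auto
    note AE_kernel_integral[OF this]
    ultimately show ?thesis by eventually_elim simp
  qed
  then have "AE \<omega> in M. \<forall>A\<in>insert (space M) E. (\<integral>x. indicator A x * X x \<partial>m \<omega>) = 0"
    using H(2) by (intro AE_ball_countable') auto
  then show ?thesis
    using AE_space AE_kernel_integrable[OF X]
  proof eventually_elim
    case (elim \<omega>)
    note sets = sets_kernel[OF elim(2)] and sp = space_kernel[OF elim(2)] and int = elim(3)
    have intA: "integrable (m \<omega>) (\<lambda>x. indicator A x * X x)" if "A \<in> sets M" for A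
      using that int integrable_mult_indicator[of A "m \<omega>" X] sets by auto
    have sub': "sigma_sets (space M) E \<subseteq> sets M" using H by simp
    have tot: "(\<integral>x. X x \<partial>m \<omega>) = 0"
    proof -
      have "(\<integral>x. X x \<partial>m \<omega>) = (\<integral>x. indicator (space M) x * X x \<partial>m \<omega>)"
        by (rule Bochner_Integration.integral_cong) (auto simp: sp)
      then show ?thesis using elim(1) by simp
    qed
    show ?case
    proof
      fix A assume "A \<in> sets H"
      then have "A \<in> sigma_sets (space M) E" by (simp add: H(1))
      with H(3) sets.space_closed[THEN subset_trans[OF E]]
      show "(\<integral>x. indicator A x * X x \<partial>m \<omega>) = 0"
      proof (induction rule: sigma_sets_induct_disjoint)
        case (basic A)
        then show ?case using elim(1) by simp
      next
        case empty
        then show ?case by simp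
      next
        case (compl A)
        then have A: "A \<in> sets M" using sub' by auto
        have "(\<integral>x. indicator (space M - A) x * X x \<partial>m \<omega>) = (\<integral>x. X x - indicator A x * X x \<partial>m \<omega>)"
          by (rule Bochner_Integration.integral_cong) (auto simp: sp indicator_def)
        then show ?case using compl tot int intA[OF A] by simp
      next
        case (union A)
        then have A: "\<And>i. A i \<in> sets M" using sub' by auto
        let ?s = "\<lambda>n x. \<Sum>i<n. indicator (A i) x * X x"
        \<comment> \<open>\<open>X\<close> has no sign, so countable unions are reached by dominated
          convergence from finite ones, where disjointness splits the integral.\<close>
        have "(\<lambda>n. \<integral>x. indicator (\<Union>i<n. A i) x * X x \<partial>m \<omega>) \<longlonglongrightarrow> (\<integral>x. indicator (\<Union>i. A i) x * X x \<partial>m \<omega>)"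
        proof (rule integral_dominated_convergence[where w = "\<lambda>x. \<bar>X x\<bar>"])
          show "AE x in m \<omega>. (\<lambda>n. indicator (\<Union>i<n. A i) x * X x) \<longlonglongrightarrow> indicator (\<Union>i. A i) x * X x"
            by (intro AE_I2 tendsto_mult_right LIMSEQ_indicator_UN)
          show "(\<lambda>x. indicator (\<Union>i. A i) x * X x) \<in> borel_measurable (m \<omega>)"
            using A by (intro borel_measurable_integrable intA) auto
          show "(\<lambda>x. indicator (\<Union>i<n. A i) x * X x) \<in> borel_measurable (m \<omega>)" for n
            using A by (intro borel_measurable_integrable intA) auto
          show "AE x in m \<omega>. norm (indicator (\<Union>i<n. A i) x * X x) \<le> \<bar>X x\<bar>" for n
            by (auto simp: indicator_def)
        qed (use int in simp)
        moreover have "(\<integral>x. indicator (\<Union>i<n. A i) x * X x \<partial>m \<omega>) = 0" for n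
        proof -
          have "indicator (\<Union>i<n. A i) x * X x = ?s n x" for x
          proof -
            have "disjoint_family_on A {..<n}"
              using union(1) by (auto simp: disjoint_family_on_def)
            then have "indicator (\<Union>i<n. A i) x = (\<Sum>i<n. indicator (A i) x :: real)"
              by (intro indicator_UN_disjoint) auto
            then show ?thesis
              by (simp only: sum_distrib_right)
          qed
          then have "(\<integral>x. indicator (\<Union>i<n. A i) x * X x \<partial>m \<omega>) = (\<integral>x. ?s n x \<partial>m \<omega>)"
            by (rule Bochner_Integration.integral_cong[OF refl])
          also have "\<dots> = (\<Sum>i<n. \<integral>x. indicator (A i) x * X x \<partial>m \<omega>)"
            by (rule Bochner_Integration.integral_sum) (rule intA[OF A])
          finally show ?thesis using union(3) by simp
        qed
        ultimately show ?case by (simp add: LIMSEQ_const_iff)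
      qed
    qed
  qed
qed

end

section \<open>Countably generated sub-\<sigma>-algebras\<close>

text \<open>Take the preimages of a countable basis of the reals and close under finite
  intersections. The last clause says that the generated \<sigma>-algebra is the least one making
  all \<open>y i\<close> measurable; it serves to place that \<sigma>-algebra inside
  \<open>F k\<close>, which itself need not be countably generated.\<close>

lemma countable_generator:
  fixes y :: "'i \<Rightarrow> 'a \<Rightarrow> real"
  assumes "countable I"
  obtains E where "countable E" "Int_stable E" "E \<subseteq> Pow \<Omega>"
    "\<And>i. i \<in> I \<Longrightarrow> y i \<in> borel_measurable (sigma \<Omega> E)"
    "\<And>N. space N = \<Omega> \<Longrightarrow> (\<And>i. i \<in> I \<Longrightarrow> y i \<in> borel_measurable N) \<Longrightarrow> E \<subseteq> sets N"
proof -
  obtain B :: "real set set" where B: "countable B" "topological_basis B"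
    using ex_countable_basis by auto
  define E0 where "E0 = (\<lambda>(i, b). y i -` b \<inter> \<Omega>) ` (I \<times> B)"
  \<comment> \<open>Intersecting with \<open>\<Omega>\<close> gives the empty family a meaning: it
    contributes \<open>\<Omega>\<close>.\<close>
  define E where "E = (\<lambda>F. \<Inter>F \<inter> \<Omega>) ` {F. finite F \<and> F \<subseteq> E0}"
  have E0: "countable E0" unfolding E0_def using assms B by auto
  have E0E: "E0 \<subseteq> E"
  proof
    fix A assume "A \<in> E0"
    then have "A \<subseteq> \<Omega>" by (auto simp: E0_def)
    then show "A \<in> E" unfolding E_def using \<open>A \<in> E0\<close> by (intro image_eqI[of _ _ "{A}"]) auto
  qed
  have sub: "E \<subseteq> Pow \<Omega>" by (auto simp: E_def)
  show thesis
  proof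
    show "countable E" unfolding E_def by (intro countable_image countable_Collect_finite_subset E0)
    show "Int_stable E"
    proof (rule Int_stableI)
      fix a b assume "a \<in> E" "b \<in> E"
      then obtain F F' where F: "a = \<Inter>F \<inter> \<Omega>" "finite F" "F \<subseteq> E0" "b = \<Inter>F' \<inter> \<Omega>" "finite F'" "F' \<subseteq> E0"
        unfolding E_def by blast
      then show "a \<inter> b \<in> E" unfolding E_def by (intro image_eqI[of _ _ "F \<union> F'"]) auto
    qed
    show "E \<subseteq> Pow \<Omega>" by fact
    show "y i \<in> borel_measurable (sigma \<Omega> E)" if "i \<in> I" for i
      unfolding borel_eq_countable_basis[OF B]
    proof (rule measurable_measure_of)
      fix b assume "b \<in> B"
      then have "y i -` b \<inter> \<Omega> \<in> E0" using that unfolding E0_def by force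
      then show "y i -` b \<inter> space (sigma \<Omega> E) \<in> sets (sigma \<Omega> E)"
        using E0E sub by (auto simp: space_measure_of)
    qed auto
    show "E \<subseteq> sets N" if N: "space N = \<Omega>" "\<And>i. i \<in> I \<Longrightarrow> y i \<in> borel_measurable N" for N
    proof -
      have E0N: "E0 \<subseteq> sets N"
      proof
        fix A assume "A \<in> E0"
        then obtain i b where A: "A = y i -` b \<inter> \<Omega>" "i \<in> I" "b \<in> B" unfolding E0_def by auto
        then have "open b" using B by (simp add: topological_basis_open)
        then show "A \<in> sets N" using A N measurable_sets[of "y i" N borel b] by auto
      qed
      have "\<Inter>F \<inter> space N \<in> sets N" if "finite F" "F \<subseteq> E0" for F
        using that
      proof (induction F rule: finite_induct)
        case (insert A F)
        then have "A \<inter> (\<Inter>F \<inter> space N) \<in> sets N" using E0N by (blast intro: sets.Int)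
        then show ?case by (simp add: Int_assoc)
      qed simp
      then show ?thesis unfolding E_def N(1)[symmetric] by auto
    qed
  qed
qed

section \<open>A central limit theorem for martingale arrays\<close>

lemma exp_minus_second_order:
  fixes y :: real
  assumes "0 \<le> y"
  shows "\<bar>exp (- y) - 1 + y\<bar> \<le> y\<^sup>2 / 2"
proof -
  have "0 \<le> exp (- y) - 1 + y" using exp_ge_add_one_self[of "- y"] by simp
  moreover have "exp (- y) \<le> 1 - y + y\<^sup>2 / 2"
  proof -
    let ?f = "\<lambda>y::real. 1 - y + y\<^sup>2 / 2 - exp (- y)"
    have "?f 0 \<le> ?f y"
    proof (rule DERIV_nonneg_imp_nondecreasing[OF assms])
      fix x :: real
      have "(?f has_real_derivative (- 1 + x + exp (- x))) (at x)"
        by (auto intro!: derivative_eq_intros)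
      moreover have "0 \<le> - 1 + x + exp (- x)" using exp_ge_add_one_self[of "- x"] by simp
      ultimately show "\<exists>d. (?f has_real_derivative d) (at x) \<and> 0 \<le> d" by blast
    qed
    then show ?thesis by simp
  qed
  ultimately show ?thesis by simp
qed

text \<open>The cubic bound is meant for small increments, the quadratic one for large increments,
  whose cubes need not be integrable.\<close>

lemma iexp_second_order:
  "cmod (iexp x - 1 - \<i> * x + x\<^sup>2 / 2) \<le> \<bar>x\<bar> ^ 3 / 6"
  "cmod (iexp x - 1 - \<i> * x + x\<^sup>2 / 2) \<le> x\<^sup>2"
proof -
  have eq: "iexp x - (\<Sum>k\<le>2. (\<i> * x)^k / fact k) = iexp x - 1 - \<i> * x + x\<^sup>2 / 2"
    by (simp add: numeral_2_eq_2 power2_eq_square algebra_simps)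
  show "cmod (iexp x - 1 - \<i> * x + x\<^sup>2 / 2) \<le> \<bar>x\<bar> ^ 3 / 6"
    using iexp_approx1[of x 2] unfolding eq by (simp add: fact_numeral eval_nat_numeral)
  show "cmod (iexp x - 1 - \<i> * x + x\<^sup>2 / 2) \<le> x\<^sup>2"
    using iexp_approx2[of x 2] unfolding eq by simp
qed

text \<open>With the non-strict threshold, \<open>K = 0\<close> is the full square, so one family
  covers the conditional variance and the Lindeberg tails.\<close>

definition tail_square :: "nat \<Rightarrow> real \<Rightarrow> real" where
  "tail_square K y = (if real K \<le> y\<^sup>2 then y\<^sup>2 else 0)"

lemma tail_square_0 [simp]: "tail_square 0 y = y\<^sup>2"
  by (simp add: tail_square_def)

lemma tail_square_nonneg: "0 \<le> tail_square K y"
  by (simp add: tail_square_def)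

lemma tail_square_le: "tail_square K y \<le> y\<^sup>2"
  by (simp add: tail_square_def)

lemma tail_square_measurable [measurable]: "tail_square K \<in> borel_measurable borel"
  unfolding tail_square_def[abs_def] by measurable

text \<open>The hypothesis on indicators says that \<open>X\<close> has conditional expectation 0
  given \<open>F\<close>, and a bounded \<open>F\<close>-measurable factor does not disturb this.
  Indicators are the form in which martingale identities pass to \<open>m \<omega>\<close>; the
  factor is complex because exponentials of past increments are used, and it is split into real and
  imaginary part.\<close>

lemma (in finite_measure_subalgebra) integral_mult_eq_0:
  fixes X :: "'a \<Rightarrow> real" and Y :: "'a \<Rightarrow> complex"
  assumes X: "integrable M X"
    and 0: "\<And>A. A \<in> sets F \<Longrightarrow> (\<integral>x. indicator A x * X x \<partial>M) = 0"
    and Y: "Y \<in> borel_measurable F" and bdd: "\<And>x. cmod (Y x) \<le> C"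
  shows "integrable M (\<lambda>x. Y x * complex_of_real (X x))"
    "(\<integral>x. Y x * complex_of_real (X x) \<partial>M) = 0"
proof -
  have [measurable]: "Y \<in> borel_measurable M" by (rule measurable_from_subalg[OF subalg Y])
  note [measurable] = borel_measurable_integrable[OF X]
  have C: "0 \<le> C" using bdd[of undefined] norm_ge_zero order_trans by blast
  have int: "integrable M (\<lambda>x. y x * X x)" if [measurable]: "y \<in> borel_measurable M" and "\<And>x. \<bar>y x\<bar> \<le> C" for y :: "'a \<Rightarrow> real"
  proof (rule Bochner_Integration.integrable_bound)
    show "integrable M (\<lambda>x. C * X x)" using X by simp
    show "AE x in M. norm (y x * X x) \<le> norm (C * X x)"
      using that(2) C by (intro AE_I2) (auto simp: abs_mult intro!: mult_right_mono)
  qed measurable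
  have rce: "AE x in M. real_cond_exp M F X x = 0"
    by (rule real_cond_exp_charact) (use X 0 in \<open>auto simp: set_lebesgue_integral_def\<close>)
  have real: "(\<integral>x. y x * X x \<partial>M) = 0" if y: "y \<in> borel_measurable F" "\<And>x. \<bar>y x\<bar> \<le> C" for y :: "'a \<Rightarrow> real"
  proof -
    have "(\<integral>x. y x * X x \<partial>M) = (\<integral>x. y x * real_cond_exp M F X x \<partial>M)"
      using y measurable_from_subalg[OF subalg y(1)] by (intro real_cond_exp_intg(2)[symmetric] int) auto
    also have "\<dots> = (\<integral>x. 0 \<partial>M)"
      using rce y measurable_from_subalg[OF subalg y(1)] by (intro integral_cong_AE) auto
    finally show ?thesis by simp
  qed
  have le: "\<bar>Re (Y x)\<bar> \<le> C" "\<bar>Im (Y x)\<bar> \<le> C" for x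
    using bdd[of x] abs_Re_le_cmod[of "Y x"] abs_Im_le_cmod[of "Y x"] by linarith+
  show int': "integrable M (\<lambda>x. Y x * complex_of_real (X x))"
  proof (rule Bochner_Integration.integrable_bound)
    show "integrable M (\<lambda>x. C * X x)" using X by simp
    show "AE x in M. norm (Y x * complex_of_real (X x)) \<le> norm (C * X x)"
      using bdd C by (intro AE_I2) (auto simp: norm_mult abs_mult intro!: mult_right_mono)
  qed measurable
  have "Re (\<integral>x. Y x * complex_of_real (X x) \<partial>M) = (\<integral>x. Re (Y x) * X x \<partial>M)"
    by (subst integral_Re[OF int', symmetric]) simp
  moreover have "Im (\<integral>x. Y x * complex_of_real (X x) \<partial>M) = (\<integral>x. Im (Y x) * X x \<partial>M)"
    by (subst integral_Im[OF int', symmetric]) simp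
  ultimately show "(\<integral>x. Y x * complex_of_real (X x) \<partial>M) = 0"
    using real[of "\<lambda>x. Re (Y x)"] real[of "\<lambda>x. Im (Y x)"] le Y by (simp add: complex_eq_iff)
qed

text \<open>The row \<open>n\<close> of the array is \<open>c n k * e k\<close> with \<open>k < n\<close>; the function \<open>h K k\<close> is the conditional
  expectation of \<open>tail_square K (e k)\<close> given \<open>G k\<close>.\<close>

locale martingale_array = prob_space P for P :: "'a measure" +
  fixes G :: "nat \<Rightarrow> 'a measure" and e :: "nat \<Rightarrow> 'a \<Rightarrow> real" and h :: "nat \<Rightarrow> nat \<Rightarrow> 'a \<Rightarrow> real"
    and c :: "nat \<Rightarrow> nat \<Rightarrow> real" and L :: "nat \<Rightarrow> real"
  assumes sub_G: "\<And>k. subalgebra P (G k)"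
    and G_mono: "\<And>k. sets (G k) \<subseteq> sets (G (Suc k))"
    and e_meas: "\<And>k. e k \<in> borel_measurable (G (Suc k))"
    and h_meas: "\<And>K k. h K k \<in> borel_measurable (G k)"
    and int_sq: "\<And>k. integrable P (\<lambda>x. (e k x)\<^sup>2)"
    and int_h: "\<And>K k. integrable P (h K k)"
    and mart: "\<And>k A. A \<in> sets (G k) \<Longrightarrow> (\<integral>x. indicator A x * e k x \<partial>P) = 0"
    and var: "\<And>K k A. A \<in> sets (G k) \<Longrightarrow> (\<integral>x. indicator A x * (tail_square K (e k x) - h K k x) \<partial>P) = 0"
    and h_nonneg: "\<And>K k x. 0 \<le> h K k x"
    and h_le: "\<And>K k x. h K k x \<le> h 0 k x"
    and h_ge: "\<And>K k x. h 0 k x \<le> real K + h K k x"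
    and c_small: "\<And>\<epsilon>. 0 < \<epsilon> \<Longrightarrow> eventually (\<lambda>n. \<forall>k<n. (c n k)\<^sup>2 \<le> \<epsilon>) sequentially"
    and conv: "\<And>K. AE x in P. (\<lambda>n. \<Sum>k<n. (c n k)\<^sup>2 * h K k x) \<longlonglongrightarrow> L K"
    and L_0: "L 0 = 1" and L_lim: "L \<longlonglongrightarrow> 0"
begin

sublocale GG: finite_measure_subalgebra P "G k" for k
  by unfold_locales (rule sub_G)

lemma G_le: "j \<le> k \<Longrightarrow> sets (G j) \<subseteq> sets (G k)"
  by (rule lift_Suc_mono_le[of "\<lambda>k. sets (G k)"]) (rule G_mono)

lemma G_lift: "j \<le> k \<Longrightarrow> f \<in> borel_measurable (G j) \<Longrightarrow> f \<in> borel_measurable (G k)"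
  by (rule measurable_from_subalg[of "G k" "G j"]) (use G_le sub_G in \<open>auto simp: subalgebra_def\<close>)

lemma e_meas_P [measurable]: "e k \<in> borel_measurable P"
  by (rule measurable_from_subalg[OF sub_G e_meas])

lemma h_meas_P [measurable]: "h K k \<in> borel_measurable P"
  by (rule measurable_from_subalg[OF sub_G h_meas])

lemma int_e: "integrable P (e k)"
  using square_integrable_imp_integrable[OF e_meas_P int_sq] .

lemma int_tail: "integrable P (\<lambda>x. tail_square K (e k x))"
  by (rule Bochner_Integration.integrable_bound[OF int_sq[of k]])
    (use tail_square_nonneg tail_square_le in auto)

text \<open>Stopping when the accumulated conditional variance exceeds 2 keeps everything bounded; the
  stopping rule is predictable, and with probability tending to one nothing is stopped.\<close>

definition active :: "nat \<Rightarrow> nat \<Rightarrow> 'a \<Rightarrow> real" where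
  "active n k x = (if (\<Sum>j\<le>k. (c n j)\<^sup>2 * h 0 j x) \<le> 2 then 1 else 0)"

definition incr :: "nat \<Rightarrow> nat \<Rightarrow> 'a \<Rightarrow> real" where
  "incr n k x = active n k x * (c n k * e k x)"

definition incr_var :: "nat \<Rightarrow> nat \<Rightarrow> 'a \<Rightarrow> real" where
  "incr_var n k x = active n k x * ((c n k)\<^sup>2 * h 0 k x)"

definition incr_tail :: "nat \<Rightarrow> nat \<Rightarrow> nat \<Rightarrow> 'a \<Rightarrow> real" where
  "incr_tail K n k x = active n k x * ((c n k)\<^sup>2 * h K k x)"

text \<open>For increments that are conditionally Gaussian with variance \<open>incr_var\<close>
  this would be a martingale started at 1. The second factor is unbounded in general; stopping keeps
  it below \<open>exp (t\<^sup>2)\<close>.\<close>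

definition Z :: "real \<Rightarrow> nat \<Rightarrow> nat \<Rightarrow> 'a \<Rightarrow> complex" where
  "Z t n k x = iexp (t * (\<Sum>j<k. incr n j x)) * complex_of_real (exp (t\<^sup>2 / 2 * (\<Sum>j<k. incr_var n j x)))"

section \<open>Bounds for the stopped array\<close>

text \<open>The test at \<open>k\<close> may include the term \<open>j = k\<close>, because
  \<open>h 0 k\<close> is known one step earlier than \<open>e k\<close>.\<close>

lemma active_meas: "active n k \<in> borel_measurable (G k)"
proof -
  have [measurable]: "h 0 j \<in> borel_measurable (G k)" if "j \<in> {..k}" for j
    using that by (intro G_lift[OF _ h_meas]) auto
  show ?thesis unfolding active_def[abs_def] by measurable
qed

lemma active_meas_P [measurable]: "active n k \<in> borel_measurable P"
  by (rule measurable_from_subalg[OF sub_G active_meas])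

lemma incr_var_meas: "incr_var n k \<in> borel_measurable (G k)"
  using active_meas[measurable] h_meas[measurable] unfolding incr_var_def[abs_def] by measurable

lemma incr_meas: "incr n k \<in> borel_measurable (G (Suc k))"
proof -
  note [measurable] = G_lift[OF le_SucI[OF order_refl] active_meas] e_meas
  show ?thesis unfolding incr_def[abs_def] by measurable
qed

lemma incr_meas_P [measurable]: "incr n k \<in> borel_measurable P"
  by (rule measurable_from_subalg[OF sub_G incr_meas])

lemma incr_var_meas_P [measurable]: "incr_var n k \<in> borel_measurable P"
  by (rule measurable_from_subalg[OF sub_G incr_var_meas])

lemma incr_tail_meas_P [measurable]: "incr_tail K n k \<in> borel_measurable P"
  unfolding incr_tail_def[abs_def] by measurable

lemma active_cases: "active n k x = 0 \<or> active n k x = 1"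
  by (simp add: active_def)

lemma incr_var_nonneg: "0 \<le> incr_var n k x"
  by (simp add: incr_var_def active_def h_nonneg)

lemma incr_tail_nonneg: "0 \<le> incr_tail K n k x"
  by (simp add: incr_tail_def active_def h_nonneg)

lemma incr_tail_le: "incr_tail K n k x \<le> incr_var n k x"
  by (simp add: incr_tail_def incr_var_def active_def h_le mult_left_mono)

text \<open>There is no overshoot: the test already counts the current term, so a step that would
  exceed 2 is cancelled instead of being the last one taken.\<close>

lemma sum_incr_var_le: "(\<Sum>j<k. incr_var n j x) \<le> 2"
proof (induction k)
  case (Suc k)
  show ?case
  proof (cases "(\<Sum>j\<le>k. (c n j)\<^sup>2 * h 0 j x) \<le> 2")
    case True
    have "(\<Sum>j<Suc k. incr_var n j x) \<le> (\<Sum>j<Suc k. (c n j)\<^sup>2 * h 0 j x)"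
      by (rule sum_mono) (simp add: incr_var_def active_def h_nonneg)
    with True show ?thesis by (simp add: lessThan_Suc_atMost)
  next
    case False
    then show ?thesis using Suc by (simp add: incr_var_def active_def)
  qed
qed simp

lemma sum_incr_var_nonneg: "0 \<le> (\<Sum>j<k. incr_var n j x)"
  by (intro sum_nonneg incr_var_nonneg)

lemma incr_var_le_2: "incr_var n k x \<le> 2"
  using sum_incr_var_le[of n x "Suc k"] sum_incr_var_nonneg[of n x k] by simp

lemma Z_meas: "Z t n k \<in> borel_measurable (G k)"
proof -
  have [measurable]: "incr n j \<in> borel_measurable (G k)" "incr_var n j \<in> borel_measurable (G k)" if "j \<in> {..<k}" for j
    using that G_lift[OF _ incr_meas, of j k n] G_lift[OF _ incr_var_meas, of j k n] by auto
  show ?thesis unfolding Z_def[abs_def] by measurable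
qed

lemma Z_meas_P [measurable]: "Z t n k \<in> borel_measurable P"
  by (rule measurable_from_subalg[OF sub_G Z_meas])

lemma cmod_Z: "cmod (Z t n k x) = exp (t\<^sup>2 / 2 * (\<Sum>j<k. incr_var n j x))"
  by (simp add: Z_def norm_mult)

lemma cmod_Z_le: "cmod (Z t n k x) \<le> exp (t\<^sup>2)"
  unfolding cmod_Z using mult_left_mono[OF sum_incr_var_le[of n x k], of "t\<^sup>2 / 2"] by simp

lemma Z_integrable: "integrable P (Z t n k)"
  by (rule integrable_const_bound[where B = "exp (t\<^sup>2)"]) (use cmod_Z_le in auto)

lemma int_active_mult:
  assumes X: "integrable P X"
  shows "integrable P (\<lambda>x. active n k x * X x)"
proof (rule Bochner_Integration.integrable_bound[OF X])
  note [measurable] = borel_measurable_integrable[OF X]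
  show "(\<lambda>x. active n k x * X x) \<in> borel_measurable P" by measurable
qed (simp add: active_def)

lemma int_incr_var: "integrable P (incr_var n k)"
  unfolding incr_var_def[abs_def] by (intro int_active_mult) (simp add: int_h)

lemma int_incr_tail: "integrable P (incr_tail K n k)"
  unfolding incr_tail_def[abs_def] by (intro int_active_mult) (simp add: int_h)

lemma incr_square: "(incr n k x)\<^sup>2 = active n k x * ((c n k)\<^sup>2 * (e k x)\<^sup>2)"
  using active_cases[of n k x] by (auto simp: incr_def power_mult_distrib)

lemma int_incr_square: "integrable P (\<lambda>x. (incr n k x)\<^sup>2)"
  unfolding incr_square by (intro int_active_mult) (simp add: int_sq)

text \<open>\<open>var\<close> is tested against the bounded \<open>G k\<close>-measurable factor
  \<open>active n k x * (c n k)\<^sup>2\<close>. At \<open>K = 0\<close> this identifies the mean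
  squared increment with the mean of \<open>incr_var\<close>.\<close>

lemma expectation_tail:
  "(\<integral>x. active n k x * ((c n k)\<^sup>2 * tail_square K (e k x)) \<partial>P) = (\<integral>x. incr_tail K n k x \<partial>P)"
proof -
  have "(\<integral>x. complex_of_real (active n k x * (c n k)\<^sup>2) * complex_of_real (tail_square K (e k x) - h K k x) \<partial>P) = 0"
  proof (rule GG.integral_mult_eq_0(2))
    show "integrable P (\<lambda>x. tail_square K (e k x) - h K k x)" using int_tail int_h by simp
    show "(\<lambda>x. complex_of_real (active n k x * (c n k)\<^sup>2)) \<in> borel_measurable (G k)"
      using active_meas[measurable] by measurable
    show "cmod (complex_of_real (active n k x * (c n k)\<^sup>2)) \<le> (c n k)\<^sup>2" for x
      using active_cases[of n k x] by (auto simp: norm_mult norm_power)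
  qed (use var in auto)
  then have "(\<integral>x. complex_of_real (active n k x * (c n k)\<^sup>2 * (tail_square K (e k x) - h K k x)) \<partial>P) = 0"
    by simp
  then have "(\<integral>x. active n k x * (c n k)\<^sup>2 * (tail_square K (e k x) - h K k x) \<partial>P) = 0"
    unfolding integral_complex_of_real by simp
  moreover have "active n k x * (c n k)\<^sup>2 * (tail_square K (e k x) - h K k x)
      = active n k x * ((c n k)\<^sup>2 * tail_square K (e k x)) - incr_tail K n k x" for x
    by (simp add: incr_tail_def algebra_simps)
  moreover have "integrable P (\<lambda>x. active n k x * ((c n k)\<^sup>2 * tail_square K (e k x)))"
    by (intro int_active_mult) (simp add: int_tail)
  ultimately show ?thesis using int_incr_tail by simp
qed

lemma expectation_incr_square: "(\<integral>x. (incr n k x)\<^sup>2 \<partial>P) = (\<integral>x. incr_var n k x \<partial>P)"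
  using expectation_tail[of n k 0] by (simp add: incr_square incr_tail_def incr_var_def)

text \<open>An increment of size at most \<epsilon> gives one factor \<epsilon> in the cubic bound.
  A larger one forces \<open>(e k x)\<^sup>2\<close> above \<open>K\<close>, because
  \<open>(c n k)\<^sup>2 * real K \<le> \<epsilon>\<^sup>2\<close>, so its whole square is counted
  by \<open>tail_square K\<close> and the quadratic bound is enough.\<close>

lemma remainder_le:
  assumes \<epsilon>: "0 < \<epsilon>" and ck: "(c n k)\<^sup>2 * real K \<le> \<epsilon>\<^sup>2"
  shows "cmod (iexp (t * incr n k x) - 1 - \<i> * (t * incr n k x) + (t * incr n k x)\<^sup>2 / 2)
    \<le> \<bar>t\<bar> ^ 3 * \<epsilon> * (incr n k x)\<^sup>2 + t\<^sup>2 * (active n k x * ((c n k)\<^sup>2 * tail_square K (e k x)))"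
    (is "cmod ?R \<le> ?A + ?B")
proof (cases "\<bar>incr n k x\<bar> \<le> \<epsilon>")
  case True
  have "cmod ?R \<le> \<bar>t * incr n k x\<bar> ^ 3 / 6" using iexp_second_order(1)[of "t * incr n k x"] by simp
  also have "\<dots> \<le> \<bar>t * incr n k x\<bar> ^ 3" by simp
  also have "\<dots> = \<bar>t\<bar> ^ 3 * (\<bar>incr n k x\<bar> * (incr n k x)\<^sup>2)"
    by (simp add: power3_eq_cube power2_eq_square abs_mult mult.commute[of "\<bar>incr n k x\<bar>"] mult.assoc mult.left_commute[of "\<bar>incr n k x\<bar>"])
  also have "\<dots> \<le> \<bar>t\<bar> ^ 3 * (\<epsilon> * (incr n k x)\<^sup>2)"
    using True by (intro mult_left_mono mult_right_mono) auto
  finally have "cmod ?R \<le> ?A" by (simp add: mult.assoc)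
  moreover have "0 \<le> ?B" by (simp add: active_def tail_square_nonneg)
  ultimately show ?thesis by linarith
next
  case False
  then have "\<epsilon>\<^sup>2 < (incr n k x)\<^sup>2" using \<epsilon> by (metis abs_le_square_iff abs_of_pos not_le)
  then have a: "active n k x = 1" and *: "(c n k)\<^sup>2 * real K < (c n k)\<^sup>2 * (e k x)\<^sup>2"
    using active_cases[of n k x] ck by (auto simp: incr_square)
  then have "real K < (e k x)\<^sup>2" by (simp add: mult_less_cancel_left split: if_splits)
  then have B: "?B = (t * incr n k x)\<^sup>2"
    using a by (simp add: tail_square_def incr_square power_mult_distrib)
  have "cmod ?R \<le> (t * incr n k x)\<^sup>2" using iexp_second_order(2)[of "t * incr n k x"] by simp
  moreover have "0 \<le> ?A" using \<epsilon> by simp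
  ultimately show ?thesis using B by linarith
qed

text \<open>\<open>h_ge\<close> bounds one factor by
  \<open>\<epsilon>\<^sup>2 + incr_tail K n k x\<close>; the other factor is kept in the first
  product and bounded by 2 in the second.\<close>

lemma incr_var_square_le:
  assumes ck: "(c n k)\<^sup>2 * real K \<le> \<epsilon>\<^sup>2"
  shows "(incr_var n k x)\<^sup>2 \<le> \<epsilon>\<^sup>2 * incr_var n k x + 2 * incr_tail K n k x"
proof -
  have "incr_var n k x \<le> \<epsilon>\<^sup>2 + incr_tail K n k x"
  proof -
    have "(c n k)\<^sup>2 * h 0 k x \<le> (c n k)\<^sup>2 * (real K + h K k x)"
      by (intro mult_left_mono h_ge) auto
    with ck show ?thesis by (simp add: incr_var_def incr_tail_def active_def algebra_simps)
  qed
  then have "incr_var n k x * incr_var n k x \<le> (\<epsilon>\<^sup>2 + incr_tail K n k x) * incr_var n k x"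
    by (rule mult_right_mono) (rule incr_var_nonneg)
  also have "\<dots> \<le> \<epsilon>\<^sup>2 * incr_var n k x + incr_tail K n k x * 2"
    using mult_left_mono[OF incr_var_le_2[of n k x] incr_tail_nonneg[of K n k x]]
    by (simp add: algebra_simps)
  finally show ?thesis by (simp add: power2_eq_square mult.commute)
qed

text \<open>Expand \<open>iexp (t * incr n k x)\<close> and
  \<open>exp (- (t\<^sup>2 / 2 * incr_var n k x))\<close> to second order. Their constants cancel;
  the linear term and the term in \<open>(incr n k x)\<^sup>2 - incr_var n k x\<close> have
  conditional mean 0. Only the two Taylor remainders survive.\<close>

lemma expectation_Z_step:
  assumes \<epsilon>: "0 < \<epsilon>" and ck: "(c n k)\<^sup>2 * real K \<le> \<epsilon>\<^sup>2"
  shows "cmod ((\<integral>x. Z t n (Suc k) x \<partial>P) - (\<integral>x. Z t n k x \<partial>P))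
    \<le> exp (t\<^sup>2) * ((\<bar>t\<bar> ^ 3 * \<epsilon> + t ^ 4 * \<epsilon>\<^sup>2 / 8) * (\<integral>x. incr_var n k x \<partial>P)
        + (t\<^sup>2 + t ^ 4 / 4) * (\<integral>x. incr_tail K n k x \<partial>P))"
proof -
  \<comment> \<open>The variance factor of step \<open>k\<close> is taken one step early. This keeps
    \<open>Y\<close> measurable for \<open>G k\<close>, as \<open>incr_var n k\<close> is, and still
    bounded by \<open>exp (t\<^sup>2)\<close>.\<close>
  define Y where "Y x = Z t n k x * complex_of_real (exp (t\<^sup>2 / 2 * incr_var n k x))" for x
  define R where "R x = iexp (t * incr n k x) - 1 - \<i> * (t * incr n k x) + (t * incr n k x)\<^sup>2 / 2" for x
  define r where "r x = exp (- (t\<^sup>2 / 2 * incr_var n k x)) - 1 + t\<^sup>2 / 2 * incr_var n k x" for x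
  have Y_meas: "Y \<in> borel_measurable (G k)"
    using Z_meas[measurable] incr_var_meas[measurable] unfolding Y_def[abs_def] by measurable
  have [measurable]: "Y \<in> borel_measurable P" by (rule measurable_from_subalg[OF sub_G Y_meas])
  have [measurable]: "R \<in> borel_measurable P" unfolding R_def[abs_def] by measurable
  have [measurable]: "r \<in> borel_measurable P" unfolding r_def[abs_def] by measurable
  have Y_le: "cmod (Y x) \<le> exp (t\<^sup>2)" for x
  proof -
    have "cmod (Y x) = exp (t\<^sup>2 / 2 * (\<Sum>j<Suc k. incr_var n j x))"
      by (simp add: Y_def norm_mult cmod_Z exp_add[symmetric] algebra_simps)
    also have "\<dots> \<le> exp (t\<^sup>2)"
      using mult_left_mono[OF sum_incr_var_le[of n x "Suc k"], of "t\<^sup>2 / 2"] by simp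
    finally show ?thesis .
  qed
  \<comment> \<open>The coefficient \<open>t ^ 4 / 8\<close> comes from half the square of
    \<open>t\<^sup>2 / 2 * incr_var n k x\<close>.\<close>
  let ?B = "\<lambda>x. \<bar>t\<bar> ^ 3 * \<epsilon> * (incr n k x)\<^sup>2 + t\<^sup>2 * (active n k x * ((c n k)\<^sup>2 * tail_square K (e k x)))
      + t ^ 4 / 8 * (\<epsilon>\<^sup>2 * incr_var n k x + 2 * incr_tail K n k x)"
  have Rr: "cmod (R x - complex_of_real (r x)) \<le> ?B x" for x
  proof -
    have "\<bar>r x\<bar> \<le> (t\<^sup>2 / 2 * incr_var n k x)\<^sup>2 / 2"
      unfolding r_def using incr_var_nonneg by (intro exp_minus_second_order) simp
    also have "\<dots> = t ^ 4 / 8 * (incr_var n k x)\<^sup>2"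
      by (simp add: power_mult_distrib power_divide flip: power_mult)
    also have "\<dots> \<le> t ^ 4 / 8 * (\<epsilon>\<^sup>2 * incr_var n k x + 2 * incr_tail K n k x)"
      by (intro mult_left_mono incr_var_square_le[OF ck]) simp
    finally have r: "\<bar>r x\<bar> \<le> t ^ 4 / 8 * (\<epsilon>\<^sup>2 * incr_var n k x + 2 * incr_tail K n k x)" .
    show ?thesis
      using norm_triangle_ineq4[of "R x" "complex_of_real (r x)"] r remainder_le[OF \<epsilon> ck, of t x]
      unfolding R_def by (simp del: of_real_mult)
  qed
  have int_tail': "integrable P (\<lambda>x. active n k x * ((c n k)\<^sup>2 * tail_square K (e k x)))"
    by (intro int_active_mult) (simp add: int_tail)
  have intB: "integrable P ?B"
    using int_incr_square int_tail' int_incr_var int_incr_tail by simp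
  have "(\<integral>x. ?B x \<partial>P) = \<bar>t\<bar> ^ 3 * \<epsilon> * (\<integral>x. incr_var n k x \<partial>P) + t\<^sup>2 * (\<integral>x. incr_tail K n k x \<partial>P)
      + t ^ 4 / 8 * (\<epsilon>\<^sup>2 * (\<integral>x. incr_var n k x \<partial>P) + 2 * (\<integral>x. incr_tail K n k x \<partial>P))"
    using int_incr_square[of n k] int_tail' int_incr_var[of n k] int_incr_tail[of K n k]
    by (simp add: expectation_incr_square expectation_tail)
  then have EB: "(\<integral>x. ?B x \<partial>P) = (\<bar>t\<bar> ^ 3 * \<epsilon> + t ^ 4 * \<epsilon>\<^sup>2 / 8) * (\<integral>x. incr_var n k x \<partial>P)
        + (t\<^sup>2 + t ^ 4 / 4) * (\<integral>x. incr_tail K n k x \<partial>P)"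
    by (simp add: algebra_simps)
  have int_err: "integrable P (\<lambda>x. Y x * (R x - complex_of_real (r x)))"
  proof (rule Bochner_Integration.integrable_bound)
    show "integrable P (\<lambda>x. exp (t\<^sup>2) * ?B x)" using intB by simp
    show "AE x in P. norm (Y x * (R x - complex_of_real (r x))) \<le> norm (exp (t\<^sup>2) * ?B x)"
    proof (rule AE_I2)
      fix x
      have "cmod (Y x) * cmod (R x - complex_of_real (r x)) \<le> exp (t\<^sup>2) * ?B x"
        by (intro mult_mono Y_le Rr) auto
      then show "norm (Y x * (R x - complex_of_real (r x))) \<le> norm (exp (t\<^sup>2) * ?B x)"
        unfolding norm_mult[of "Y x"] real_norm_def by (rule order_trans[OF _ abs_ge_self])
    qed
  qed measurable
  \<comment> \<open>The second and third summands are written as a bounded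
    \<open>G k\<close>-measurable factor times \<open>e k\<close> or times the compensated square,
    ready for \<open>integral_mult_eq_0\<close>.\<close>
  have step: "Z t n (Suc k) x - Z t n k x = Y x * (R x - complex_of_real (r x))
      + (Y x * complex_of_real (active n k x * (t * c n k))) * \<i> * complex_of_real (e k x)
      - (Y x * complex_of_real (active n k x * (t\<^sup>2 / 2 * (c n k)\<^sup>2))) * complex_of_real (tail_square 0 (e k x) - h 0 k x)" for x
  proof -
    have Z1: "Z t n (Suc k) x = Y x * iexp (t * incr n k x)"
      by (simp add: Z_def Y_def distrib_left exp_add)
    have Z0: "Z t n k x = Y x * complex_of_real (exp (- (t\<^sup>2 / 2 * incr_var n k x)))"
      unfolding Y_def by (simp add: mult.assoc exp_minus flip: of_real_mult)
    have eq0: "iexp (t * incr n k x) - complex_of_real (exp (- (t\<^sup>2 / 2 * incr_var n k x)))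
      = (R x - complex_of_real (r x)) + \<i> * complex_of_real (t * incr n k x)
        - complex_of_real (t\<^sup>2 / 2 * ((incr n k x)\<^sup>2 - incr_var n k x))"
      unfolding R_def r_def by (simp add: power_mult_distrib algebra_simps)
    have eq1: "t\<^sup>2 / 2 * ((incr n k x)\<^sup>2 - incr_var n k x) = active n k x * (t\<^sup>2 / 2 * (c n k)\<^sup>2) * (tail_square 0 (e k x) - h 0 k x)"
      by (simp add: incr_square incr_var_def algebra_simps)
    have eq2: "t * incr n k x = active n k x * (t * c n k) * e k x"
      by (simp add: incr_def)
    have eq: "iexp (t * incr n k x) - complex_of_real (exp (- (t\<^sup>2 / 2 * incr_var n k x)))
      = (R x - complex_of_real (r x)) + \<i> * complex_of_real (active n k x * (t * c n k) * e k x)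
        - complex_of_real (active n k x * (t\<^sup>2 / 2 * (c n k)\<^sup>2) * (tail_square 0 (e k x) - h 0 k x))"
      using eq0 unfolding eq1 eq2 .
    have diff: "Z t n (Suc k) x - Z t n k x = Y x * (iexp (t * incr n k x) - complex_of_real (exp (- (t\<^sup>2 / 2 * incr_var n k x))))"
      unfolding Z1 Z0 by (rule right_diff_distrib[symmetric])
    have alg: "y * (u + \<i> * (p * q) - v * w) = y * u + (y * p) * \<i> * q - (y * v) * w" for y u p q v w :: complex
      by (simp add: algebra_simps)
    show ?thesis
      unfolding diff eq of_real_mult[of "active n k x * (t * c n k)" "e k x"]
        of_real_mult[of "active n k x * (t\<^sup>2 / 2 * (c n k)\<^sup>2)" "tail_square 0 (e k x) - h 0 k x"]
      by (rule alg)
  qed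
  have Ya: "cmod (Y x * complex_of_real (active n k x * s)) \<le> exp (t\<^sup>2) * \<bar>s\<bar>" for s x
    unfolding norm_mult norm_of_real
    by (intro mult_mono Y_le) (use active_cases[of n k x] in auto)
  have Ya_meas: "(\<lambda>x. Y x * complex_of_real (active n k x * s)) \<in> borel_measurable (G k)" for s
    using Y_meas[measurable] active_meas[measurable] by measurable
  have bd1: "cmod ((Y x * complex_of_real (active n k x * (t * c n k))) * \<i>) \<le> exp (t\<^sup>2) * \<bar>t * c n k\<bar>" for x
    using Ya[of x "t * c n k"] unfolding norm_mult[of _ \<i>] by simp
  have meas1: "(\<lambda>x. (Y x * complex_of_real (active n k x * (t * c n k))) * \<i>) \<in> borel_measurable (G k)"
    by (intro borel_measurable_times Ya_meas borel_measurable_const)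
  have m1: "integrable P (\<lambda>x. (Y x * complex_of_real (active n k x * (t * c n k))) * \<i> * complex_of_real (e k x))"
    "(\<integral>x. (Y x * complex_of_real (active n k x * (t * c n k))) * \<i> * complex_of_real (e k x) \<partial>P) = 0"
    by (rule GG.integral_mult_eq_0[OF int_e _ meas1 bd1], erule mart)+
  have int2: "integrable P (\<lambda>x. tail_square 0 (e k x) - h 0 k x)"
    using int_tail int_h by (rule Bochner_Integration.integrable_diff)
  have m2: "integrable P (\<lambda>x. (Y x * complex_of_real (active n k x * (t\<^sup>2 / 2 * (c n k)\<^sup>2))) * complex_of_real (tail_square 0 (e k x) - h 0 k x))"
    "(\<integral>x. (Y x * complex_of_real (active n k x * (t\<^sup>2 / 2 * (c n k)\<^sup>2))) * complex_of_real (tail_square 0 (e k x) - h 0 k x) \<partial>P) = 0"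
    by (rule GG.integral_mult_eq_0[OF int2 _ Ya_meas Ya], erule var)+
  have "(\<integral>x. Z t n (Suc k) x \<partial>P) - (\<integral>x. Z t n k x \<partial>P) = (\<integral>x. Z t n (Suc k) x - Z t n k x \<partial>P)"
    using Z_integrable by simp
  also have "\<dots> = (\<integral>x. Y x * (R x - complex_of_real (r x)) \<partial>P)"
    unfolding step
    using Bochner_Integration.integral_diff[OF Bochner_Integration.integrable_add[OF int_err m1(1)] m2(1)]
    unfolding Bochner_Integration.integral_add[OF int_err m1(1)] m1(2) m2(2) add_0_right diff_zero .
  finally have eq: "(\<integral>x. Z t n (Suc k) x \<partial>P) - (\<integral>x. Z t n k x \<partial>P) = (\<integral>x. Y x * (R x - complex_of_real (r x)) \<partial>P)" .
  have le: "cmod (\<integral>x. Y x * (R x - complex_of_real (r x)) \<partial>P) \<le> (\<integral>x. exp (t\<^sup>2) * ?B x \<partial>P)"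
  proof (rule order_trans[OF integral_norm_bound integral_mono])
    show "integrable P (\<lambda>x. cmod (Y x * (R x - complex_of_real (r x))))" using int_err by simp
    show "integrable P (\<lambda>x. exp (t\<^sup>2) * ?B x)" using intB by simp
    show "cmod (Y x * (R x - complex_of_real (r x))) \<le> exp (t\<^sup>2) * ?B x" for x
      unfolding norm_mult by (intro mult_mono Y_le Rr) auto
  qed
  show ?thesis
    using le unfolding eq integral_mult_right_zero EB .
qed

text \<open>Telescope from \<open>Z t n 0 x = 1\<close>. The stopped variances sum to at most 2, and
  the stopped tails lie below them; the resulting cut at 2 provides the majorant for dominated
  convergence, since the unstopped tail sums converge only almost surely.\<close>

lemma expectation_Z_bound:
  assumes \<epsilon>: "0 < \<epsilon>" and ck: "\<And>k. k < n \<Longrightarrow> (c n k)\<^sup>2 * real K \<le> \<epsilon>\<^sup>2"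
  shows "cmod ((\<integral>x. Z t n n x \<partial>P) - 1)
    \<le> exp (t\<^sup>2) * (2 * (\<bar>t\<bar> ^ 3 * \<epsilon> + t ^ 4 * \<epsilon>\<^sup>2 / 8)
        + (t\<^sup>2 + t ^ 4 / 4) * (\<integral>x. min 2 (\<Sum>k<n. (c n k)\<^sup>2 * h K k x) \<partial>P))"
proof -
  let ?E = "\<lambda>k. \<integral>x. Z t n k x \<partial>P"
  let ?a = "\<bar>t\<bar> ^ 3 * \<epsilon> + t ^ 4 * \<epsilon>\<^sup>2 / 8" and ?b = "t\<^sup>2 + t ^ 4 / 4"
  have a: "0 \<le> ?a" and b: "0 \<le> ?b" using \<epsilon> by auto
  have "?E 0 = 1" by (simp add: Z_def prob_space)
  then have "?E n - 1 = (\<Sum>k<n. ?E (Suc k) - ?E k)"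
    using sum_lessThan_telescope[of ?E n] by simp
  then have "cmod (?E n - 1) \<le> (\<Sum>k<n. cmod (?E (Suc k) - ?E k))"
    by (simp add: norm_sum)
  also have "\<dots> \<le> (\<Sum>k<n. exp (t\<^sup>2) * (?a * (\<integral>x. incr_var n k x \<partial>P) + ?b * (\<integral>x. incr_tail K n k x \<partial>P)))"
    by (intro sum_mono expectation_Z_step[OF \<epsilon>] ck) auto
  also have "\<dots> = exp (t\<^sup>2) * (?a * (\<Sum>k<n. \<integral>x. incr_var n k x \<partial>P) + ?b * (\<Sum>k<n. \<integral>x. incr_tail K n k x \<partial>P))"
    by (simp only: sum_distrib_left[symmetric] sum.distrib)
  also have "(\<Sum>k<n. \<integral>x. incr_var n k x \<partial>P) = (\<integral>x. (\<Sum>k<n. incr_var n k x) \<partial>P)"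
    by (rule Bochner_Integration.integral_sum[symmetric]) (rule int_incr_var)
  also have "(\<Sum>k<n. \<integral>x. incr_tail K n k x \<partial>P) = (\<integral>x. (\<Sum>k<n. incr_tail K n k x) \<partial>P)"
    by (rule Bochner_Integration.integral_sum[symmetric]) (rule int_incr_tail)
  also have "exp (t\<^sup>2) * (?a * (\<integral>x. (\<Sum>k<n. incr_var n k x) \<partial>P) + ?b * (\<integral>x. (\<Sum>k<n. incr_tail K n k x) \<partial>P))
    \<le> exp (t\<^sup>2) * (?a * 2 + ?b * (\<integral>x. min 2 (\<Sum>k<n. (c n k)\<^sup>2 * h K k x) \<partial>P))"
  proof (intro mult_left_mono add_mono a b)
    have "(\<integral>x. (\<Sum>k<n. incr_var n k x) \<partial>P) \<le> (\<integral>x. 2 \<partial>P)"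
      by (intro integral_mono sum_incr_var_le) (auto intro: int_incr_var)
    then show "(\<integral>x. (\<Sum>k<n. incr_var n k x) \<partial>P) \<le> 2" by (simp add: prob_space)
    show "(\<integral>x. (\<Sum>k<n. incr_tail K n k x) \<partial>P) \<le> (\<integral>x. min 2 (\<Sum>k<n. (c n k)\<^sup>2 * h K k x) \<partial>P)"
    proof (rule integral_mono)
      show "integrable P (\<lambda>x. \<Sum>k<n. incr_tail K n k x)" by (auto intro: int_incr_tail)
      show "integrable P (\<lambda>x. min 2 (\<Sum>k<n. (c n k)\<^sup>2 * h K k x))"
        by (intro integrable_min Bochner_Integration.integrable_sum integrable_mult_right int_h) simp
      fix x
      have "(\<Sum>k<n. incr_tail K n k x) \<le> (\<Sum>k<n. incr_var n k x)" by (intro sum_mono incr_tail_le)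
      moreover have "(\<Sum>k<n. incr_tail K n k x) \<le> (\<Sum>k<n. (c n k)\<^sup>2 * h K k x)"
        by (intro sum_mono) (simp add: incr_tail_def active_def h_nonneg)
      ultimately show "(\<Sum>k<n. incr_tail K n k x) \<le> min 2 (\<Sum>k<n. (c n k)\<^sup>2 * h K k x)"
        using sum_incr_var_le[of n x n] by simp
    qed
  qed simp
  finally show ?thesis by (simp add: mult.commute)
qed

lemma expectation_Z_lim: "(\<lambda>n. \<integral>x. Z t n n x \<partial>P) \<longlonglongrightarrow> 1"
proof (rule LIM_zero_cancel, rule tendsto_norm_zero_cancel, rule LIMSEQ_I)
  fix r :: real assume r: "0 < r"
  let ?a = "\<lambda>\<epsilon>. \<bar>t\<bar> ^ 3 * \<epsilon> + t ^ 4 * \<epsilon>\<^sup>2 / 8" and ?b = "t\<^sup>2 + t ^ 4 / 4"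
  let ?q = "\<lambda>K n. \<integral>x. min 2 (\<Sum>k<n. (c n k)\<^sup>2 * h K k x) \<partial>P"
  \<comment> \<open>Tying \<epsilon> to \<open>K\<close> leaves a single parameter: \<open>K\<close>
    is fixed so that the limiting bound is below \<open>r\<close>, and only then does
    \<open>n\<close> grow.\<close>
  have "(\<lambda>K. exp (t\<^sup>2) * (2 * ?a (inverse (real (Suc K))) + ?b * min 2 (L K)))
      \<longlonglongrightarrow> exp (t\<^sup>2) * (2 * ?a 0 + ?b * min 2 0)"
    by (intro tendsto_intros LIMSEQ_inverse_real_of_nat L_lim) auto
  then have "eventually (\<lambda>K. exp (t\<^sup>2) * (2 * ?a (inverse (real (Suc K))) + ?b * min 2 (L K)) < r) sequentially"
    by (rule order_tendstoD) (use r in simp)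
  then obtain K where K: "exp (t\<^sup>2) * (2 * ?a (inverse (real (Suc K))) + ?b * min 2 (L K)) < r"
    by (auto simp: eventually_sequentially)
  define \<epsilon> where "\<epsilon> = inverse (real (Suc K))"
  have \<epsilon>: "0 < \<epsilon>" by (simp add: \<epsilon>_def)
  have "?q K \<longlonglongrightarrow> (\<integral>x. min 2 (L K) \<partial>P)"
  proof (rule integral_dominated_convergence[where w = "\<lambda>x. 2"])
    show "AE x in P. (\<lambda>n. min 2 (\<Sum>k<n. (c n k)\<^sup>2 * h K k x)) \<longlonglongrightarrow> min 2 (L K)"
      using conv[of K] by eventually_elim (intro tendsto_intros)
    show "AE x in P. norm (min 2 (\<Sum>k<n. (c n k)\<^sup>2 * h K k x)) \<le> 2" for n
      by (auto simp: min_def h_nonneg sum_nonneg)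
  qed auto
  then have "(\<lambda>n. exp (t\<^sup>2) * (2 * ?a \<epsilon> + ?b * ?q K n)) \<longlonglongrightarrow> exp (t\<^sup>2) * (2 * ?a \<epsilon> + ?b * min 2 (L K))"
    by (intro tendsto_intros) (simp add: prob_space)
  then have "eventually (\<lambda>n. exp (t\<^sup>2) * (2 * ?a \<epsilon> + ?b * ?q K n) < r) sequentially"
    by (rule order_tendstoD) (use K in \<open>simp add: \<epsilon>_def\<close>)
  \<comment> \<open>Dividing by \<open>Suc K\<close> instead of \<open>K\<close> keeps the bound
    positive for \<open>K = 0\<close>.\<close>
  moreover have "eventually (\<lambda>n. \<forall>k<n. (c n k)\<^sup>2 \<le> \<epsilon>\<^sup>2 / real (Suc K)) sequentially"
    by (rule c_small) (use \<epsilon> in simp)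
  ultimately have "eventually (\<lambda>n. norm (norm ((\<integral>x. Z t n n x \<partial>P) - 1) - 0) < r) sequentially"
  proof eventually_elim
    case (elim n)
    have "(c n k)\<^sup>2 * real K \<le> \<epsilon>\<^sup>2" if "k < n" for k
    proof -
      have "(c n k)\<^sup>2 * real K \<le> (c n k)\<^sup>2 * real (Suc K)" by (intro mult_left_mono) auto
      also have "\<dots> \<le> \<epsilon>\<^sup>2" using elim(2) that by (simp add: field_simps)
      finally show ?thesis .
    qed
    from expectation_Z_bound[OF \<epsilon> this, where t = t] elim(1) show ?case by simp
  qed
  then show "\<exists>no. \<forall>n\<ge>no. norm (norm ((\<integral>x. Z t n n x \<partial>P) - 1) - 0) < r"
    by (simp add: eventually_sequentially)
qed

text \<open>By \<open>expectation_Z_lim\<close> the product of \<open>Z t n n\<close> with the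
  normal characteristic function has the right limit in mean. The difference \<open>?D\<close> from
  the true exponential is bounded and tends to 0 almost surely.\<close>

theorem martingale_clt:
  "weak_conv_m (\<lambda>n. distr P borel (\<lambda>x. \<Sum>k<n. c n k * e k x)) std_normal_distribution"
proof (rule levy_continuity)
  let ?S = "\<lambda>n x. \<Sum>k<n. c n k * e k x"
  show "real_distribution (distr P borel (?S n))" for n
    by (rule real_distribution_distr) measurable
  show "real_distribution std_normal_distribution" by (rule real_dist_normal_dist)
  fix t :: real
  let ?z = "complex_of_real (exp (- (t\<^sup>2) / 2))"
  let ?D = "\<lambda>n x. iexp (t * ?S n x) - Z t n n x * ?z"
  have "(\<lambda>n. \<integral>x. ?D n x \<partial>P) \<longlonglongrightarrow> (\<integral>x. 0 \<partial>P)"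
  proof (rule integral_dominated_convergence[where w = "\<lambda>x. 1 + exp (t\<^sup>2)"])
    show "AE x in P. (\<lambda>n. ?D n x) \<longlonglongrightarrow> 0"
      using conv[of 0]
    proof eventually_elim
      case (elim x)
      then have lim: "(\<lambda>n. \<Sum>k<n. (c n k)\<^sup>2 * h 0 k x) \<longlonglongrightarrow> 1" by (simp add: L_0)
      \<comment> \<open>The stopping level 2 lies above the limit 1, so at this point no step is
        stopped from some \<open>n\<close> on.\<close>
      then have "eventually (\<lambda>n. (\<Sum>k<n. (c n k)\<^sup>2 * h 0 k x) < 2) sequentially"
        by (rule order_tendstoD) simp
      then have "eventually (\<lambda>n. cmod (?D n x) = \<bar>1 - exp (t\<^sup>2 / 2 * ((\<Sum>k<n. (c n k)\<^sup>2 * h 0 k x) - 1))\<bar>) sequentially"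
      proof eventually_elim
        case (elim n)
        have act: "active n k x = 1" if "k < n" for k
        proof -
          have "(\<Sum>j\<le>k. (c n j)\<^sup>2 * h 0 j x) \<le> (\<Sum>j<n. (c n j)\<^sup>2 * h 0 j x)"
            using that by (intro sum_mono2) (auto simp: h_nonneg)
          with elim show ?thesis by (simp add: active_def)
        qed
        define V where "V = (\<Sum>k<n. (c n k)\<^sup>2 * h 0 k x)"
        have "Z t n n x = iexp (t * ?S n x) * complex_of_real (exp (t\<^sup>2 / 2 * V))"
          unfolding Z_def incr_def incr_var_def V_def using act by simp
        moreover have "exp (t\<^sup>2 / 2 * V) * exp (- (t\<^sup>2) / 2) = exp (t\<^sup>2 / 2 * (V - 1))"
          by (simp add: exp_add[symmetric] algebra_simps)
        ultimately have "?D n x = iexp (t * ?S n x) * complex_of_real (1 - exp (t\<^sup>2 / 2 * (V - 1)))"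
          by (simp only: mult.assoc of_real_mult[symmetric] right_diff_distrib of_real_diff of_real_1 mult_1_right)
        then show ?case unfolding V_def by (simp only: norm_mult norm_of_real norm_exp_i_times mult_1)
      qed
      moreover have "(\<lambda>n. \<bar>1 - exp (t\<^sup>2 / 2 * ((\<Sum>k<n. (c n k)\<^sup>2 * h 0 k x) - 1))\<bar>) \<longlonglongrightarrow> \<bar>1 - exp (t\<^sup>2 / 2 * (1 - 1))\<bar>"
        by (intro tendsto_intros lim)
      ultimately have "(\<lambda>n. cmod (?D n x)) \<longlonglongrightarrow> 0"
        by (simp add: filterlim_cong)
      then show ?case by (rule tendsto_norm_zero_cancel)
    qed
    show "AE x in P. cmod (?D n x) \<le> 1 + exp (t\<^sup>2)" for n
    proof (rule AE_I2)
      fix x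
      have "cmod (Z t n n x * ?z) \<le> exp (t\<^sup>2) * 1"
        unfolding norm_mult by (intro mult_mono cmod_Z_le) auto
      then show "cmod (?D n x) \<le> 1 + exp (t\<^sup>2)"
        using norm_triangle_ineq4[of "iexp (t * ?S n x)" "Z t n n x * ?z"] by simp
    qed
  qed auto
  then have D0: "(\<lambda>n. \<integral>x. ?D n x \<partial>P) \<longlonglongrightarrow> 0" by simp
  have "char (distr P borel (?S n)) t = (\<integral>x. ?D n x \<partial>P) + (\<integral>x. Z t n n x \<partial>P) * ?z" for n
  proof -
    have "char (distr P borel (?S n)) t = (\<integral>x. iexp (t * ?S n x) \<partial>P)"
      unfolding char_def by (rule integral_distr) auto
    moreover have "integrable P (\<lambda>x. iexp (t * ?S n x))"
      by (rule integrable_const_bound[where B = 1]) auto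
    ultimately show ?thesis using Z_integrable[of t n n] by simp
  qed
  then have "(\<lambda>n. char (distr P borel (?S n)) t) \<longlonglongrightarrow> 0 + 1 * ?z"
    using tendsto_add[OF D0 tendsto_mult[OF expectation_Z_lim[of t] tendsto_const[of ?z]]] by simp
  then show "(\<lambda>n. char (distr P borel (?S n)) t) \<longlonglongrightarrow> char std_normal_distribution t"
    by (simp add: char_std_normal_distribution)
qed

end

section \<open>Weights built from partial sums\<close>

lemma sum_square_le_card:
  fixes a :: "nat \<Rightarrow> real"
  assumes "summable (\<lambda>i. (a i)\<^sup>2)" "finite I"
  shows "(\<Sum>i\<in>I. a i)\<^sup>2 \<le> real (card I) * (\<Sum>i. (a i)\<^sup>2)"
proof -
  have "(\<Sum>i\<in>I. a i)\<^sup>2 \<le> (\<Sum>i\<in>I. (a i)\<^sup>2) * real (card I)"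
    by (rule sum_squared_le_sum_of_squares)
  also have "\<dots> \<le> (\<Sum>i. (a i)\<^sup>2) * real (card I)"
    by (intro mult_right_mono sum_le_suminf assms) auto
  finally show ?thesis by (simp add: mult.commute)
qed

text \<open>By Cauchy-Schwarz a partial sum moves by at most \<open>sqrt (L * A)\<close> in
  \<open>L\<close> steps, so \<open>(b k)\<^sup>2\<close> is controlled by each of the
  \<open>L\<close> squares ending at \<open>k\<close>. Averaging over them costs a fraction
  \<open>2 / L\<close> of \<open>s n\<close> plus a constant, and the constant is beaten by
  \<open>s n\<close> tending to infinity.\<close>

lemma partial_sums_negligible:
  fixes a b s :: "nat \<Rightarrow> real"
  assumes sq: "summable (\<lambda>i. (a i)\<^sup>2)"
    and b: "\<And>j. b j = (\<Sum>i<j. a i)" and s: "\<And>n. s n = (\<Sum>k<n. (b k)\<^sup>2)"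
    and lim: "filterlim s at_top sequentially" and \<epsilon>: "0 < \<epsilon>"
  shows "eventually (\<lambda>n. \<forall>k<n. (b k)\<^sup>2 \<le> \<epsilon> * s n) sequentially"
proof -
  define A where "A = (\<Sum>i. (a i)\<^sup>2)"
  have A: "0 \<le> A" unfolding A_def by (intro suminf_nonneg sq) auto
  have s0: "0 \<le> s n" for n unfolding s by (intro sum_nonneg) auto
  have bound: "(b k)\<^sup>2 \<le> 2 / real L * s n + 2 * real L * A" if L: "0 < L" and k: "k < n" for L k n :: nat
  proof (cases "k < L")
    \<comment> \<open>There are not enough predecessors to average over, but \<open>b k\<close> then
      has fewer than \<open>L\<close> terms.\<close>
    case True
    have "(b k)\<^sup>2 \<le> real k * A" unfolding b A_def using sum_square_le_card[OF sq, of "{..<k}"] by simp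
    also have "\<dots> \<le> 2 * real L * A" using True A by (intro mult_right_mono) auto
    finally show ?thesis using s0[of n] L by (smt (verit) divide_nonneg_nonneg mult_nonneg_nonneg of_nat_0_le_iff)
  next
    case False
    have "(b k)\<^sup>2 \<le> 2 * (b (k - l))\<^sup>2 + 2 * real L * A" if l: "l < L" for l
    proof -
      have "b k = b (k - l) + (\<Sum>i=k-l..<k. a i)"
        unfolding b lessThan_atLeast0 by (intro sum.atLeastLessThan_concat[symmetric]) auto
      then have "(b k)\<^sup>2 \<le> 2 * (b (k - l))\<^sup>2 + 2 * (\<Sum>i=k-l..<k. a i)\<^sup>2"
        using sum_squares_bound[of "b (k - l)" "\<Sum>i=k-l..<k. a i"] by (simp add: power2_sum)
      moreover have "(\<Sum>i=k-l..<k. a i)\<^sup>2 \<le> real L * A"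
      proof -
        have "(\<Sum>i=k-l..<k. a i)\<^sup>2 \<le> real (k - (k - l)) * A"
          using sum_square_le_card[OF sq, of "{k-l..<k}"] by (simp add: A_def)
        also have "\<dots> \<le> real L * A" using l A by (intro mult_right_mono) auto
        finally show ?thesis .
      qed
      ultimately show ?thesis by simp
    qed
    then have "(\<Sum>l<L. (b k)\<^sup>2) \<le> (\<Sum>l<L. 2 * (b (k - l))\<^sup>2 + 2 * real L * A)"
      by (intro sum_mono) auto
    also have "\<dots> = 2 * (\<Sum>l<L. (b (k - l))\<^sup>2) + real L * (2 * real L * A)"
      by (simp add: sum.distrib sum_distrib_left)
    also have "(\<Sum>l<L. (b (k - l))\<^sup>2) = (\<Sum>j\<in>(\<lambda>l. k - l) ` {..<L}. (b j)\<^sup>2)"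
      using False by (intro sum.reindex_cong[symmetric, where l = "\<lambda>l. k - l"]) (auto simp: inj_on_def)
    also have "\<dots> \<le> s n" unfolding s using k by (intro sum_mono2) auto
    finally have "real L * (b k)\<^sup>2 \<le> 2 * s n + real L * (2 * real L * A)" by simp
    then have "(b k)\<^sup>2 \<le> (2 * s n + real L * (2 * real L * A)) / real L"
      using L by (simp add: pos_le_divide_eq mult.commute)
    also have "\<dots> = 2 / real L * s n + 2 * real L * A" using L by (simp add: field_simps)
    finally show ?thesis .
  qed
  obtain L :: nat where L: "0 < L" "2 / real L \<le> \<epsilon> / 2"
  proof -
    obtain m :: nat where "1 / Suc m < \<epsilon> / 4" using nat_approx_posE[of "\<epsilon> / 4"] \<epsilon> by auto
    then have "2 / real (Suc m) \<le> \<epsilon> / 2" by simp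
    then show thesis by (intro that[of "Suc m"]) auto
  qed
  \<comment> \<open>Chosen so that the constant \<open>2 * real L * A\<close> is at most
    \<open>\<epsilon> / 2 * s n\<close>.\<close>
  have "eventually (\<lambda>n. 4 * real L * A / \<epsilon> \<le> s n) sequentially"
    using lim by (simp add: filterlim_at_top)
  then show ?thesis
  proof eventually_elim
    case (elim n)
    show ?case
    proof (intro allI impI)
      fix k assume "k < n"
      from bound[OF L(1) this] have "(b k)\<^sup>2 \<le> 2 / real L * s n + 2 * real L * A" .
      also have "\<dots> \<le> \<epsilon> / 2 * s n + \<epsilon> / 2 * s n"
        using elim \<epsilon> by (intro add_mono mult_right_mono L s0) (simp add: field_simps)
      finally show "(b k)\<^sup>2 \<le> \<epsilon> * s n" by simp
    qed
  qed
qed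

text \<open>Only the last \<open>J\<close> indices meet a coefficient \<open>a (n - 1 - k)\<close>
  that is not small, and a block of fixed length at the end has vanishing share in a convergent
  Cesaro mean.\<close>

lemma reversed_average_null:
  fixes a y :: "nat \<Rightarrow> real"
  assumes a: "a \<longlonglongrightarrow> 0"
    and y: "(\<lambda>n. (\<Sum>k<n. \<bar>y k\<bar>) / real n) \<longlonglongrightarrow> l"
  shows "(\<lambda>n. (\<Sum>k<n. \<bar>a (n - 1 - k)\<bar> * \<bar>y k\<bar>) / real n) \<longlonglongrightarrow> 0"
proof (rule LIMSEQ_I)
  fix r :: real assume r: "0 < r"
  let ?Y = "\<lambda>n. \<Sum>k<n. \<bar>y k\<bar>"
  obtain A where A: "\<And>n. \<bar>a n\<bar> \<le> A" and A0: "0 < A"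
    using convergent_imp_Bseq[OF convergentI[OF a]] unfolding Bseq_def by auto
  have l: "0 \<le> l" using y by (rule LIMSEQ_le_const) (auto intro!: sum_nonneg divide_nonneg_nonneg)
  \<comment> \<open>Adding 1 to \<open>l\<close> covers \<open>l = 0\<close> and still gives
    \<open>\<epsilon> * l < r\<close>.\<close>
  define \<epsilon> where "\<epsilon> = r / (2 * (l + 1))"
  have \<epsilon>: "0 < \<epsilon>" using r l by (simp add: \<epsilon>_def)
  obtain J where J: "\<And>j. J \<le> j \<Longrightarrow> \<bar>a j\<bar> < \<epsilon>"
    using LIMSEQ_D[OF a \<epsilon>] by auto
  have shift: "(\<lambda>n. ?Y (n - J) / real n) \<longlonglongrightarrow> l"
  proof -
    have "(\<lambda>n. ?Y n / real n * (real n / real (n + J))) \<longlonglongrightarrow> l * 1"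
    proof (intro tendsto_mult y)
      have "(\<lambda>n. 1 - real J * (1 / (real (n + J)))) \<longlonglongrightarrow> 1 - real J * 0"
        by (intro tendsto_intros LIMSEQ_ignore_initial_segment lim_1_over_n)
      moreover have "eventually (\<lambda>n. 1 - real J * (1 / (real (n + J))) = real n / real (n + J)) sequentially"
        using eventually_gt_at_top[of 0] by eventually_elim (simp add: field_simps)
      ultimately show "(\<lambda>n. real n / real (n + J)) \<longlonglongrightarrow> 1"
        by (simp add: filterlim_cong[OF refl refl])
    qed
    moreover have "eventually (\<lambda>n. ?Y n / real n * (real n / real (n + J)) = ?Y n / real (n + J)) sequentially"
      using eventually_gt_at_top[of 0] by eventually_elim simp
    ultimately have "(\<lambda>n. ?Y n / real (n + J)) \<longlonglongrightarrow> l * 1" by (rule Lim_transform_eventually)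
    then have "(\<lambda>n. ?Y (n + J - J) / real (n + J)) \<longlonglongrightarrow> l" by simp
    then show ?thesis by (rule LIMSEQ_offset)
  qed
  have "(\<lambda>n. \<epsilon> * (?Y n / real n) + A * (?Y n / real n - ?Y (n - J) / real n)) \<longlonglongrightarrow> \<epsilon> * l + A * (l - l)"
    by (intro tendsto_intros y shift)
  moreover have "\<epsilon> * l + A * (l - l) < r"
  proof -
    have "\<epsilon> * (2 * (l + 1)) = r" unfolding \<epsilon>_def using l by simp
    moreover have "\<epsilon> * l < \<epsilon> * (2 * (l + 1))" using l by (intro mult_strict_left_mono \<epsilon>) simp
    ultimately show ?thesis by simp
  qed
  ultimately have "eventually (\<lambda>n. \<epsilon> * (?Y n / real n) + A * (?Y n / real n - ?Y (n - J) / real n) < r) sequentially"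
    by (rule order_tendstoD)
  then have "eventually (\<lambda>n. norm ((\<Sum>k<n. \<bar>a (n - 1 - k)\<bar> * \<bar>y k\<bar>) / real n - 0) < r) sequentially"
    using eventually_ge_at_top[of "J + 1"]
  proof eventually_elim
    case (elim n)
    have split: "sum f {..<n} = sum f {..<n - J} + sum f {n - J..<n}" for f :: "nat \<Rightarrow> real"
      unfolding lessThan_atLeast0 by (rule sum.atLeastLessThan_concat[symmetric]) auto
    have "(\<Sum>k<n. \<bar>a (n - 1 - k)\<bar> * \<bar>y k\<bar>) = (\<Sum>k<n - J. \<bar>a (n - 1 - k)\<bar> * \<bar>y k\<bar>) + (\<Sum>k=n-J..<n. \<bar>a (n - 1 - k)\<bar> * \<bar>y k\<bar>)"
      by (rule split)
    also have "\<dots> \<le> (\<Sum>k<n - J. \<epsilon> * \<bar>y k\<bar>) + (\<Sum>k=n-J..<n. A * \<bar>y k\<bar>)"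
    proof (intro add_mono sum_mono mult_right_mono)
      fix k assume "k \<in> {..<n - J}"
      then have "J \<le> n - 1 - k" by auto
      from J[OF this] show "\<bar>a (n - 1 - k)\<bar> \<le> \<epsilon>" by simp
    qed (use A in auto)
    also have "\<dots> \<le> (\<Sum>k<n. \<epsilon> * \<bar>y k\<bar>) + (\<Sum>k=n-J..<n. A * \<bar>y k\<bar>)"
      using \<epsilon> by (intro add_mono sum_mono2) auto
    also have "\<dots> = \<epsilon> * ?Y n + A * (?Y n - ?Y (n - J))"
    proof -
      have "(\<Sum>k=n-J..<n. \<bar>y k\<bar>) = ?Y n - ?Y (n - J)" using split[of "\<lambda>k. \<bar>y k\<bar>"] by simp
      then show ?thesis unfolding sum_distrib_left[symmetric] by simp
    qed
    finally have "(\<Sum>k<n. \<bar>a (n - 1 - k)\<bar> * \<bar>y k\<bar>) / real n \<le> (\<epsilon> * ?Y n + A * (?Y n - ?Y (n - J))) / real n"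
      by (rule divide_right_mono) simp
    also have "\<dots> = \<epsilon> * (?Y n / real n) + A * (?Y n / real n - ?Y (n - J) / real n)"
      by (simp add: add_divide_distrib diff_divide_distrib[symmetric])
    finally have "(\<Sum>k<n. \<bar>a (n - 1 - k)\<bar> * \<bar>y k\<bar>) / real n < r" using elim(1) by simp
    moreover have "0 \<le> (\<Sum>k<n. \<bar>a (n - 1 - k)\<bar> * \<bar>y k\<bar>) / real n"
      by (intro divide_nonneg_nonneg sum_nonneg) auto
    ultimately show ?case by simp
  qed
  then show "\<exists>no. \<forall>n\<ge>no. norm ((\<Sum>k<n. \<bar>a (n - 1 - k)\<bar> * \<bar>y k\<bar>) / real n - 0) < r"
    by (simp add: eventually_sequentially)
qed

section \<open>Slowly varying weights of order 1/n\<close>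

text \<open>\<open>flat\<close> is condition (ii) cleared of its denominator, with
  \<open>s n\<close> for the variance.\<close>

locale flat_weights =
  fixes a b s :: "nat \<Rightarrow> real" and C :: real
  assumes a_lim: "a \<longlonglongrightarrow> 0"
    and b_eq: "\<And>j. b j = (\<Sum>i<j. a i)" and s_eq: "\<And>n. s n = (\<Sum>k<n. (b k)\<^sup>2)"
    and s_lim: "filterlim s at_top sequentially"
    and flat: "\<And>n k. 0 < s n \<Longrightarrow> k \<le> n \<Longrightarrow> real n * (b k)\<^sup>2 \<le> C * s n"
begin

text \<open>The index is reversed because \<open>E (int (Suc k))\<close> enters the centered sum
  with coefficient \<open>b (n - 1 - k)\<close>.\<close>

definition w :: "nat \<Rightarrow> nat \<Rightarrow> real" where
  "w n k = (b (n - 1 - k))\<^sup>2 / s n"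

lemma s_pos: "eventually (\<lambda>n. 0 < s n) sequentially"
  using s_lim by (auto simp: filterlim_at_top_dense)

text \<open>Some \<open>b k\<close> is nonzero, and \<open>flat\<close> for this single
  \<open>k\<close> with \<open>n\<close> growing is a linear lower bound.\<close>

lemma s_linear: "\<exists>\<delta>>0. eventually (\<lambda>n. \<delta> * real n \<le> s n) sequentially"
proof -
  obtain n where n: "0 < s n" using s_pos by (auto simp: eventually_sequentially)
  then obtain k where k: "b k \<noteq> 0" unfolding s_eq by (metis less_irrefl power_zero_numeral sum.neutral)
  have "eventually (\<lambda>n. (b k)\<^sup>2 * real n \<le> C * s n) sequentially"
    using s_pos eventually_ge_at_top[of k] by eventually_elim (use flat in \<open>simp add: mult.commute\<close>)
  then have "eventually (\<lambda>n. (b k)\<^sup>2 / (\<bar>C\<bar> + 1) * real n \<le> s n) sequentially"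
    using s_pos
  proof eventually_elim
    case (elim n)
    have "C * s n \<le> (\<bar>C\<bar> + 1) * s n" using elim by (intro mult_right_mono) auto
    with elim(1) have "(b k)\<^sup>2 * real n \<le> (\<bar>C\<bar> + 1) * s n" by simp
    then show ?case by (simp add: field_simps)
  qed
  moreover have "0 < (b k)\<^sup>2 / (\<bar>C\<bar> + 1)" using k by simp
  ultimately show ?thesis by blast
qed

lemma w_nonneg: "0 \<le> w n k"
  unfolding w_def s_eq by (intro divide_nonneg_nonneg sum_nonneg) auto

lemma w_le:
  assumes "0 < s n" shows "w n k \<le> C / real n"
proof (cases "n = 0")
  case False
  have "real n * (b (n - 1 - k))\<^sup>2 \<le> C * s n" by (rule flat[OF assms]) auto
  then show ?thesis using assms False by (simp add: w_def field_simps)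
qed (use assms in \<open>simp add: s_eq\<close>)

lemma sum_w:
  assumes "0 < s n" shows "(\<Sum>k<n. w n k) = 1"
proof -
  have "(\<Sum>k<n. w n k) = (\<Sum>k<n. (b (n - Suc k))\<^sup>2) / s n"
    by (simp add: w_def sum_divide_distrib)
  also have "(\<Sum>k<n. (b (n - Suc k))\<^sup>2) = s n"
    unfolding s_eq by (rule sum.nat_diff_reindex)
  finally show ?thesis using assms by simp
qed

text \<open>A difference of squares is \<open>a j\<close> times a sum of two values of
  \<open>b\<close>, and each of these is \<open>O(s n / n)\<close>. The factor \<open>a j\<close>,
  which tends to 0, is the gain over the trivial bound \<open>O(1 / n)\<close>.\<close>

lemma increment_le:
  "\<exists>D\<ge>0. eventually (\<lambda>n. \<forall>j<n. \<bar>(b (Suc j))\<^sup>2 - (b j)\<^sup>2\<bar> / s n \<le> D / real n * \<bar>a j\<bar>) sequentially"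
proof -
  obtain \<delta> where \<delta>: "0 < \<delta>" "eventually (\<lambda>n. \<delta> * real n \<le> s n) sequentially"
    using s_linear by auto
  define D where "D = 2 * sqrt (\<bar>C\<bar> / \<delta>)"
  have "eventually (\<lambda>n. \<forall>j<n. \<bar>(b (Suc j))\<^sup>2 - (b j)\<^sup>2\<bar> / s n \<le> D / real n * \<bar>a j\<bar>) sequentially"
    using \<delta>(2) s_pos eventually_gt_at_top[of 0]
  proof eventually_elim
    case (elim n)
    \<comment> \<open>The product of \<open>flat\<close> with the linear lower bound puts
      \<open>(s n)\<^sup>2\<close> on the right, so that a square root can be taken.\<close>
    have b_le: "\<bar>b k\<bar> / s n \<le> sqrt (\<bar>C\<bar> / \<delta>) / real n" if "k \<le> n" for k
    proof (rule power2_le_imp_le)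
      have "real n * (b k)\<^sup>2 \<le> \<bar>C\<bar> * s n"
        using flat[OF elim(2) that] elim(2) by (smt (verit) mult_right_mono)
      then have "real n * (b k)\<^sup>2 * (\<delta> * real n) \<le> \<bar>C\<bar> * s n * s n"
        by (rule mult_mono) (use elim \<delta> in auto)
      then show "(\<bar>b k\<bar> / s n)\<^sup>2 \<le> (sqrt (\<bar>C\<bar> / \<delta>) / real n)\<^sup>2"
        using elim \<delta> by (simp add: power_divide real_sqrt_pow2 field_simps power2_eq_square)
    qed (use \<delta> in simp)
    show ?case
    proof (intro allI impI)
      fix j assume j: "j < n"
      have "(b (Suc j))\<^sup>2 - (b j)\<^sup>2 = a j * (b (Suc j) + b j)"
        by (simp add: b_eq power2_eq_square algebra_simps)
      then have "\<bar>(b (Suc j))\<^sup>2 - (b j)\<^sup>2\<bar> / s n = \<bar>a j\<bar> * (\<bar>b (Suc j) + b j\<bar> / s n)"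
        by (simp add: abs_mult)
      also have "\<dots> \<le> \<bar>a j\<bar> * (\<bar>b (Suc j)\<bar> / s n + \<bar>b j\<bar> / s n)"
        using elim by (intro mult_left_mono) (auto simp: add_divide_distrib[symmetric] intro!: divide_right_mono)
      also have "\<dots> \<le> \<bar>a j\<bar> * (sqrt (\<bar>C\<bar> / \<delta>) / real n + sqrt (\<bar>C\<bar> / \<delta>) / real n)"
        using j by (intro mult_left_mono add_mono b_le) auto
      finally show "\<bar>(b (Suc j))\<^sup>2 - (b j)\<^sup>2\<bar> / s n \<le> D / real n * \<bar>a j\<bar>"
        by (simp add: D_def mult.commute)
    qed
  qed
  moreover have "0 \<le> D" using \<delta> by (simp add: D_def)
  ultimately show ?thesis by blast
qed

text \<open>Summation by parts moves the shift from \<open>y\<close> to the weights. Their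
  increments carry the reversed coefficients \<open>a (n - 1 - k)\<close>, which
  \<open>reversed_average_null\<close> handles.\<close>

lemma weighted_shift:
  assumes y: "(\<lambda>n. (\<Sum>k<n. \<bar>y k\<bar>) / real n) \<longlonglongrightarrow> l"
  shows "(\<lambda>n. (\<Sum>k<n. w n k * y (Suc k)) - (\<Sum>k<n. w n k * y k)) \<longlonglongrightarrow> 0"
proof -
  obtain D where D: "0 \<le> D" and inc: "eventually (\<lambda>n. \<forall>j<n. \<bar>(b (Suc j))\<^sup>2 - (b j)\<^sup>2\<bar> / s n \<le> D / real n * \<bar>a j\<bar>) sequentially"
    using increment_le by auto
  let ?R = "\<lambda>n. D * ((\<Sum>k<n. \<bar>a (n - 1 - k)\<bar> * \<bar>y k\<bar>) / real n) + C / real n * \<bar>y 0\<bar>"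
  have "(\<lambda>n. C / real n * \<bar>y 0\<bar>) \<longlonglongrightarrow> 0 * \<bar>y 0\<bar>"
    by (intro tendsto_mult_right lim_const_over_n)
  from tendsto_add[OF tendsto_mult_left[OF reversed_average_null[OF a_lim y], of D] this]
  have R: "?R \<longlonglongrightarrow> 0" by simp
  show ?thesis
  proof (rule Lim_null_comparison[OF _ R])
    show "eventually (\<lambda>n. norm ((\<Sum>k<n. w n k * y (Suc k)) - (\<Sum>k<n. w n k * y k)) \<le> ?R n) sequentially"
      using inc s_pos eventually_gt_at_top[of 0]
    proof eventually_elim
      case (elim n)
      let ?v = "\<lambda>j. (b j)\<^sup>2 / s n"
      have "(\<Sum>k<n. w n k * y (Suc k)) + ?v n * y 0 = (\<Sum>k<Suc n. ?v (n - k) * y k)"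
        by (simp add: w_def sum.lessThan_Suc_shift del: sum.lessThan_Suc)
      \<comment> \<open>The term \<open>k = n\<close> has the weight of \<open>b 0 = 0\<close>; the
        only boundary term left is the one at \<open>y 0\<close>.\<close>
      also have "\<dots> = (\<Sum>k<n. ?v (n - k) * y k)" by (simp add: b_eq)
      finally have "(\<Sum>k<n. w n k * y (Suc k)) - (\<Sum>k<n. w n k * y k) = (\<Sum>k<n. (?v (n - k) - w n k) * y k) - ?v n * y 0"
        by (simp add: left_diff_distrib sum_subtractf)
      also have "norm \<dots> \<le> (\<Sum>k<n. \<bar>(?v (n - k) - w n k) * y k\<bar>) + \<bar>?v n * y 0\<bar>"
        unfolding real_norm_def by (rule order_trans[OF abs_triangle_ineq4 add_right_mono[OF sum_abs]])
      also have "\<dots> \<le> (\<Sum>k<n. D / real n * (\<bar>a (n - 1 - k)\<bar> * \<bar>y k\<bar>)) + C / real n * \<bar>y 0\<bar>"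
      proof (intro add_mono sum_mono)
        fix k assume k: "k \<in> {..<n}"
        then have nk: "n - k = Suc (n - 1 - k)" by auto
        have "\<bar>?v (n - k) - w n k\<bar> = \<bar>(b (Suc (n - 1 - k)))\<^sup>2 - (b (n - 1 - k))\<^sup>2\<bar> / s n"
          unfolding w_def nk diff_divide_distrib[symmetric] using elim(2) by simp
        also have "\<dots> \<le> D / real n * \<bar>a (n - 1 - k)\<bar>" using elim(1) k by auto
        finally show "\<bar>(?v (n - k) - w n k) * y k\<bar> \<le> D / real n * (\<bar>a (n - 1 - k)\<bar> * \<bar>y k\<bar>)"
          unfolding abs_mult mult.assoc[symmetric] by (rule mult_right_mono) simp
      next
        have "?v n \<le> C / real n"
          using flat[OF elim(2) order_refl] elim(2,3) by (simp add: field_simps)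
        moreover have "0 \<le> ?v n" using elim(2) by simp
        ultimately show "\<bar>?v n * y 0\<bar> \<le> C / real n * \<bar>y 0\<bar>"
          unfolding abs_mult by (intro mult_right_mono) auto
      qed
      also have "\<dots> = ?R n" by (simp add: sum_distrib_left sum_divide_distrib)
      finally show ?case .
    qed
  qed
qed

lemma weighted_shifts:
  assumes y: "\<And>i. \<exists>l. (\<lambda>n. (\<Sum>k<n. \<bar>y (k + i)\<bar>) / real n) \<longlonglongrightarrow> l"
  shows "(\<lambda>n. (\<Sum>k<n. w n k * y (k + i)) - (\<Sum>k<n. w n k * y k)) \<longlonglongrightarrow> 0"
proof (induction i)
  case (Suc i)
  obtain l where "(\<lambda>n. (\<Sum>k<n. \<bar>y (k + i)\<bar>) / real n) \<longlonglongrightarrow> l" using y by blast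
  from tendsto_add[OF weighted_shift[OF this] Suc] show ?case by simp
qed simp

text \<open>The weights vary slowly, so the weighted sum does not change if the sequence is first averaged
  over windows of length \<open>q\<close>; as the weights are at most \<open>C / n\<close>, ordinary averages suffice then.\<close>

lemma weighted_average_lim:
  assumes y: "\<And>i. \<exists>l. (\<lambda>n. (\<Sum>k<n. \<bar>y (k + i)\<bar>) / real n) \<longlonglongrightarrow> l"
    and block: "\<And>q. 0 < q \<Longrightarrow> (\<lambda>n. (\<Sum>k<n. \<bar>(\<Sum>i<q. y (k + i)) / real q - \<gamma>\<bar>) / real n) \<longlonglongrightarrow> d q"
    and d: "d \<longlonglongrightarrow> 0"
  shows "(\<lambda>n. \<Sum>k<n. w n k * y k) \<longlonglongrightarrow> \<gamma>"
proof (rule LIMSEQ_I)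
  fix r :: real assume r: "0 < r"
  have "(\<lambda>q. C * d q) \<longlonglongrightarrow> C * 0" by (intro tendsto_mult_left d)
  then have "eventually (\<lambda>q. C * d q < r / 2) sequentially" by (rule order_tendstoD) (use r in simp)
  then have "eventually (\<lambda>q. 0 < q \<and> C * d q < r / 2) sequentially"
    using eventually_gt_at_top[of 0] by eventually_elim simp
  \<comment> \<open>The window length is fixed before \<open>n\<close> grows, so only finitely many
    shifts have to be compared.\<close>
  then obtain q where q: "0 < q" "C * d q < r / 2"
    by (auto simp: eventually_sequentially)
  let ?Y = "\<lambda>k. (\<Sum>i<q. y (k + i)) / real q"
  have "(\<lambda>n. (\<Sum>i<q. (\<Sum>k<n. w n k * y (k + i)) - (\<Sum>k<n. w n k * y k)) / real q) \<longlonglongrightarrow> (\<Sum>i<q. 0) / real q"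
    by (intro tendsto_divide tendsto_sum weighted_shifts y tendsto_const) (use q in simp)
  note lim0 = this
  have diff: "(\<lambda>n. \<bar>(\<Sum>k<n. w n k * ?Y k) - (\<Sum>k<n. w n k * y k)\<bar>) \<longlonglongrightarrow> 0"
  proof -
    have "(\<Sum>i<q. (\<Sum>k<n. w n k * y (k + i)) - (\<Sum>k<n. w n k * y k)) / real q = (\<Sum>k<n. w n k * ?Y k) - (\<Sum>k<n. w n k * y k)" for n
    proof -
      have "(\<Sum>i<q. \<Sum>k<n. w n k * y (k + i)) = (\<Sum>k<n. w n k * (\<Sum>i<q. y (k + i)))"
        by (subst sum.swap) (simp add: sum_distrib_left)
      moreover have "(\<Sum>k<n. w n k * ?Y k) = (\<Sum>k<n. w n k * (\<Sum>i<q. y (k + i))) / real q"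
        by (simp only: times_divide_eq_right sum_divide_distrib[symmetric])
      ultimately show ?thesis using q by (simp add: sum_subtractf diff_divide_distrib)
    qed
    with lim0 show ?thesis by (simp add: tendsto_rabs_zero)
  qed
  have "eventually (\<lambda>n. C * ((\<Sum>k<n. \<bar>?Y k - \<gamma>\<bar>) / real n) < r / 2) sequentially"
    by (rule order_tendstoD[OF tendsto_mult_left[OF block[OF q(1)]]]) (use q in simp)
  moreover have "eventually (\<lambda>n. \<bar>(\<Sum>k<n. w n k * ?Y k) - (\<Sum>k<n. w n k * y k)\<bar> < r / 2) sequentially"
    by (rule order_tendstoD[OF diff]) (use r in simp)
  ultimately have "eventually (\<lambda>n. norm ((\<Sum>k<n. w n k * y k) - \<gamma>) < r) sequentially"
    using s_pos
  proof eventually_elim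
    case (elim n)
    \<comment> \<open>The weights sum to 1, which allows \<gamma> under the sum.\<close>
    have "\<bar>(\<Sum>k<n. w n k * ?Y k) - \<gamma>\<bar> = \<bar>\<Sum>k<n. w n k * (?Y k - \<gamma>)\<bar>"
      using sum_w[OF elim(3)] by (simp add: right_diff_distrib sum_subtractf flip: sum_distrib_right)
    also have "\<dots> \<le> (\<Sum>k<n. \<bar>w n k * (?Y k - \<gamma>)\<bar>)" by (rule sum_abs)
    also have "\<dots> \<le> (\<Sum>k<n. C / real n * \<bar>?Y k - \<gamma>\<bar>)"
      unfolding abs_mult using w_le[OF elim(3)] w_nonneg by (intro sum_mono mult_right_mono) auto
    also have "\<dots> = C * ((\<Sum>k<n. \<bar>?Y k - \<gamma>\<bar>) / real n)"
      by (simp add: sum_distrib_left sum_divide_distrib)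
    finally have "\<bar>(\<Sum>k<n. w n k * ?Y k) - \<gamma>\<bar> < r / 2" using elim(1) by (rule le_less_trans)
    moreover have "\<bar>v - \<gamma>\<bar> \<le> \<bar>u - \<gamma>\<bar> + \<bar>u - v\<bar>" for u v :: real by linarith
    note this[of "\<Sum>k<n. w n k * y k" "\<Sum>k<n. w n k * ?Y k"]
    ultimately show ?case using elim(2) unfolding real_norm_def by linarith
  qed
  then show "\<exists>no. \<forall>n\<ge>no. norm ((\<Sum>k<n. w n k * y k) - \<gamma>) < r"
    by (simp add: eventually_sequentially)
qed

end

section \<open>Stationary martingale differences and centering\<close>

lemma (in prob_space) abs_expectation_le_L2_norm:
  assumes g: "g \<in> L2 M M"
  shows "integrable M g" "(\<integral>x. \<bar>g x\<bar> \<partial>M) \<le> L2_norm M g"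
proof -
  have [measurable]: "g \<in> borel_measurable M" and sq: "integrable M (\<lambda>x. (g x)\<^sup>2)"
    using g by (auto simp: L2_def)
  show int: "integrable M g" by (rule square_integrable_imp_integrable) (use sq in auto)
  have "0 \<le> (\<integral>x. (\<bar>g x\<bar>)\<^sup>2 \<partial>M) - (\<integral>x. \<bar>g x\<bar> \<partial>M)\<^sup>2"
    using variance_positive[of "\<lambda>x. \<bar>g x\<bar>"] variance_eq[of "\<lambda>x. \<bar>g x\<bar>"] int sq by simp
  then show "(\<integral>x. \<bar>g x\<bar> \<partial>M) \<le> L2_norm M g"
    unfolding L2_norm_def by (intro real_le_rsqrt) simp
qed

lemma (in finite_measure_subalgebra) cond_exp_L1_contraction:
  assumes X: "integrable M X"
  shows "(\<integral>x. \<bar>real_cond_exp M F X x\<bar> \<partial>M) \<le> (\<integral>x. \<bar>X x\<bar> \<partial>M)"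
proof -
  have aX: "integrable M (\<lambda>x. \<bar>X x\<bar>)" and nX: "integrable M (\<lambda>x. -1 * X x)" using X by auto
  have "AE x in M. \<bar>real_cond_exp M F X x\<bar> \<le> real_cond_exp M F (\<lambda>x. \<bar>X x\<bar>) x"
    using real_cond_exp_mono[OF _ X aX] real_cond_exp_mono[OF _ nX aX] real_cond_exp_cmult[OF X, of "-1"]
    by (auto simp: abs_le_iff)
  then have "(\<integral>x. \<bar>real_cond_exp M F X x\<bar> \<partial>M) \<le> (\<integral>x. real_cond_exp M F (\<lambda>x. \<bar>X x\<bar>) x \<partial>M)"
    by (intro integral_mono_AE) (auto intro: real_cond_exp_int X aX)
  also have "\<dots> = (\<integral>x. \<bar>X x\<bar> \<partial>M)" by (rule real_cond_exp_int[OF aX])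
  finally show ?thesis .
qed

text \<open>Subtracting an \<open>F\<close>-measurable function does not change the difference
  between \<open>R\<close> and its conditional expectation, and contraction bounds this by twice the
  L1 distance. The conclusion is a fixed-point equation because an L1 limit is
  \<open>F\<close>-measurable only up to a null set.\<close>

lemma (in finite_measure_subalgebra) cond_exp_L1_limit:
  assumes R: "integrable M R" and u: "\<And>N::nat. integrable M (u N)" "\<And>N. u N \<in> borel_measurable F"
    and lim: "(\<lambda>N. \<integral>x. \<bar>R x - u N x\<bar> \<partial>M) \<longlonglongrightarrow> 0"
  shows "AE x in M. real_cond_exp M F R x = R x"
proof -
  let ?I = "\<integral>x. \<bar>R x - real_cond_exp M F R x\<bar> \<partial>M"
  have RF: "integrable M (real_cond_exp M F R)" by (rule real_cond_exp_int[OF R])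
  have le: "?I \<le> 2 * (\<integral>x. \<bar>R x - u N x\<bar> \<partial>M)" for N
  proof -
    let ?g = "\<lambda>x. R x - u N x"
    have g: "integrable M ?g" using R u by auto
    have gF: "integrable M (real_cond_exp M F ?g)" by (rule real_cond_exp_int[OF g])
    have "AE x in M. \<bar>R x - real_cond_exp M F R x\<bar> \<le> \<bar>?g x\<bar> + \<bar>real_cond_exp M F ?g x\<bar>"
      using real_cond_exp_diff[OF R u(1)[of N]] real_cond_exp_F_meas[OF u(1)[of N] u(2)[of N]]
      by eventually_elim linarith
    then have "?I \<le> (\<integral>x. \<bar>?g x\<bar> + \<bar>real_cond_exp M F ?g x\<bar> \<partial>M)"
      by (intro integral_mono_AE) (use R RF g gF in auto)
    also have "\<dots> = (\<integral>x. \<bar>?g x\<bar> \<partial>M) + (\<integral>x. \<bar>real_cond_exp M F ?g x\<bar> \<partial>M)"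
      using g gF by (intro Bochner_Integration.integral_add) auto
    also have "\<dots> \<le> 2 * (\<integral>x. \<bar>?g x\<bar> \<partial>M)"
      using cond_exp_L1_contraction[OF g] by simp
    finally show ?thesis .
  qed
  have "?I \<le> 2 * 0"
    by (rule LIMSEQ_le_const[OF tendsto_mult_left[OF lim]]) (use le in blast)
  moreover have "0 \<le> ?I" by simp
  ultimately have "?I = 0" by linarith
  then have "AE x in M. \<bar>R x - real_cond_exp M F R x\<bar> = 0"
    by (subst (asm) integral_nonneg_eq_0_iff_AE) (use R RF in auto)
  then show ?thesis by eventually_elim simp
qed

section \<open>The shifted filtration and the stationary differences\<close>

locale filtered_system = prob_space M for M :: "'a measure" +
  fixes T :: "'a \<Rightarrow> 'a" and F :: "int \<Rightarrow> 'a measure" and e :: "'a \<Rightarrow> real"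
  assumes aut: "automorphism M T" and ergodic_T: "ergodic M T"
    and sub_F: "\<And>i. subalgebra M (F i)"
    and F_step: "\<And>i. sets (F i) \<subseteq> sets (F (i + 1))"
    and F_shift: "\<And>i. sets (F (i + 1)) = {T -` A \<inter> space M | A. A \<in> sets (F i)}"
    and e_ominus: "e \<in> L2_ominus M (F 0) (F (- 1))" and e_norm: "L2_norm M e = 1"
begin

abbreviation T' :: "'a \<Rightarrow> 'a" where "T' \<equiv> inv_into (space M) T"

lemma T_bij: "bij_betw T (space M) (space M)"
  using aut by (simp add: automorphism_def)

sublocale ergodic_system M T
proof unfold_locales
  show [measurable]: "T \<in> M \<rightarrow>\<^sub>M M" using aut by (simp add: automorphism_def)
  show "distr M M T = M"
    by (rule measure_eqI) (use aut in \<open>auto simp: automorphism_def emeasure_distr\<close>)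
  show "ergodic M T" by (rule ergodic_T)
qed

sublocale FF: finite_measure_subalgebra M "F i" for i
  by unfold_locales (rule sub_F)

lemma space_F [simp]: "space (F i) = space M"
  using sub_F[of i] by (simp add: subalgebra_def)

lemma sets_F: "sets (F i) \<subseteq> sets M"
  using sub_F[of i] by (simp add: subalgebra_def)

lemma F_le: "i \<le> j \<Longrightarrow> sets (F i) \<subseteq> sets (F j)"
proof (induction j rule: int_ge_induct)
  case (step j)
  then show ?case using F_step[of j] by auto
qed simp

lemma measurable_F_le: "i \<le> j \<Longrightarrow> g \<in> borel_measurable (F i) \<Longrightarrow> g \<in> borel_measurable (F j)"
  by (rule measurable_from_subalg[of "F j" "F i"]) (use F_le in \<open>auto simp: subalgebra_def\<close>)

lemma measurable_F_M: "g \<in> borel_measurable (F i) \<Longrightarrow> g \<in> borel_measurable M"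
  by (rule measurable_from_subalg[OF sub_F])

lemma T_space: "x \<in> space M \<Longrightarrow> T x \<in> space M"
  using T_bij by (auto dest: bij_betwE)

lemma T'_space: "x \<in> space M \<Longrightarrow> T' x \<in> space M"
  using bij_betw_inv_into[OF T_bij] by (auto dest: bij_betwE)

lemma T'_T: "x \<in> space M \<Longrightarrow> T' (T x) = x"
  by (rule bij_betw_inv_into_left[OF T_bij])

lemma T_T': "x \<in> space M \<Longrightarrow> T (T' x) = x"
  by (rule bij_betw_inv_into_right[OF T_bij])

lemma funpow_space: "x \<in> space M \<Longrightarrow> (T ^^ n) x \<in> space M"
  by (rule measurable_space[OF funpow_measurable])

lemma iter_T:
  assumes x: "x \<in> space M"
  shows "iter M T i (T x) = iter M T (i + 1) x"
proof (cases "0 \<le> i")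
  case True
  then have "nat (i + 1) = Suc (nat i)" by simp
  with True show ?thesis by (simp add: iter_def funpow_swap1)
next
  case False
  define k where "k = nat (- i - 1)"
  have k: "nat (- i) = Suc k" "nat (- (i + 1)) = k" using False by (auto simp: k_def)
  have "(T' ^^ Suc k) (T x) = (T' ^^ k) (T' (T x))" by (simp add: funpow_swap1)
  also have "\<dots> = (T' ^^ k) x" by (simp add: T'_T[OF x])
  finally have *: "iter M T i (T x) = (T' ^^ k) x" using False by (simp add: iter_def k)
  \<comment> \<open>At \<open>i = -1\<close> the definition of \<open>iter\<close> changes from
    powers of the inverse to powers of \<open>T\<close>.\<close>
  show ?thesis
  proof (cases "i = -1")
    case True
    then show ?thesis using * by (simp add: iter_def k_def)
  next
    case neq: False
    then have "\<not> 0 \<le> i + 1" using False by simp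
    then show ?thesis using * by (simp add: iter_def k_def)
  qed
qed

lemma iter_funpow: "x \<in> space M \<Longrightarrow> iter M T i ((T ^^ n) x) = iter M T (i + int n) x"
proof (induction n arbitrary: x)
  case (Suc n)
  have "iter M T i ((T ^^ Suc n) x) = iter M T i ((T ^^ n) (T x))" by (simp add: funpow_swap1)
  also have "\<dots> = iter M T (i + int n) (T x)" by (rule Suc.IH[OF T_space[OF Suc.prems]])
  also have "\<dots> = iter M T (i + int (Suc n)) x" by (simp add: iter_T[OF Suc.prems] ac_simps)
  finally show ?case .
qed simp

lemma iter_nat: "iter M T (int n) = T ^^ n"
  by (simp add: iter_def)

lemma T_F_measurable: "T \<in> F (i + 1) \<rightarrow>\<^sub>M F i"
  by (rule measurableI) (use T_space F_shift in auto)

text \<open>Every set of \<open>F (i + 1)\<close> is a \<open>T\<close>-preimage of a set of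
  \<open>F i\<close>, and pulling back by \<open>T'\<close> returns that set.\<close>

lemma T'_F_measurable: "T' \<in> F i \<rightarrow>\<^sub>M F (i + 1)"
proof (rule measurableI)
  fix A assume "A \<in> sets (F (i + 1))"
  then obtain B where B: "A = T -` B \<inter> space M" "B \<in> sets (F i)" using F_shift by auto
  then have "B \<subseteq> space M" using sets.sets_into_space by fastforce
  then have "T' -` A \<inter> space (F i) = B" using B(1) T'_space T_T' by auto
  then show "T' -` A \<inter> space (F i) \<in> sets (F i)" using B by simp
qed (use T'_space in simp)

lemma funpow_F_measurable: "T ^^ n \<in> F (i + int n) \<rightarrow>\<^sub>M F i"
proof (induction n arbitrary: i)
  case (Suc n)
  have "T \<circ> (T ^^ n) \<in> F (i + 1 + int n) \<rightarrow>\<^sub>M F i"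
    by (rule measurable_comp[OF Suc.IH T_F_measurable])
  then show ?case by (simp add: comp_def ac_simps)
qed simp

lemma iter_F_measurable: "iter M T j \<in> F (i + j) \<rightarrow>\<^sub>M F i"
proof (cases "0 \<le> j")
  case True
  then show ?thesis using funpow_F_measurable[of "nat j" i] by (simp add: iter_def)
next
  case False
  have *: "T' ^^ n \<in> F (i - int n) \<rightarrow>\<^sub>M F i" for n i
  proof (induction n arbitrary: i)
    case (Suc n)
    have "T' \<circ> (T' ^^ n) \<in> F (i - 1 - int n) \<rightarrow>\<^sub>M F (i - 1 + 1)"
      by (rule measurable_comp[OF Suc.IH T'_F_measurable])
    then show ?case by (simp add: comp_def algebra_simps)
  qed simp
  show ?thesis using *[of "nat (- j)" i] False by (simp add: iter_def)
qed

definition E :: "int \<Rightarrow> 'a \<Rightarrow> real" where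
  "E j x = e (iter M T j x)"

lemma e_meas: "e \<in> borel_measurable (F 0)" and e_sq: "integrable M (\<lambda>x. (e x)\<^sup>2)"
  using e_ominus by (auto simp: L2_ominus_def L2_def)

lemma e_meas_M [measurable]: "e \<in> borel_measurable M"
  by (rule measurable_F_M[OF e_meas])

lemma E_meas: "E j \<in> borel_measurable (F j)"
  using measurable_comp[OF iter_F_measurable[of j 0] e_meas] by (simp add: E_def[abs_def] comp_def)

lemma E_meas_M [measurable]: "E j \<in> borel_measurable M"
  by (rule measurable_F_M[OF E_meas])

lemma E_0: "E 0 x = e x"
  by (simp add: E_def iter_def)

lemma E_nat: "E (int n) x = e ((T ^^ n) x)"
  by (simp add: E_def iter_nat)

lemma E_funpow: "x \<in> space M \<Longrightarrow> E j ((T ^^ n) x) = E (j + int n) x"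
  by (simp add: E_def iter_funpow)

lemma E_sq: "integrable M (\<lambda>x. (E j x)\<^sup>2)" and E_norm: "(\<integral>x. (E j x)\<^sup>2 \<partial>M) = 1"
proof -
  have e1: "(\<integral>x. (e x)\<^sup>2 \<partial>M) = 1"
    using e_norm unfolding L2_norm_def by simp
  have nat: "integrable M (\<lambda>x. (E (int n) x)\<^sup>2) \<and> (\<integral>x. (E (int n) x)\<^sup>2 \<partial>M) = 1" for n
    unfolding E_nat using integrable_funpow[OF e_sq, of n] integral_funpow[of "\<lambda>x. (e x)\<^sup>2" n] e1 by simp
  have "integrable M (\<lambda>x. (E j x)\<^sup>2) \<and> (\<integral>x. (E j x)\<^sup>2 \<partial>M) = 1"
  proof (cases "0 \<le> j")
    case True
    then show ?thesis using nat[of "nat j"] by simp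
  next
    case False
    \<comment> \<open>Invariance is available for forward iterates, so \<open>E j\<close> with
      negative \<open>j\<close> is carried forward to \<open>e\<close>.\<close>
    let ?n = "nat (- j)"
    have eq: "(E j ((T ^^ ?n) x))\<^sup>2 = (e x)\<^sup>2" if "x \<in> space M" for x
      using E_funpow[OF that, of j ?n] False by (simp add: E_0)
    have "integrable (distr M M (T ^^ ?n)) (\<lambda>x. (E j x)\<^sup>2) \<longleftrightarrow> integrable M (\<lambda>x. (E j ((T ^^ ?n) x))\<^sup>2)"
      by (rule integrable_distr_eq) auto
    also have "\<dots> \<longleftrightarrow> integrable M (\<lambda>x. (e x)\<^sup>2)"
      by (rule Bochner_Integration.integrable_cong[OF refl]) (rule eq)
    finally have "integrable M (\<lambda>x. (E j x)\<^sup>2)" using e_sq by (simp add: distr_funpow)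
    moreover have "(\<integral>x. (E j x)\<^sup>2 \<partial>M) = (\<integral>x. (E j ((T ^^ ?n) x))\<^sup>2 \<partial>M)"
      by (rule integral_funpow[symmetric]) measurable
    moreover have "\<dots> = (\<integral>x. (e x)\<^sup>2 \<partial>M)"
      by (rule Bochner_Integration.integral_cong[OF refl]) (rule eq)
    ultimately show ?thesis using e1 by simp
  qed
  then show "integrable M (\<lambda>x. (E j x)\<^sup>2)" "(\<integral>x. (E j x)\<^sup>2 \<partial>M) = 1" by auto
qed

lemma E_int: "integrable M (E j)"
  by (rule square_integrable_imp_integrable[OF E_meas_M E_sq])

text \<open>Stationarity moves the test set from \<open>F k\<close> back to \<open>F (- 1)\<close>.\<close>

lemma integral_shifted:
  fixes u :: "'a \<Rightarrow> real"
  assumes u: "u \<in> borel_measurable M" and A: "A \<in> sets (F (int k))"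
    and 0: "\<And>B. B \<in> sets (F (- 1)) \<Longrightarrow> (\<integral>x. indicator B x * u x \<partial>M) = 0"
  shows "(\<integral>x. indicator A x * u ((T ^^ Suc k) x) \<partial>M) = 0"
proof -
  have *: "\<exists>B\<in>sets (F i). A = (T ^^ n) -` B \<inter> space M" if "A \<in> sets (F (i + int n))" for n i A
    using that
  proof (induction n arbitrary: i)
    case 0
    then show ?case using sets.sets_into_space by (intro bexI[of _ A]) fastforce+
  next
    case (Suc n)
    then have "A \<in> sets (F (i + 1 + int n))" by (simp add: ac_simps)
    from Suc.IH[OF this] obtain B where B: "B \<in> sets (F (i + 1))" "A = (T ^^ n) -` B \<inter> space M" by auto
    then obtain D where D: "D \<in> sets (F i)" "B = T -` D \<inter> space M" using F_shift by auto
    have "A = (T ^^ Suc n) -` D \<inter> space M" using B D funpow_space by auto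
    with D show ?case by blast
  qed
  obtain B where B: "B \<in> sets (F (- 1))" "A = (T ^^ Suc k) -` B \<inter> space M"
    using *[of A "- 1" "Suc k"] A by auto
  have [measurable]: "B \<in> sets M" using B sets_F by auto
  note [measurable] = u
  have "(\<integral>x. indicator A x * u ((T ^^ Suc k) x) \<partial>M) = (\<integral>x. indicator B ((T ^^ Suc k) x) * u ((T ^^ Suc k) x) \<partial>M)"
    by (rule Bochner_Integration.integral_cong) (auto simp: B(2) indicator_def)
  also have "\<dots> = (\<integral>x. indicator B x * u x \<partial>M)"
    by (rule integral_funpow[of "\<lambda>x. indicator B x * u x" "Suc k"]) measurable
  finally show ?thesis using 0[OF B(1)] by simp
qed

lemma e_orthogonal: "h \<in> L2 M (F (- 1)) \<Longrightarrow> (\<integral>x. e x * h x \<partial>M) = 0"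
  using e_ominus by (simp add: L2_ominus_def)

lemma e_martingale:
  assumes "B \<in> sets (F (- 1))"
  shows "(\<integral>x. indicator B x * e x \<partial>M) = 0"
proof -
  have [measurable]: "B \<in> sets M" using assms sets_F by auto
  have "(\<lambda>x. (indicator B x)\<^sup>2 :: real) = indicator B" by (auto simp: indicator_def)
  then have "indicator B \<in> L2 M (F (- 1))"
    using assms by (auto simp: L2_def less_top[symmetric])
  from e_orthogonal[OF this] show ?thesis by (simp add: mult.commute)
qed

lemma E_martingale:
  assumes "A \<in> sets (F (int k))"
  shows "(\<integral>x. indicator A x * E (int (Suc k)) x \<partial>M) = 0"
  unfolding E_nat by (rule integral_shifted[OF e_meas_M assms e_martingale])

text \<open>Stationarity moves the later factor to time 0; the earlier one is then square integrable
  and \<open>F (- 1)\<close>-measurable, hence orthogonal to \<open>e\<close>.\<close>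

lemma E_orthogonal:
  assumes "j < k"
  shows "integrable M (\<lambda>x. E (int j) x * E (int k) x)" "(\<integral>x. E (int j) x * E (int k) x \<partial>M) = 0"
proof -
  show "integrable M (\<lambda>x. E (int j) x * E (int k) x)"
  proof (rule Bochner_Integration.integrable_bound)
    show "integrable M (\<lambda>x. (E (int j) x)\<^sup>2 + (E (int k) x)\<^sup>2)" using E_sq by simp
    show "AE x in M. norm (E (int j) x * E (int k) x) \<le> norm ((E (int j) x)\<^sup>2 + (E (int k) x)\<^sup>2)"
    proof (rule AE_I2)
      fix x
      have "2 * \<bar>E (int j) x\<bar> * \<bar>E (int k) x\<bar> \<le> \<bar>E (int j) x\<bar>\<^sup>2 + \<bar>E (int k) x\<bar>\<^sup>2"
        by (rule sum_squares_bound)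
      moreover have "0 \<le> \<bar>E (int j) x\<bar> * \<bar>E (int k) x\<bar>" by simp
      ultimately have "\<bar>E (int j) x * E (int k) x\<bar> \<le> (E (int j) x)\<^sup>2 + (E (int k) x)\<^sup>2"
        unfolding abs_mult power2_abs by linarith
      then show "norm (E (int j) x * E (int k) x) \<le> norm ((E (int j) x)\<^sup>2 + (E (int k) x)\<^sup>2)"
        unfolding real_norm_def by (rule order_trans[OF _ abs_ge_self])
    qed
  qed measurable
  have "(\<integral>x. E (int j) x * E (int k) x \<partial>M) = (\<integral>x. E (int j - int k) ((T ^^ k) x) * e ((T ^^ k) x) \<partial>M)"
    by (rule Bochner_Integration.integral_cong) (auto simp: E_funpow E_nat)
  also have "\<dots> = (\<integral>x. E (int j - int k) x * e x \<partial>M)"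
    by (rule integral_funpow[of "\<lambda>x. E (int j - int k) x * e x" k]) measurable
  also have "\<dots> = 0"
  proof -
    have "E (int j - int k) \<in> borel_measurable (F (- 1))"
      by (rule measurable_F_le[OF _ E_meas]) (use assms in simp)
    then have "E (int j - int k) \<in> L2 M (F (- 1))" using E_sq by (auto simp: L2_def)
    from e_orthogonal[OF this] show ?thesis by (simp add: mult.commute)
  qed
  finally show "(\<integral>x. E (int j) x * E (int k) x \<partial>M) = 0" .
qed

lemma integral_linear_combination_sq:
  "(\<integral>x. (\<Sum>k<n. c k * E (int (Suc k)) x)\<^sup>2 \<partial>M) = (\<Sum>k<n. (c k)\<^sup>2)"
proof -
  have int: "integrable M (\<lambda>x. E (int j) x * E (int k) x)" for j k
    using E_orthogonal(1)[of j k] E_orthogonal(1)[of k j] E_sq[of "int k"]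
    by (cases j k rule: linorder_cases) (auto simp: mult.commute power2_eq_square)
  have val: "(\<integral>x. E (int j) x * E (int k) x \<partial>M) = (if j = k then 1 else 0)" for j k
    using E_orthogonal(2)[of j k] E_orthogonal(2)[of k j] E_norm[of "int k"]
    by (cases j k rule: linorder_cases) (auto simp: mult.commute power2_eq_square)
  have "(\<integral>x. (\<Sum>k<n. c k * E (int (Suc k)) x)\<^sup>2 \<partial>M)
    = (\<integral>x. (\<Sum>j<n. \<Sum>k<n. (c j * c k) * (E (int (Suc j)) x * E (int (Suc k)) x)) \<partial>M)"
    by (rule Bochner_Integration.integral_cong) (auto simp: power2_eq_square sum_product ac_simps)
  also have "\<dots> = (\<Sum>j<n. \<Sum>k<n. (c j * c k) * (\<integral>x. E (int (Suc j)) x * E (int (Suc k)) x \<partial>M))"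
    using int by (subst Bochner_Integration.integral_sum; (subst Bochner_Integration.integral_sum)?) (auto simp del: of_nat_Suc)
  also have "\<dots> = (\<Sum>j<n. \<Sum>k<n. if j = k then (c j)\<^sup>2 else 0)"
    unfolding val by (intro sum.cong) (auto simp: power2_eq_square)
  finally show ?thesis by simp
qed

lemma cond_exp_E_future: "AE x in M. real_cond_exp M (F 0) (E (int (Suc k))) x = 0"
proof (rule FF.real_cond_exp_charact)
  fix A assume "A \<in> sets (F 0)"
  then have "A \<in> sets (F (int k))" using F_le[of 0 "int k"] by auto
  from E_martingale[OF this] show "(\<integral>x\<in>A. E (int (Suc k)) x \<partial>M) = (\<integral>x\<in>A. 0 \<partial>M)"
    by (simp add: set_lebesgue_integral_def)
qed (auto intro: E_int)

text \<open>In \<open>f \<circ> T ^^ i\<close> the terms with nonpositive index are an \<open>L\<^sup>2\<close> limit of \<open>F 0\<close>-measurable functions,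
  so centering removes exactly these.\<close>

lemma cond_exp_past:
  assumes f: "L2_sums M (\<lambda>l x. a l * e (iter M T (- int l) x)) f"
  shows "integrable M (\<lambda>x. f ((T ^^ i) x) - (\<Sum>l<i. a l * E (int i - int l) x))"
    "AE x in M. real_cond_exp M (F 0) (\<lambda>x. f ((T ^^ i) x) - (\<Sum>l<i. a l * E (int i - int l) x)) x
      = f ((T ^^ i) x) - (\<Sum>l<i. a l * E (int i - int l) x)"
proof -
  let ?R = "\<lambda>x. f ((T ^^ i) x) - (\<Sum>l<i. a l * E (int i - int l) x)"
  \<comment> \<open>From \<open>l = i\<close> on the time index \<open>i - l\<close> is nonpositive,
    so these finite sums are \<open>F 0\<close>-measurable.\<close>
  let ?u = "\<lambda>N x. \<Sum>l=i..<i + N. a l * E (int i - int l) x"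
  let ?d = "\<lambda>N x. f x - (\<Sum>l<N. a l * E (- int l) x)"
  have f2: "f \<in> L2 M M" and lim: "(\<lambda>N. L2_norm M (?d N)) \<longlonglongrightarrow> 0"
    using f by (auto simp: L2_sums_def E_def)
  note [measurable] = conjunct1[OF f2[unfolded L2_def mem_Collect_eq]]
  have f_int: "integrable M f" by (rule abs_expectation_le_L2_norm[OF f2])
  \<comment> \<open>Membership matters: a function that is not square integrable has
    \<open>L2_norm\<close> 0 by convention, which would bound nothing.\<close>
  have d2: "?d N \<in> L2 M M" for N
  proof -
    have "integrable M (\<lambda>x. (?d N x)\<^sup>2)"
    proof (induction N)
      case 0
      then show ?case using f2 by (simp add: L2_def)
    next
      case (Suc N)
      show ?case
      proof (rule Bochner_Integration.integrable_bound)
        show "integrable M (\<lambda>x. 2 * (?d N x)\<^sup>2 + 2 * ((a N)\<^sup>2 * (E (- int N) x)\<^sup>2))"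
          using Suc E_sq by simp
        show "AE x in M. norm ((?d (Suc N) x)\<^sup>2) \<le> norm (2 * (?d N x)\<^sup>2 + 2 * ((a N)\<^sup>2 * (E (- int N) x)\<^sup>2))"
        proof (rule AE_I2)
          fix x
          have sq: "(p - q)\<^sup>2 \<le> 2 * p\<^sup>2 + 2 * q\<^sup>2" for p q :: real
            using zero_le_power2[of "p + q"] by (simp add: power2_sum power2_diff)
          have "(?d (Suc N) x)\<^sup>2 = (?d N x - a N * E (- int N) x)\<^sup>2" by (simp add: algebra_simps)
          also have "\<dots> \<le> 2 * (?d N x)\<^sup>2 + 2 * (a N * E (- int N) x)\<^sup>2" by (rule sq)
          also have "\<dots> = 2 * (?d N x)\<^sup>2 + 2 * ((a N)\<^sup>2 * (E (- int N) x)\<^sup>2)" by (simp only: power_mult_distrib)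
          finally show "norm ((?d (Suc N) x)\<^sup>2) \<le> norm (2 * (?d N x)\<^sup>2 + 2 * ((a N)\<^sup>2 * (E (- int N) x)\<^sup>2))"
            unfolding real_norm_def by (subst abs_of_nonneg) auto
        qed
      qed measurable
    qed
    then show ?thesis by (simp add: L2_def)
  qed
  show R: "integrable M ?R"
    using integrable_funpow[OF f_int, of i] E_int by auto
  show "AE x in M. real_cond_exp M (F 0) ?R x = ?R x"
  proof (rule FF.cond_exp_L1_limit[OF R])
    show "integrable M (?u N)" for N using E_int by auto
    show "?u N \<in> borel_measurable (F 0)" for N
    proof (intro borel_measurable_sum borel_measurable_times borel_measurable_const)
      fix l assume "l \<in> {i..<i + N}"
      then show "E (int i - int l) \<in> borel_measurable (F 0)" by (intro measurable_F_le[OF _ E_meas]) auto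
    qed
    have eq: "?R x - ?u N x = ?d (i + N) ((T ^^ i) x)" if x: "x \<in> space M" for N x
    proof -
      have "(\<Sum>l<i + N. a l * E (- int l) ((T ^^ i) x)) = (\<Sum>l<i + N. a l * E (int i - int l) x)"
        using E_funpow[OF x] by (intro sum.cong) auto
      also have "\<dots> = (\<Sum>l<i. a l * E (int i - int l) x) + ?u N x"
        unfolding lessThan_atLeast0 by (rule sum.atLeastLessThan_concat[symmetric]) auto
      finally show ?thesis by simp
    qed
    have "(\<lambda>N. L2_norm M (?d (i + N))) \<longlonglongrightarrow> 0"
      using LIMSEQ_ignore_initial_segment[OF lim, of i] by (simp add: add.commute)
    then show "(\<lambda>N. \<integral>x. \<bar>?R x - ?u N x\<bar> \<partial>M) \<longlonglongrightarrow> 0"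
    proof (rule Lim_null_comparison[rotated])
      show "eventually (\<lambda>N. norm (\<integral>x. \<bar>?R x - ?u N x\<bar> \<partial>M) \<le> L2_norm M (?d (i + N))) sequentially"
      proof (rule always_eventually, rule allI)
        fix N
        have "(\<integral>x. \<bar>?R x - ?u N x\<bar> \<partial>M) = (\<integral>x. \<bar>?d (i + N) ((T ^^ i) x)\<bar> \<partial>M)"
          by (rule Bochner_Integration.integral_cong[OF refl]) (simp only: eq)
        also have "\<dots> = (\<integral>x. \<bar>?d (i + N) x\<bar> \<partial>M)"
          by (rule integral_funpow[of "\<lambda>x. \<bar>?d (i + N) x\<bar>" i]) measurable
        also have "\<dots> \<le> L2_norm M (?d (i + N))" by (rule abs_expectation_le_L2_norm[OF d2])
        finally show "norm (\<integral>x. \<bar>?R x - ?u N x\<bar> \<partial>M) \<le> L2_norm M (?d (i + N))" by simp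
      qed
    qed
  qed
qed

text \<open>The difference at time \<open>k + 1\<close> occurs in \<open>f \<circ> T\<^sup>i\<close>
  for \<open>k < i < n\<close>, with coefficients \<open>a 0, ..., a (n - 2 - k)\<close>, and these
  add up to \<open>b (n - 1 - k)\<close>. The last term \<open>k = n - 1\<close> carries
  \<open>b 0 = 0\<close>.\<close>

lemma centered_birkhoff_sum:
  assumes f: "L2_sums M (\<lambda>l x. a l * e (iter M T (- int l) x)) f"
    and b: "b = (\<lambda>j. \<Sum>i<j. a i)"
  shows "AE x in M. cond_centered M (F 0) (birkhoff_sum T f n) x = (\<Sum>k<n. b (n - 1 - k) * E (int (Suc k)) x)"
proof -
  let ?R = "\<lambda>i x. f ((T ^^ i) x) - (\<Sum>l<i. a l * E (int i - int l) x)"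
  let ?W = "\<lambda>n x. \<Sum>k<n. b (n - 1 - k) * E (int (Suc k)) x"
  have W: "(\<Sum>i<n. \<Sum>l<i. a l * E (int i - int l) x) = ?W n x" for n x
  proof (induction n)
    case (Suc n)
    have "?W (Suc n) x = (\<Sum>k<n. b (n - k) * E (int (Suc k)) x)" by (simp add: b)
    also have "\<dots> = (\<Sum>k<n. b (n - 1 - k) * E (int (Suc k)) x + a (n - Suc k) * E (int (Suc k)) x)"
    proof (rule sum.cong[OF refl])
      fix k assume "k \<in> {..<n}"
      then have "n - k = Suc (n - 1 - k)" by auto
      then have "b (n - k) = b (n - 1 - k) + a (n - Suc k)" by (simp add: b)
      then show "b (n - k) * E (int (Suc k)) x = b (n - 1 - k) * E (int (Suc k)) x + a (n - Suc k) * E (int (Suc k)) x"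
        by (simp only: distrib_right)
    qed
    also have "\<dots> = ?W n x + (\<Sum>k<n. a (n - Suc k) * E (int n - int (n - Suc k)) x)"
      by (simp add: sum.distrib of_nat_diff del: of_nat_Suc cong: sum.cong_simp)
    also have "(\<Sum>k<n. a (n - Suc k) * E (int n - int (n - Suc k)) x) = (\<Sum>l<n. a l * E (int n - int l) x)"
      by (rule sum.nat_diff_reindex)
    finally show ?case using Suc by simp
  qed simp
  have S: "birkhoff_sum T f n = (\<lambda>x. (\<Sum>i<n. ?R i x) + ?W n x)"
    unfolding birkhoff_sum_def W[symmetric] by (simp add: sum_subtractf)
  have R_int: "integrable M (?R i)" for i by (rule cond_exp_past[OF f])
  have sumR_int: "integrable M (\<lambda>x. \<Sum>i<n. ?R i x)" using R_int by auto
  have W_int: "integrable M (?W n)" using E_int by auto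
  have cW: "AE x in M. real_cond_exp M (F 0) (?W n) x = 0"
  proof -
    have "AE x in M. \<forall>k. real_cond_exp M (F 0) (\<lambda>x. b (n - 1 - k) * E (int (Suc k)) x) x = 0"
      unfolding AE_all_countable
    proof
      fix k
      show "AE x in M. real_cond_exp M (F 0) (\<lambda>x. b (n - 1 - k) * E (int (Suc k)) x) x = 0"
        using FF.real_cond_exp_cmult[OF E_int, of 0 "b (n - 1 - k)" "int (Suc k)"] cond_exp_E_future[of k]
        by eventually_elim simp
    qed
    moreover have "AE x in M. real_cond_exp M (F 0) (?W n) x = (\<Sum>k<n. real_cond_exp M (F 0) (\<lambda>x. b (n - 1 - k) * E (int (Suc k)) x) x)"
      by (rule FF.real_cond_exp_sum) (intro integrable_mult_right E_int)
    ultimately show ?thesis by eventually_elim simp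
  qed
  have cR: "AE x in M. real_cond_exp M (F 0) (\<lambda>x. \<Sum>i<n. ?R i x) x = (\<Sum>i<n. ?R i x)"
  proof -
    have "AE x in M. \<forall>i. real_cond_exp M (F 0) (?R i) x = ?R i x"
      unfolding AE_all_countable using cond_exp_past(2)[OF f] by blast
    with FF.real_cond_exp_sum[OF R_int, of 0 "\<lambda>i. i" "{..<n}"] show ?thesis
      by eventually_elim simp
  qed
  have "AE x in M. real_cond_exp M (F 0) (birkhoff_sum T f n) x = (\<Sum>i<n. ?R i x)"
    unfolding S using FF.real_cond_exp_add[OF sumR_int W_int, of 0] cR cW by eventually_elim simp
  then show ?thesis
    by eventually_elim (simp add: cond_centered_def S)
qed

lemma L2_sums_meas: "L2_sums M u f \<Longrightarrow> f \<in> borel_measurable M"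
  by (simp add: L2_sums_def L2_def)

lemma sigma_bar_sq:
  assumes f: "L2_sums M (\<lambda>l x. a l * e (iter M T (- int l) x)) f"
    and b: "b = (\<lambda>j. \<Sum>i<j. a i)"
  shows "(sigma_bar M (F 0) T f n)\<^sup>2 = (\<Sum>k<n. (b k)\<^sup>2)"
proof -
  note [measurable] = L2_sums_meas[OF f]
  have [measurable]: "cond_centered M (F 0) (birkhoff_sum T f n) \<in> borel_measurable M"
    unfolding cond_centered_def[abs_def] by measurable
  have "(\<integral>x. (cond_centered M (F 0) (birkhoff_sum T f n) x)\<^sup>2 \<partial>M)
    = (\<integral>x. (\<Sum>k<n. b (n - 1 - k) * E (int (Suc k)) x)\<^sup>2 \<partial>M)"
    using centered_birkhoff_sum[OF f b, of n] by (intro integral_cong_AE) (auto simp del: of_nat_Suc)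
  also have "\<dots> = (\<Sum>k<n. (b (n - 1 - k))\<^sup>2)" by (rule integral_linear_combination_sq)
  also have "\<dots> = (\<Sum>k<n. (b k)\<^sup>2)"
    using sum.nat_diff_reindex[of "\<lambda>k. (b k)\<^sup>2" n] by simp
  finally show ?thesis
    unfolding sigma_bar_def by (simp add: sum_nonneg)
qed

end

section \<open>The quenched central limit theorem\<close>

context ergodic_system
begin

text \<open>The hypotheses of \<open>weighted_average_lim\<close> are ordinary ergodic averages of
  countably many functions, the shifts of \<open>u\<close> and the window errors
  \<open>?Y q\<close>, so one null set suffices. The means of the window errors tend to 0 by
  \<open>mean_ergodic_L1\<close>.\<close>

theorem weighted_birkhoff:
  assumes w: "flat_weights a b s C"
    and u: "integrable M u" and nonneg: "\<And>x. 0 \<le> u x"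
  shows "AE x in M. (\<lambda>n. \<Sum>k<n. (b (n - 1 - k))\<^sup>2 / s n * u ((T ^^ k) x)) \<longlonglongrightarrow> (\<integral>x. u x \<partial>M)"
proof -
  interpret flat_weights a b s C by (rule w)
  note [measurable] = borel_measurable_integrable[OF u]
  have pow: "(T ^^ i) ((T ^^ k) x) = (T ^^ (k + i)) x" for i k x
    by (simp add: funpow_add add.commute[of k i])
  have "AE x in M. \<forall>i. (\<lambda>n. birkhoff_sum T (\<lambda>x. \<bar>u ((T ^^ i) x)\<bar>) n x / real n) \<longlonglongrightarrow> (\<integral>x. \<bar>u ((T ^^ i) x)\<bar> \<partial>M)"
    unfolding AE_all_countable by (intro allI birkhoff integrable_abs integrable_funpow[OF u])
  moreover
  let ?Y = "\<lambda>q x. \<bar>birkhoff_sum T u q x / real q - (\<integral>x. u x \<partial>M)\<bar>"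
  have "integrable M (?Y q)" for q
    unfolding birkhoff_sum_def
    using integrable_funpow[OF u]
    by (intro integrable_abs Bochner_Integration.integrable_diff integrable_divide Bochner_Integration.integrable_sum) auto
  then have "AE x in M. \<forall>q. (\<lambda>n. birkhoff_sum T (?Y q) n x / real n) \<longlonglongrightarrow> (\<integral>x. ?Y q x \<partial>M)"
    unfolding AE_all_countable by (intro allI birkhoff)
  ultimately show ?thesis
  proof eventually_elim
    case (elim x)
    have "(\<lambda>n. \<Sum>k<n. w n k * u ((T ^^ k) x)) \<longlonglongrightarrow> (\<integral>x. u x \<partial>M)"
    proof (rule weighted_average_lim)
      show "\<exists>l. (\<lambda>n. (\<Sum>k<n. \<bar>u ((T ^^ (k + i)) x)\<bar>) / real n) \<longlonglongrightarrow> l" for i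
        using elim(1) unfolding birkhoff_sum_def pow by blast
      show "(\<lambda>n. (\<Sum>k<n. \<bar>(\<Sum>i<q. u ((T ^^ (k + i)) x)) / real q - (\<integral>x. u x \<partial>M)\<bar>) / real n)
          \<longlonglongrightarrow> (\<integral>x. ?Y q x \<partial>M)" for q
        using elim(2) unfolding birkhoff_sum_def pow by blast
      show "(\<lambda>q. \<integral>x. ?Y q x \<partial>M) \<longlonglongrightarrow> 0" by (rule mean_ergodic_L1[OF u nonneg])
    qed
    then show ?case by (simp add: w_def)
  qed
qed

end

section \<open>Conditional tails and the passage to the quenched measures\<close>

context filtered_system
begin

definition tail_mean :: "nat \<Rightarrow> real" where
  "tail_mean K = (\<integral>x. tail_square K (e x) \<partial>M)"

abbreviation tail_rce :: "nat \<Rightarrow> 'a \<Rightarrow> real" where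
  "tail_rce K \<equiv> real_cond_exp M (F (- 1)) (\<lambda>x. tail_square K (e x))"

text \<open>A version of \<^term>\<open>tail_rce K\<close> for which the inequalities relating different \<open>K\<close> hold everywhere.\<close>

definition cond_tail :: "nat \<Rightarrow> 'a \<Rightarrow> real" where
  "cond_tail K x = max (max 0 (max 0 (tail_rce 0 x) - real K)) (min (max 0 (tail_rce 0 x)) (tail_rce K x))"

lemma cond_tail_nonneg: "0 \<le> cond_tail K x"
  and cond_tail_le: "cond_tail K x \<le> cond_tail 0 x"
  and cond_tail_ge: "cond_tail 0 x \<le> real K + cond_tail K x"
  by (auto simp: cond_tail_def max_def min_def)

lemma cond_tail_meas: "cond_tail K \<in> borel_measurable (F (- 1))"
  unfolding cond_tail_def[abs_def] by measurable

lemma cond_tail_meas_M [measurable]: "cond_tail K \<in> borel_measurable M"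
  by (rule measurable_F_M[OF cond_tail_meas])

lemma tail_int: "integrable M (\<lambda>x. tail_square K (e x))"
  by (rule Bochner_Integration.integrable_bound[OF e_sq])
    (use tail_square_nonneg tail_square_le in auto)

lemma cond_tail_AE: "AE x in M. cond_tail K x = tail_rce K x"
proof -
  have "AE x in M. 0 \<le> tail_rce K x"
    using tail_square_nonneg by (intro FF.real_cond_exp_pos) auto
  moreover have "AE x in M. tail_rce K x \<le> tail_rce 0 x"
    using tail_square_le by (intro FF.real_cond_exp_mono tail_int) auto
  moreover have "AE x in M. tail_rce 0 x \<le> real K + tail_rce K x"
  proof -
    have K: "integrable M (\<lambda>x. real K)" by simp
    have "AE x in M. tail_rce 0 x \<le> real_cond_exp M (F (- 1)) (\<lambda>x. real K + tail_square K (e x)) x"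
      using tail_int[of K] by (intro FF.real_cond_exp_mono tail_int Bochner_Integration.integrable_add K AE_I2)
        (auto simp: tail_square_def)
    moreover have "AE x in M. real_cond_exp M (F (- 1)) (\<lambda>x. real K) x = real K"
      by (rule FF.real_cond_exp_F_meas[OF K]) simp
    ultimately show ?thesis
      using FF.real_cond_exp_add[OF K tail_int[of K], of "- 1"] by eventually_elim simp
  qed
  ultimately show ?thesis
    by eventually_elim (auto simp: cond_tail_def)
qed

lemma cond_tail_int: "integrable M (cond_tail K)"
  and cond_tail_mean: "(\<integral>x. cond_tail K x \<partial>M) = tail_mean K"
proof -
  have i: "integrable M (tail_rce K)" by (rule FF.real_cond_exp_int[OF tail_int])
  show "integrable M (cond_tail K)"
    by (rule integrable_cong_AE_imp[OF i _ AE_symmetric[OF cond_tail_AE]]) measurable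
  have "(\<integral>x. cond_tail K x \<partial>M) = (\<integral>x. tail_rce K x \<partial>M)"
    by (rule integral_cong_AE) (use cond_tail_AE in auto)
  then show "(\<integral>x. cond_tail K x \<partial>M) = tail_mean K"
    unfolding tail_mean_def using FF.real_cond_exp_int(2)[OF tail_int] by simp
qed

lemma cond_tail_martingale:
  assumes B: "B \<in> sets (F (- 1))"
  shows "(\<integral>x. indicator B x * (tail_square K (e x) - cond_tail K x) \<partial>M) = 0"
proof -
  have [measurable]: "B \<in> sets M" using B sets_F by auto
  have "(\<integral>x. indicator B x * (tail_square K (e x) - cond_tail K x) \<partial>M)
    = (\<integral>x. indicator B x * tail_square K (e x) \<partial>M) - (\<integral>x. indicator B x * cond_tail K x \<partial>M)"
    using integrable_mult_indicator[OF _ tail_int, of B K] integrable_mult_indicator[OF _ cond_tail_int, of B K]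
    by (simp add: right_diff_distrib)
  also have "(\<integral>x. indicator B x * cond_tail K x \<partial>M) = (\<integral>x. indicator B x * tail_rce K x \<partial>M)"
    by (rule integral_cong_AE) (use cond_tail_AE[of K] in auto)
  also have "\<dots> = (\<integral>x. indicator B x * tail_square K (e x) \<partial>M)"
    by (rule FF.real_cond_exp_intg(2)) (use integrable_mult_indicator[OF _ tail_int, of B K] B in auto)
  finally show ?thesis by simp
qed

lemma tail_mean_0: "tail_mean 0 = 1"
  using E_norm[of 0] by (simp add: tail_mean_def E_0)

lemma tail_mean_lim: "tail_mean \<longlonglongrightarrow> 0"
proof -
  have "tail_mean \<longlonglongrightarrow> (\<integral>x. 0 \<partial>M)"
    unfolding tail_mean_def[abs_def]
  proof (rule integral_dominated_convergence[where w = "\<lambda>x. (e x)\<^sup>2"])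
    show "AE x in M. (\<lambda>K. tail_square K (e x)) \<longlonglongrightarrow> 0"
    proof (rule AE_I2, rule tendsto_eventually)
      fix x
      obtain N :: nat where N: "(e x)\<^sup>2 < real N" using reals_Archimedean2 by blast
      show "eventually (\<lambda>K. tail_square K (e x) = 0) sequentially"
        using eventually_ge_at_top[of N]
        by eventually_elim (use N in \<open>auto simp: tail_square_def\<close>)
    qed
  qed (use e_sq tail_square_nonneg tail_square_le in auto)
  then show ?thesis by simp
qed

text \<open>A test set \<open>B\<close> of \<open>F 0\<close> also lies in \<open>F k\<close>, so
  \<open>A \<inter> B\<close> does, and the hypothesis applies to it.\<close>

lemma cond_exp_sets_0:
  assumes X: "integrable M X" and 0: "\<And>A. A \<in> sets (F (int k)) \<Longrightarrow> (\<integral>x. indicator A x * X x \<partial>M) = 0"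
    and A: "A \<in> sets (F (int k))"
  shows "AE x in M. real_cond_exp M (F 0) (\<lambda>x. indicator A x * X x) x = 0"
proof (rule FF.real_cond_exp_charact)
  have "A \<in> sets M" using A sets_F by auto
  then show "integrable M (\<lambda>x. indicator A x * X x)"
    using integrable_mult_indicator[OF _ X, of A] by simp
  fix B assume "B \<in> sets (F 0)"
  then have "B \<in> sets (F (int k))" using F_le[of 0 "int k"] by auto
  then have "A \<inter> B \<in> sets (F (int k))" using A by auto
  then show "(\<integral>x\<in>B. indicator A x * X x \<partial>M) = (\<integral>x\<in>B. 0 \<partial>M)"
    using 0[of "A \<inter> B"] by (simp add: set_lebesgue_integral_def indicator_inter_arith ac_simps)
qed auto

text \<open>The array requirements are brought to \<open>m \<omega>\<close> one by one. Each is a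
  countable family of almost sure statements, the martingale identities because \<open>G k\<close>
  is countably generated, so almost every \<omega> satisfies all of them at once.\<close>

theorem quenched_clt:
  assumes rcp: "regular_cond_prob M (F 0) m"
    and sq: "summable (\<lambda>i. (a i)\<^sup>2)"
    and b: "\<And>j. b j = (\<Sum>i<j. a i)" and s: "\<And>n. s n = (\<Sum>k<n. (b k)\<^sup>2)"
    and lim: "filterlim s at_top sequentially"
    and conv: "\<And>K. AE x in M. (\<lambda>n. \<Sum>k<n. (b (n - 1 - k))\<^sup>2 / s n * cond_tail K ((T ^^ Suc k) x)) \<longlonglongrightarrow> tail_mean K"
  shows "AE \<omega> in M. weak_conv_m
    (\<lambda>n. distr (m \<omega>) borel (\<lambda>x. \<Sum>k<n. b (n - 1 - k) / sqrt (s n) * E (int (Suc k)) x)) std_normal_distribution"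
proof -
  interpret D: disintegration M "F 0" m
    by unfold_locales (rule sub_F, rule rcp)
  define y where "y = case_sum (\<lambda>j. E (int (Suc j))) (\<lambda>(K, j) x. cond_tail K ((T ^^ Suc j) x))"
  \<comment> \<open>The bounds differ on purpose: at stage \<open>k\<close> the differences up to
    time \<open>k\<close> are known, whereas the conditional tails of the next difference must be
    included.\<close>
  define I :: "nat \<Rightarrow> (nat + nat \<times> nat) set" where "I k = Inl ` {..<k} \<union> Inr ` (UNIV \<times> {..k})" for k
  have "\<exists>H. countable H \<and> Int_stable H \<and> H \<subseteq> Pow (space M)
      \<and> (\<forall>i\<in>I k. y i \<in> borel_measurable (sigma (space M) H))
      \<and> (\<forall>N. space N = space M \<longrightarrow> (\<forall>i\<in>I k. y i \<in> borel_measurable N) \<longrightarrow> H \<subseteq> sets N)" for k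
  proof -
    have "countable (I k)" by simp
    from countable_generator[OF this, of "space M" y] show ?thesis by metis
  qed
  then obtain H where H: "\<And>k. countable (H k)" "\<And>k. Int_stable (H k)" "\<And>k. H k \<subseteq> Pow (space M)"
    and H_meas: "\<And>k i. i \<in> I k \<Longrightarrow> y i \<in> borel_measurable (sigma (space M) (H k))"
    and H_le: "\<And>k N. space N = space M \<Longrightarrow> (\<And>i. i \<in> I k \<Longrightarrow> y i \<in> borel_measurable N) \<Longrightarrow> H k \<subseteq> sets N"
    by metis
  define G where "G k = sigma (space M) (H k)" for k
  have space_G: "space (G k) = space M" for k
    unfolding G_def using H(3) by (rule space_measure_of)
  have sets_G: "sets (G k) = sigma_sets (space M) (H k)" for k
    unfolding G_def using H(3) by (rule sets_measure_of)
  have G_least: "sets (G k) \<subseteq> sets N" if "space N = space M" "\<And>i. i \<in> I k \<Longrightarrow> y i \<in> borel_measurable N" for k N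
    using sets.sigma_sets_subset[OF H_le[OF that, of k]] unfolding sets_G that(1) .
  have G_mono: "sets (G k) \<subseteq> sets (G (Suc k))" for k
  proof (rule G_least[OF space_G])
    fix i assume "i \<in> I k"
    then have "i \<in> I (Suc k)" by (auto simp: I_def)
    then show "y i \<in> borel_measurable (G (Suc k))" unfolding G_def by (rule H_meas)
  qed
  have cond_tail_F: "(\<lambda>x. cond_tail K ((T ^^ Suc j) x)) \<in> borel_measurable (F (int j))" for K j
    using measurable_comp[OF funpow_F_measurable[of "Suc j" "- 1"] cond_tail_meas[of K]] by (simp add: comp_def)
  have G_F: "sets (G k) \<subseteq> sets (F (int k))" for k
  proof (rule G_least[OF space_F])
    fix i assume "i \<in> I k"
    then consider j where "i = Inl j" "j < k" | K j where "i = Inr (K, j)" "j \<le> k"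
      by (auto simp: I_def)
    then show "y i \<in> borel_measurable (F (int k))"
    proof cases
      case 1
      then show ?thesis unfolding y_def by (auto intro!: measurable_F_le[OF _ E_meas])
    next
      case 2
      then show ?thesis unfolding y_def using measurable_F_le[OF _ cond_tail_F, of j "int k" K] by simp
    qed
  qed
  then have G_M: "sets (G k) \<subseteq> sets M" for k using sets_F by blast
  have E_G: "E (int (Suc k)) \<in> borel_measurable (G (Suc k))" for k
    using H_meas[of "Inl k" "Suc k"] by (simp add: I_def y_def G_def)
  have tail_G: "(\<lambda>x. cond_tail K ((T ^^ Suc k) x)) \<in> borel_measurable (G k)" for K k
    using H_meas[of "Inr (K, k)" k] by (simp add: I_def y_def G_def)
  have tail_int': "integrable M (\<lambda>x. cond_tail K ((T ^^ Suc k) x))" for K k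
    by (rule integrable_funpow[OF cond_tail_int])
  have diff_int: "integrable M (\<lambda>x. tail_square K (E (int (Suc k)) x) - cond_tail K ((T ^^ Suc k) x))" for K k
    unfolding E_nat by (intro Bochner_Integration.integrable_diff integrable_funpow[OF tail_int] tail_int')
  have mart: "AE \<omega> in M. \<forall>A\<in>sets (G k). (\<integral>x. indicator A x * E (int (Suc k)) x \<partial>m \<omega>) = 0" for k
  proof (rule D.AE_kernel_integral_sets_0[OF E_int sets_G H(1,2) G_M])
    fix A assume "A \<in> sets (G k)"
    then have A: "A \<in> sets (F (int k))" using G_F by auto
    show "AE x in M. real_cond_exp M (F 0) (\<lambda>x. indicator A x * E (int (Suc k)) x) x = 0"
      by (rule cond_exp_sets_0[OF E_int _ A]) (rule E_martingale)
  qed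
  have var: "AE \<omega> in M. \<forall>A\<in>sets (G k).
      (\<integral>x. indicator A x * (tail_square K (E (int (Suc k)) x) - cond_tail K ((T ^^ Suc k) x)) \<partial>m \<omega>) = 0" for k K
  proof (rule D.AE_kernel_integral_sets_0[OF diff_int sets_G H(1,2) G_M])
    fix A assume "A \<in> sets (G k)"
    then have A: "A \<in> sets (F (int k))" using G_F by auto
    have 0: "(\<integral>x. indicator A x * (tail_square K (E (int (Suc k)) x) - cond_tail K ((T ^^ Suc k) x)) \<partial>M) = 0"
      if "A \<in> sets (F (int k))" for A
      unfolding E_nat
      by (rule integral_shifted[of "\<lambda>x. tail_square K (e x) - cond_tail K x", OF _ that cond_tail_martingale]) measurable
    show "AE x in M. real_cond_exp M (F 0)
        (\<lambda>x. indicator A x * (tail_square K (E (int (Suc k)) x) - cond_tail K ((T ^^ Suc k) x))) x = 0"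
      by (rule cond_exp_sets_0[OF diff_int 0 A])
  qed
  have "AE \<omega> in M. \<forall>k. integrable (m \<omega>) (\<lambda>x. (E (int (Suc k)) x)\<^sup>2)"
    "AE \<omega> in M. \<forall>K k. integrable (m \<omega>) (\<lambda>x. cond_tail K ((T ^^ Suc k) x))"
    "AE \<omega> in M. \<forall>K. AE x in m \<omega>. (\<lambda>n. \<Sum>k<n. (b (n - 1 - k))\<^sup>2 / s n * cond_tail K ((T ^^ Suc k) x)) \<longlonglongrightarrow> tail_mean K"
    "AE \<omega> in M. \<forall>k. \<forall>A\<in>sets (G k). (\<integral>x. indicator A x * E (int (Suc k)) x \<partial>m \<omega>) = 0"
    "AE \<omega> in M. \<forall>k K. \<forall>A\<in>sets (G k).
      (\<integral>x. indicator A x * (tail_square K (E (int (Suc k)) x) - cond_tail K ((T ^^ Suc k) x)) \<partial>m \<omega>) = 0"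
    unfolding AE_all_countable
    by (intro allI D.AE_kernel_integrable E_sq tail_int' D.AE_kernel conv mart var)+
  then show ?thesis
    using AE_space
  proof eventually_elim
    case (elim \<omega>)
    have s0: "0 \<le> s n" for n unfolding s by (intro sum_nonneg) auto
    have c_sq: "(b k / sqrt (s n))\<^sup>2 = (b k)\<^sup>2 / s n" for k n
      using s0 by (simp add: power_divide)
    have "martingale_array (m \<omega>) G (\<lambda>k. E (int (Suc k))) (\<lambda>K k x. cond_tail K ((T ^^ Suc k) x))
        (\<lambda>n k. b (n - 1 - k) / sqrt (s n)) tail_mean"
    proof (intro martingale_array.intro martingale_array_axioms.intro)
      show "prob_space (m \<omega>)" by (rule D.kernel_prob_space[OF elim(6)])
      show "subalgebra (m \<omega>) (G k)" for k
        using G_M D.sets_kernel[OF elim(6)] D.space_kernel[OF elim(6)] space_G by (auto simp: subalgebra_def)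
      show "AE x in m \<omega>. (\<lambda>n. \<Sum>k<n. (b (n - 1 - k) / sqrt (s n))\<^sup>2 * cond_tail K ((T ^^ Suc k) x)) \<longlonglongrightarrow> tail_mean K" for K
        unfolding c_sq using elim(3) by blast
      show "eventually (\<lambda>n. \<forall>k<n. (b (n - 1 - k) / sqrt (s n))\<^sup>2 \<le> \<epsilon>) sequentially" if "0 < \<epsilon>" for \<epsilon>
      proof -
        have "eventually (\<lambda>n. 0 < s n) sequentially" using lim by (auto simp: filterlim_at_top_dense)
        then show ?thesis
          using partial_sums_negligible[OF sq b s lim that]
          by eventually_elim (auto simp: c_sq pos_divide_le_eq)
      qed
      show "integrable (m \<omega>) (\<lambda>x. (E (int (Suc k)) x)\<^sup>2)" for k
        using elim(1) by (rule spec)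
      show "integrable (m \<omega>) (\<lambda>x. cond_tail K ((T ^^ Suc k) x))" for K k
        using spec[OF spec[OF elim(2)]] .
      show "(\<integral>x. indicator A x * E (int (Suc k)) x \<partial>m \<omega>) = 0" if "A \<in> sets (G k)" for k A
        using bspec[OF spec[OF elim(4)] that] .
      show "(\<integral>x. indicator A x * (tail_square K (E (int (Suc k)) x) - cond_tail K ((T ^^ Suc k) x)) \<partial>m \<omega>) = 0"
        if "A \<in> sets (G k)" for K k A
        using bspec[OF spec[OF spec[OF elim(5)]] that] .
    qed (rule G_mono E_G tail_G cond_tail_nonneg cond_tail_le cond_tail_ge tail_mean_0 tail_mean_lim)+
    from martingale_array.martingale_clt[OF this] show ?case .
  qed
qed

text \<open>The array starts with the difference at time 1, so the ergodic theorem is applied to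
  \<open>cond_tail K\<close> composed with \<open>T\<close>, which has the same mean.\<close>

lemma conv_flat:
  assumes w: "flat_weights a b s C"
  shows "AE x in M. (\<lambda>n. \<Sum>k<n. (b (n - 1 - k))\<^sup>2 / s n * cond_tail K ((T ^^ Suc k) x)) \<longlonglongrightarrow> tail_mean K"
proof -
  have int: "integrable M (\<lambda>x. cond_tail K (T x))"
    using integrable_funpow[OF cond_tail_int[of K], of 1] by simp
  have mean: "(\<integral>x. cond_tail K (T x) \<partial>M) = tail_mean K"
    using integral_funpow[OF cond_tail_meas_M, of K 1] cond_tail_mean[of K] by simp
  from weighted_birkhoff[OF w int cond_tail_nonneg] show ?thesis
    unfolding mean by simp
qed

text \<open>Since \<open>e\<close> is independent of its past, its conditional tails are almost
  surely constant along the whole orbit, and weights of total 1 reproduce the constant without any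
  ergodic theorem.\<close>

lemma conv_indep:
  assumes indep: "indep_vars (\<lambda>_. borel) (\<lambda>i x. e (iter M T i x)) UNIV"
    and nat: "\<And>i. sets (F i) = sigma_sets (space M)
       (\<Union>j\<in>{..i}. {(\<lambda>x. e (iter M T j x)) -` B \<inter> space M | B. B \<in> sets borel})"
    and s: "\<And>n. s n = (\<Sum>k<n. (b k)\<^sup>2)" and lim: "filterlim s at_top sequentially"
  shows "AE x in M. (\<lambda>n. \<Sum>k<n. (b (n - 1 - k))\<^sup>2 / s n * cond_tail K ((T ^^ Suc k) x)) \<longlonglongrightarrow> tail_mean K"
proof -
  let ?G = "\<lambda>j. {(\<lambda>x. e (iter M T j x)) -` B \<inter> space M | B. B \<in> sets borel}"
  have Int_stable: "Int_stable (?G j)" for j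
  proof (rule Int_stableI)
    fix A B assume "A \<in> ?G j" "B \<in> ?G j"
    then obtain A' B' where "A = (\<lambda>x. e (iter M T j x)) -` A' \<inter> space M" "A' \<in> sets borel"
      "B = (\<lambda>x. e (iter M T j x)) -` B' \<inter> space M" "B' \<in> sets borel" by blast
    then show "A \<inter> B \<in> ?G j" by (intro CollectI exI[of _ "A' \<inter> B'"]) auto
  qed
  \<comment> \<open>Two blocks of indices, the strict past and time 0, are labelled by booleans so
    that grouping yields a pair of independent \<sigma>-algebras.\<close>
  have "indep_sets ?G (\<Union>t\<in>UNIV. case_bool {..- 1} {0} t)"
    using indep unfolding indep_vars_def2 by (auto intro: indep_sets_mono_index)
  then have "indep_sets (\<lambda>t. sigma_sets (space M) (\<Union>j\<in>case_bool {..- 1} {0} t. ?G j)) UNIV"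
    by (rule indep_sets_collect_sigma) (auto intro: Int_stable simp: disjoint_family_on_def split: bool.splits)
  then have ind: "indep_set (sets (F (- 1))) (sigma_sets (space M) (?G 0))"
    unfolding indep_set_def nat by (rule indep_sets_cong[THEN iffD1, rotated -1]) (auto split: bool.split)
  have prod: "(\<integral>x. indicator B x * tail_square K (e x) \<partial>M) = prob B * tail_mean K" if B: "B \<in> sets (F (- 1))" for B
  proof -
    have [measurable]: "B \<in> sets M" using B sets_F by auto
    \<comment> \<open>Treating \<open>B\<close> as a random variable makes the product rule for
      independent integrable variables applicable.\<close>
    have "indep_var borel (indicator B :: 'a \<Rightarrow> real) borel (\<lambda>x. tail_square K (e x))"
      unfolding indep_var_eq
    proof (intro conjI)
      have 1: "sigma_sets (space M) {(indicator B :: 'a \<Rightarrow> real) -` A \<inter> space M | A. A \<in> sets borel} \<subseteq> sets (F (- 1))"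
      proof -
        have "(indicator B :: 'a \<Rightarrow> real) \<in> borel_measurable (F (- 1))" using B by simp
        then have "{(indicator B :: 'a \<Rightarrow> real) -` A \<inter> space M | A. A \<in> sets borel} \<subseteq> sets (F (- 1))"
          using measurable_sets[of "indicator B :: 'a \<Rightarrow> real" "F (- 1)" borel] by auto
        from sets.sigma_sets_subset[OF this] show ?thesis by simp
      qed
      have 2: "sigma_sets (space M) {(\<lambda>x. tail_square K (e x)) -` A \<inter> space M | A. A \<in> sets borel} \<subseteq> sigma_sets (space M) (?G 0)"
      proof (rule sigma_sets_mono', rule subsetI)
        fix A assume "A \<in> {(\<lambda>x. tail_square K (e x)) -` A \<inter> space M | A. A \<in> sets borel}"
        then obtain A' where A': "A = (\<lambda>x. tail_square K (e x)) -` A' \<inter> space M" "A' \<in> sets borel" by blast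
        have "tail_square K -` A' \<inter> space borel \<in> sets borel"
          by (rule measurable_sets[OF tail_square_measurable A'(2)])
        then have "tail_square K -` A' \<in> sets borel" by simp
        then show "A \<in> ?G 0"
          using A' by (intro CollectI exI[of _ "tail_square K -` A'"]) (auto simp: iter_def)
      qed
      show "indep_set (sigma_sets (space M) {(indicator B :: 'a \<Rightarrow> real) -` A \<inter> space M | A. A \<in> sets borel})
          (sigma_sets (space M) {(\<lambda>x. tail_square K (e x)) -` A \<inter> space M | A. A \<in> sets borel})"
        using ind 1 2 unfolding indep_sets2_eq by blast
    qed measurable
    from indep_var_lebesgue_integral[OF this _ tail_int]
    show ?thesis by (simp add: tail_mean_def less_top[symmetric])
  qed
  have "AE x in M. tail_rce K x = tail_mean K"
  proof (rule FF.real_cond_exp_charact)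
    fix B assume B: "B \<in> sets (F (- 1))"
    then have [measurable]: "B \<in> sets M" using sets_F by auto
    show "(\<integral>x\<in>B. tail_square K (e x) \<partial>M) = (\<integral>x\<in>B. tail_mean K \<partial>M)"
      using prod[OF B] by (simp add: set_lebesgue_integral_def)
  qed (use tail_int in auto)
  with cond_tail_AE[of K] have "AE x in M. cond_tail K x = tail_mean K"
    by eventually_elim simp
  then have "AE x in M. \<forall>k. cond_tail K ((T ^^ Suc k) x) = tail_mean K"
    unfolding AE_all_countable by (intro allI AE_funpow)
  then show ?thesis
  proof eventually_elim
    case (elim x)
    have "eventually (\<lambda>n. 0 < s n) sequentially" using lim by (auto simp: filterlim_at_top_dense)
    then have "eventually (\<lambda>n. (\<Sum>k<n. (b (n - 1 - k))\<^sup>2 / s n * cond_tail K ((T ^^ Suc k) x)) = tail_mean K) sequentially"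
    proof eventually_elim
      case (elim n)
      have "(\<Sum>k<n. (b (n - Suc k))\<^sup>2) = s n" unfolding s by (rule sum.nat_diff_reindex)
      then have "(\<Sum>k<n. (b (n - 1 - k))\<^sup>2 / s n) = 1" using elim by (simp add: sum_divide_distrib[symmetric])
      then show ?case using \<open>\<forall>k. cond_tail K ((T ^^ Suc k) x) = tail_mean K\<close>
        by (simp only: sum_distrib_right[symmetric])
    qed
    then show ?case by (rule tendsto_eventually)
  qed
qed

end

theorem theorem1:
  fixes M :: "'a measure" and T :: "'a \<Rightarrow> 'a" and F :: "int \<Rightarrow> 'a measure"
    and m :: "'a \<Rightarrow> 'a measure" and e f :: "'a \<Rightarrow> real"
    and a b :: "nat \<Rightarrow> real" and S :: "nat \<Rightarrow> 'a \<Rightarrow> real" and \<sigma> :: "nat \<Rightarrow> real"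
  assumes "prob_space M"
    and "automorphism M T" and "ergodic M T"
    and "\<And>i. subalgebra M (F i)"
    and "\<And>i. sets (F i) \<subseteq> sets (F (i + 1))"
    and "\<And>i. sets (F (i + 1)) = {T -` A \<inter> space M | A. A \<in> sets (F i)}"
    and "regular_cond_prob M (F 0) m"
    and "e \<in> L2_ominus M (F 0) (F (- 1))" and "L2_norm M e = 1"
    and "summable (\<lambda>i. (a i)\<^sup>2)"
    and "L2_sums M (\<lambda>i x. a i * e (iter M T (- int i) x)) f"
    and S: "S = birkhoff_sum T f"
    and b: "b = (\<lambda>j. \<Sum>i<j. a i)"
    and \<sigma>: "\<sigma> = sigma_bar M (F 0) T f"
  shows "(\<forall>n\<ge>1. (\<sigma> n)\<^sup>2 = (\<Sum>k=1..n-1. (b (n - k))\<^sup>2)) \<and>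
    (filterlim (\<lambda>n. (\<sigma> n)\<^sup>2) at_top sequentially \<longrightarrow>
     (prob_space.indep_vars M (\<lambda>_. borel) (\<lambda>i x. e (iter M T i x)) UNIV \<and>
      (\<forall>i j. distr M borel (\<lambda>x. e (iter M T i x)) = distr M borel (\<lambda>x. e (iter M T j x))) \<and>
      (\<forall>i. sets (F i) = sigma_sets (space M)
         (\<Union>j\<in>{..i}. {(\<lambda>x. e (iter M T j x)) -` B \<inter> space M | B. B \<in> sets borel})))
     \<or> (SUP n\<in>{n. 1 \<le> n \<and> 0 < \<sigma> n}. MAX k\<in>{1..n}. ereal (real n * (b k)\<^sup>2 / (\<sigma> n)\<^sup>2)) < \<infinity> \<longrightarrow>
     (AE \<omega> in M. weak_conv_m
        (\<lambda>n. distr (m \<omega>) borel (\<lambda>x. cond_centered M (F 0) (S n) x / \<sigma> n))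
        std_normal_distribution))"
proof -
  interpret filtered_system M T F e
    by (intro filtered_system.intro filtered_system_axioms.intro assms)
  interpret D: disintegration M "F 0" m
    by (intro disintegration.intro disintegration_axioms.intro assms)
  note f = assms(11)
  have s: "(\<sigma> n)\<^sup>2 = (\<Sum>k<n. (b k)\<^sup>2)" for n
    unfolding \<sigma> by (rule sigma_bar_sq[OF f b])
  have \<sigma>_nonneg: "0 \<le> \<sigma> n" for n
    unfolding \<sigma> sigma_bar_def by simp
  have b': "b j = (\<Sum>i<j. a i)" for j by (simp add: b)
  have var: "(\<sigma> n)\<^sup>2 = (\<Sum>k=1..n-1. (b (n - k))\<^sup>2)" if "1 \<le> n" for n
  proof -
    have "(\<Sum>k=1..n-1. (b (n - k))\<^sup>2) = (\<Sum>k=1..n-1. (b k)\<^sup>2)"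
      by (rule sum.reindex_bij_witness[of _ "\<lambda>k. n - k" "\<lambda>k. n - k"]) auto
    \<comment> \<open>The index 0 can be added because \<open>b 0 = 0\<close>.\<close>
    also have "\<dots> = (\<Sum>k<n. (b k)\<^sup>2)"
      by (rule sum.mono_neutral_left) (auto simp: b Suc_le_eq)
    finally show ?thesis by (simp add: s)
  qed
  \<comment> \<open>The two alternatives enter only through \<open>conv\<close>, so the rest is done
    once for both.\<close>
  moreover have "AE \<omega> in M. weak_conv_m (\<lambda>n. distr (m \<omega>) borel (\<lambda>x. cond_centered M (F 0) (S n) x / \<sigma> n)) std_normal_distribution"
    if lim: "filterlim (\<lambda>n. (\<sigma> n)\<^sup>2) at_top sequentially"
      and conv: "\<And>K. AE x in M. (\<lambda>n. \<Sum>k<n. (b (n - 1 - k))\<^sup>2 / (\<sigma> n)\<^sup>2 * cond_tail K ((T ^^ Suc k) x)) \<longlonglongrightarrow> tail_mean K"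
  proof -
    \<comment> \<open>The quantifier over \<open>n\<close> stands inside, so that for almost every
      \<omega> the whole sequence of laws is replaced at once.\<close>
    have "AE x in M. \<forall>n. cond_centered M (F 0) (S n) x / \<sigma> n = (\<Sum>k<n. b (n - 1 - k) / sqrt ((\<sigma> n)\<^sup>2) * E (int (Suc k)) x)"
      unfolding AE_all_countable
    proof
      fix n
      show "AE x in M. cond_centered M (F 0) (S n) x / \<sigma> n = (\<Sum>k<n. b (n - 1 - k) / sqrt ((\<sigma> n)\<^sup>2) * E (int (Suc k)) x)"
        using centered_birkhoff_sum[OF f b, of n] unfolding S
        by eventually_elim (simp add: \<sigma>_nonneg sum_divide_distrib)
    qed
    then have "AE \<omega> in M. AE x in m \<omega>. \<forall>n. cond_centered M (F 0) (S n) x / \<sigma> n = (\<Sum>k<n. b (n - 1 - k) / sqrt ((\<sigma> n)\<^sup>2) * E (int (Suc k)) x)"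
      by (rule D.AE_kernel)
    then show ?thesis
      using quenched_clt[OF assms(7,10) b' s lim conv] AE_space
    proof eventually_elim
      case (elim \<omega>)
      have [measurable]: "f \<in> borel_measurable M" by (rule L2_sums_meas[OF f])
      have [measurable]: "S n \<in> borel_measurable M" for n unfolding S by measurable
      have "distr (m \<omega>) borel (\<lambda>x. cond_centered M (F 0) (S n) x / \<sigma> n)
        = distr (m \<omega>) borel (\<lambda>x. \<Sum>k<n. b (n - 1 - k) / sqrt ((\<sigma> n)\<^sup>2) * E (int (Suc k)) x)" for n
      proof (rule distr_cong_AE[OF refl refl])
        show "AE x in m \<omega>. cond_centered M (F 0) (S n) x / \<sigma> n = (\<Sum>k<n. b (n - 1 - k) / sqrt ((\<sigma> n)\<^sup>2) * E (int (Suc k)) x)"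
          using elim(1) by eventually_elim blast
        show "(\<lambda>x. cond_centered M (F 0) (S n) x / \<sigma> n) \<in> borel_measurable (m \<omega>)"
          unfolding cond_centered_def by (subst measurable_cong_sets[OF D.sets_kernel[OF elim(3)] refl]) measurable
        show "(\<lambda>x. \<Sum>k<n. b (n - 1 - k) / sqrt ((\<sigma> n)\<^sup>2) * E (int (Suc k)) x) \<in> borel_measurable (m \<omega>)"
          by (subst measurable_cong_sets[OF D.sets_kernel[OF elim(3)] refl]) measurable
      qed
      with elim(2) show ?case by simp
    qed
  qed
  moreover have "AE x in M. (\<lambda>n. \<Sum>k<n. (b (n - 1 - k))\<^sup>2 / (\<sigma> n)\<^sup>2 * cond_tail K ((T ^^ Suc k) x)) \<longlonglongrightarrow> tail_mean K"
    if lim: "filterlim (\<lambda>n. (\<sigma> n)\<^sup>2) at_top sequentially"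
      and sup: "(SUP n\<in>{n. 1 \<le> n \<and> 0 < \<sigma> n}. MAX k\<in>{1..n}. ereal (real n * (b k)\<^sup>2 / (\<sigma> n)\<^sup>2)) < \<infinity>" for K
  proof -
    \<comment> \<open>A supremum below infinity in the extended reals is exceeded by some natural
      number, which serves as the constant of \<open>flat_weights\<close>.\<close>
    obtain C :: nat where C: "(SUP n\<in>{n. 1 \<le> n \<and> 0 < \<sigma> n}. MAX k\<in>{1..n}. ereal (real n * (b k)\<^sup>2 / (\<sigma> n)\<^sup>2)) < ereal (real C)"
      using sup less_PInf_Ex_of_nat by (auto simp: less_top)
    have "flat_weights a b (\<lambda>n. (\<sigma> n)\<^sup>2) (real C)"
    proof
      show "a \<longlonglongrightarrow> 0"
        using tendsto_real_sqrt[OF summable_LIMSEQ_zero[OF assms(10)]] by (simp add: tendsto_rabs_zero_iff)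
      fix n k :: nat assume n: "0 < (\<sigma> n)\<^sup>2" and k: "k \<le> n"
      show "real n * (b k)\<^sup>2 \<le> real C * (\<sigma> n)\<^sup>2"
      \<comment> \<open>The maximum in (ii) starts at \<open>k = 1\<close>; for \<open>k = 0\<close>
        the bound is trivial because \<open>b 0 = 0\<close>.\<close>
      proof (cases "k = 0")
        case False
        have \<sigma>n: "0 < \<sigma> n" using n \<sigma>_nonneg[of n] by (simp add: less_le)
        have "ereal (real n * (b k)\<^sup>2 / (\<sigma> n)\<^sup>2) \<le> (MAX k\<in>{1..n}. ereal (real n * (b k)\<^sup>2 / (\<sigma> n)\<^sup>2))"
          using False k by (intro Max_ge) auto
        also have "\<dots> \<le> (SUP n\<in>{n. 1 \<le> n \<and> 0 < \<sigma> n}. MAX k\<in>{1..n}. ereal (real n * (b k)\<^sup>2 / (\<sigma> n)\<^sup>2))"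
          using False k \<sigma>n by (intro SUP_upper) auto
        also note C
        finally show ?thesis using n by (simp add: field_simps)
      qed (simp add: b)
    qed (use b' s lim in auto)
    from conv_flat[OF this] show ?thesis .
  qed
  moreover note conv_indep[OF _ _ s, of K for K]
  ultimately show ?thesis by blast
qed

end
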